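(* Let $\mathbb K$ be an algebraically closed field of characteristic zero and $n\ge 3$. Let $g=x_n^d-x_{n-1}^m h\in \mathbb K[x_1,\ldots,x_n]$, with $d>m\ge 1$ and $h\in\mathbb K[x_1,\ldots,x_{n-2}]$ a reduced homogeneous polynomial of degree $d-m\geq 2$. Then: (i) $g$ is a nonfree divisor. (ii) If $h$ is a free divisor (in $\mathbb K[x_1,\ldots,x_{n-2}]$), then $f:=gh$ is a free divisor; if, moreover, the gradient ideal $J_h$ is an ideal of linear type in $\mathbb K[x_1,\ldots,x_{n-2}]$, then the gradient ideal $J_f\subset\mathbb K[x_1,\ldots,x_n]$ is of linear type.
   Context: For a squarefree polynomial $F$ in a polynomial ring $R$ over $\mathbb K$, $D_F=\{\theta\in{\rm Der}_{\mathbb K}(R):\theta(F)\in\langle F\rangle\}$, and $F$ (or $V(F)$) is a free divisor if $D_F$ is a free $R$-module; for a homogeneous squarefree $F$ with singular hypersurface this is equivalent to the gradient ideal $J_F$ (generated by all partial derivatives of $F$) being a perfect ideal of codimension $2$. An ideal is of linear type if the canonical surjection from its symmetric algebra to its Rees algebra is an isomorphism. *)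

theory Defs
  imports
    "HOL-Library.Poly_Mapping"
    "HOL-Computational_Algebra.Polynomial"
    "HOL-Algebra.QuotRing"
    "HOL-Algebra.Ideal_Product"
    "HOL-Algebra.Module"
    "HOL-Algebra.Divisibility"
begin

section \<open>Multivariate polynomials\<close>

text \<open>A polynomial maps exponent vectors to coefficients; multiplication is convolution.\<close>

type_synonym ('v, 'a) mpoly = "('v \<Rightarrow>\<^sub>0 nat) \<Rightarrow>\<^sub>0 'a"

definition Var :: "'v \<Rightarrow> ('v, 'a::comm_ring_1) mpoly" where
  "Var v = Poly_Mapping.single (Poly_Mapping.single v 1) 1"

definition Const :: "'a \<Rightarrow> ('v, 'a::comm_ring_1) mpoly" where
  "Const c = Poly_Mapping.single 0 c"

text \<open>The set \<open>A[T\<^sub>v | v \<in> V]\<close>, for a subring \<open>A\<close> of the coefficient type.\<close>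

definition mpolys :: "'a::comm_ring_1 set \<Rightarrow> 'v set \<Rightarrow> ('v, 'a) mpoly set" where
  "mpolys A V = {p. \<forall>m. Poly_Mapping.lookup p m \<in> A \<and>
     (Poly_Mapping.lookup p m \<noteq> 0 \<longrightarrow> Poly_Mapping.keys m \<subseteq> V)}"

definition ring_on :: "'a::comm_ring_1 set \<Rightarrow> 'a ring" where
  "ring_on A = \<lparr>carrier = A, mult = (*), one = 1, zero = 0, add = (+)\<rparr>"

text \<open>\<open>K[x\<^sub>1, \<dots>, x\<^sub>n]\<close>, where \<open>K\<close> is the whole coefficient type and \<open>x\<^sub>i = Var i\<close>. For
  \<open>k \<le> n\<close> the carrier of \<open>mpoly_ring k\<close> is contained in that of \<open>mpoly_ring n\<close>.\<close>

definition mpoly_ring :: "nat \<Rightarrow> (nat, 'k::field) mpoly ring" where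
  "mpoly_ring n = ring_on (mpolys UNIV {1..n})"

definition homogeneous :: "nat \<Rightarrow> ('v, 'a::zero) mpoly \<Rightarrow> bool" where
  "homogeneous d p \<longleftrightarrow>
     (\<forall>m\<in>Poly_Mapping.keys p. (\<Sum>v\<in>Poly_Mapping.keys m. Poly_Mapping.lookup m v) = d)"

definition partial_deriv :: "'v \<Rightarrow> ('v, 'a::comm_ring_1) mpoly \<Rightarrow> ('v, 'a) mpoly" where
  "partial_deriv v p =
     (\<Sum>m\<in>Poly_Mapping.keys p. Poly_Mapping.single (m - Poly_Mapping.single v 1)
                      (of_nat (Poly_Mapping.lookup m v) * Poly_Mapping.lookup p m))"

definition gradient_ideal :: "nat \<Rightarrow> (nat, 'k::field) mpoly \<Rightarrow> (nat, 'k) mpoly set" where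
  "gradient_ideal n F = Idl\<^bsub>mpoly_ring n\<^esub> ((\<lambda>i. partial_deriv i F) ` {1..n})"

text \<open>In particular \<open>0\<close> is not squarefree (unless the ring is trivial).\<close>

definition squarefree_in :: "('a, 'm) ring_scheme \<Rightarrow> 'a \<Rightarrow> bool" where
  "squarefree_in R a \<longleftrightarrow> a \<in> carrier R \<and>
     (\<forall>p\<in>carrier R. (p \<otimes>\<^bsub>R\<^esub> p) divides\<^bsub>R\<^esub> a \<longrightarrow> p \<in> Units R)"


section \<open>Free divisors\<close>

text \<open>\<open>Der\<^sub>K(K[x\<^sub>1, \<dots>, x\<^sub>n])\<close>. Derivations are extensional functions, so that
  equality of functions is equality on the carrier.\<close>

definition derivations :: "nat \<Rightarrow> ((nat, 'k::field) mpoly \<Rightarrow> (nat, 'k) mpoly) set" where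
  "derivations n = (let P = carrier (mpoly_ring n) in
     {\<theta> \<in> P \<rightarrow>\<^sub>E P.
        (\<forall>p\<in>P. \<forall>q\<in>P. \<theta> (p + q) = \<theta> p + \<theta> q) \<and>
        (\<forall>c. \<forall>p\<in>P. \<theta> (Const c * p) = Const c * \<theta> p) \<and>
        (\<forall>p\<in>P. \<forall>q\<in>P. \<theta> (p * q) = \<theta> p * q + p * \<theta> q)})"

text \<open>The module \<open>D\<^sub>F = {\<theta> | \<theta>(F) \<in> \<langle>F\<rangle>}\<close> with pointwise operations. The library's
  module record also has multiplication fields, which play no role.\<close>

definition log_derivations ::
    "nat \<Rightarrow> (nat, 'k::field) mpoly \<Rightarrow>
     ((nat, 'k) mpoly, (nat, 'k) mpoly \<Rightarrow> (nat, 'k) mpoly) module" where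
  "log_derivations n F = (let P = carrier (mpoly_ring n) in
     \<lparr>carrier = {\<theta> \<in> derivations n. \<theta> F \<in> PIdl\<^bsub>mpoly_ring n\<^esub> F},
      mult = undefined, one = undefined,
      zero = (\<lambda>p\<in>P. 0),
      add = (\<lambda>\<theta> \<eta>. \<lambda>p\<in>P. \<theta> p + \<eta> p),
      smult = (\<lambda>r \<theta>. \<lambda>p\<in>P. r * \<theta> p)\<rparr>)"

text \<open>Each element is a unique finite linear combination of elements of \<open>B\<close>.\<close>

definition module_basis :: "('a, 'm) ring_scheme \<Rightarrow> ('a, 'b, 'n) module_scheme \<Rightarrow> 'b set \<Rightarrow> bool" where
  "module_basis R M B \<longleftrightarrow> B \<subseteq> carrier M \<and>
     (\<forall>x\<in>carrier M. \<exists>!c. c \<in> B \<rightarrow>\<^sub>E carrier R \<and> finite {b\<in>B. c b \<noteq> \<zero>\<^bsub>R\<^esub>} \<and>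
        x = (\<Oplus>\<^bsub>M\<^esub>b\<in>{b\<in>B. c b \<noteq> \<zero>\<^bsub>R\<^esub>}. c b \<odot>\<^bsub>M\<^esub> b))"

definition free_module :: "('a, 'm) ring_scheme \<Rightarrow> ('a, 'b, 'n) module_scheme \<Rightarrow> bool" where
  "free_module R M \<longleftrightarrow> module R M \<and> (\<exists>B. module_basis R M B)"

definition free_divisor :: "nat \<Rightarrow> (nat, 'k::field) mpoly \<Rightarrow> bool" where
  "free_divisor n F \<longleftrightarrow>
     squarefree_in (mpoly_ring n) F \<and> free_module (mpoly_ring n) (log_derivations n F)"

definition nonfree_divisor :: "nat \<Rightarrow> (nat, 'k::field) mpoly \<Rightarrow> bool" where
  "nonfree_divisor n F \<longleftrightarrow>
     squarefree_in (mpoly_ring n) F \<and> \<not> free_module (mpoly_ring n) (log_derivations n F)"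


section \<open>Ideals of linear type\<close>

text \<open>In this section \<open>A\<close> is a subring of the type and \<open>I\<close> an ideal of \<open>A\<close>. The symmetric
  algebra of the \<open>A\<close>-module \<open>I\<close> is \<open>A[T\<^sub>a | a \<in> I]\<close>, with one variable for
  \<^emph>\<open>each\<close> element of \<open>I\<close>, modulo the relations making \<open>a \<mapsto> T\<^sub>a\<close> an \<open>A\<close>-linear map.\<close>

definition sym_relations :: "'a::comm_ring_1 set \<Rightarrow> 'a set \<Rightarrow> ('a, 'a) mpoly set" where
  "sym_relations A I =
     {Var (a + b) - Var a - Var b | a b. a \<in> I \<and> b \<in> I} \<union>
     {Var (r * a) - Const r * Var a | r a. r \<in> A \<and> a \<in> I}"

definition sym_algebra :: "'a::comm_ring_1 set \<Rightarrow> 'a set \<Rightarrow> ('a, 'a) mpoly set ring" where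
  "sym_algebra A I =
     ring_on (mpolys A I) Quot (Idl\<^bsub>ring_on (mpolys A I)\<^esub> (sym_relations A I))"

text \<open>The subring \<open>\<Oplus>\<^sub>i I\<^sup>i t\<^sup>i\<close> of \<open>A[t]\<close>; powers of \<open>I\<close> are taken in the monoid of ideals
  of \<open>A\<close>, so \<open>I\<^sup>0 = A\<close>.\<close>

definition rees_algebra :: "'a::comm_ring_1 set \<Rightarrow> 'a set \<Rightarrow> 'a poly ring" where
  "rees_algebra A I = ring_on {p. \<forall>i. poly.coeff p i \<in> I [^]\<^bsub>ideals_set (ring_on A)\<^esub> i}"

text \<open>The \<open>A\<close>-algebra map \<open>A[T\<^sub>a | a \<in> I] \<rightarrow> A[t]\<close> with \<open>T\<^sub>a \<mapsto> a t\<close>, and the map it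
  induces on the symmetric algebra, whose elements are cosets.\<close>

definition rees_eval :: "('a, 'a) mpoly \<Rightarrow> 'a::comm_ring_1 poly" where
  "rees_eval p = (\<Sum>m\<in>Poly_Mapping.keys p. [:Poly_Mapping.lookup p m:] *
     (\<Prod>a\<in>Poly_Mapping.keys m. [:0, a:] ^ Poly_Mapping.lookup m a))"

definition sym_to_rees :: "('a, 'a) mpoly set \<Rightarrow> 'a::comm_ring_1 poly" where
  "sym_to_rees X = the_elem (rees_eval ` X)"

definition linear_type :: "'a::comm_ring_1 set \<Rightarrow> 'a set \<Rightarrow> bool" where
  "linear_type A I \<longleftrightarrow> sym_to_rees \<in> ring_iso (sym_algebra A I) (rees_algebra A I)"

end

theory Submission
  imports Defs
begin

text \<open>
  Write \<open>y = x\<^bsub>n-1\<^esub>\<close>, \<open>z = x\<^sub>n\<close>, \<open>S = K[x\<^sub>1, \<dots>, x\<^bsub>n-2\<^esub>]\<close> and \<open>R = S[y, z]\<close>. All arguments are elementary: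
  factorisation into primes is avoided, and what replaces it is that \<open>y\<close> and \<open>z\<close> are variables, that
  \<open>g = z\<^sup>d - y\<^sup>m h\<close> is monic in \<open>z\<close>, and that \<open>h\<close> involves neither \<open>y\<close> nor \<open>z\<close>.

  \<^emph>\<open>Squarefreeness.\<close> If \<open>p\<^sup>2\<close> divides \<open>g\<close>, then \<open>p\<close> divides \<open>\<partial>g/\<partial>z = d z\<^bsup>d-1\<^esup>\<close>, while \<open>z\<close> does not divide \<open>g\<close>;
  so \<open>p\<close> is a unit. The same derivative shows that a square factor of \<open>g h\<close> lies in \<open>S\<close> and divides \<open>h\<close>.

  \<^emph>\<open>\<open>g\<close> is not free\<close> (\<open>no_log_derivation_basis\<close>). Let \<open>\<partial>\<^sub>i h \<noteq> 0\<close>. The Koszul derivations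
  \<open>\<kappa>\<^sub>1 = g\<^sub>y \<partial>\<^sub>z - g\<^sub>z \<partial>\<^sub>y\<close>, \<open>\<kappa>\<^sub>2 = g\<^sub>i \<partial>\<^sub>z - g\<^sub>z \<partial>\<^sub>i\<close> and \<open>\<sigma> = g\<^sub>i \<partial>\<^sub>y - g\<^sub>y \<partial>\<^sub>i\<close> kill \<open>g\<close> and satisfy
  \<open>g\<^sub>i \<kappa>\<^sub>1 - g\<^sub>y \<kappa>\<^sub>2 = - g\<^sub>z \<sigma>\<close>. Comparing degrees of their \<open>z\<close>-components, \<open>\<kappa>\<^sub>1\<close> and \<open>\<kappa>\<^sub>2\<close> are linearly
  independent modulo the maximal ideal at the origin times the module of logarithmic derivations.
  With a basis, some \<open>2\<times>2\<close> minor \<open>\<Delta>\<close> of their coordinates would have nonzero constant term; the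
  relation forces \<open>g\<^sub>i \<Delta>\<close>, hence \<open>\<Delta>\<close>, to be divisible by \<open>z\<close>, a contradiction.

  \<^emph>\<open>\<open>g h\<close> is free\<close> (\<open>free_gh\<close>). A derivation \<open>\<theta>\<close> is logarithmic for \<open>g h\<close> iff \<open>\<theta>(h) = c h\<close> and
  \<open>\<theta>(g) = t g\<close>. The second condition reads
  \<open>z\<^bsup>d-1\<^esup> (d \<theta>(z) - t z) = y\<^bsup>m-1\<^esup> h (m \<theta>(y) + y c - y t)\<close>, and is solved by one further free parameter
  \<open>s\<close> with \<open>d \<theta>(z) - t z = y\<^bsup>m-1\<^esup> h s\<close>. So \<open>\<theta>\<close> corresponds to a logarithmic derivation of \<open>h\<close> with
  coefficients in \<open>R\<close> and to arbitrary \<open>t, s \<in> R\<close>, and a basis for \<open>h\<close> extends by two elements.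

  \<^emph>\<open>Linear type\<close> (\<open>linear_type_gh\<close>). An ideal is of linear type iff the kernel of \<open>T\<^sub>a \<mapsto> a t\<close> is generated
  by the linear relations. The partial derivatives of \<open>g h\<close> are \<open>q \<partial>\<^sub>i h\<close> with \<open>q = z\<^sup>d - 2 y\<^sup>m h\<close>, and
  nonzero multiples of \<open>u\<^sub>0 = - 2 y\<^bsup>m-1\<^esup> h\<^sup>2\<close> and \<open>v\<^sub>0 = z\<^bsup>d-1\<^esup> h\<close>. If \<open>A \<subseteq> S[t]\<close> is the Rees algebra of
  \<open>J\<^sub>h\<close>, which by assumption is its symmetric algebra, then the symmetric algebra of \<open>J\<^bsub>gh\<^esub>\<close> is an
  image of \<open>A[y, z, U, V]\<close>, where \<open>t \<mapsto> q t\<close>, \<open>U \<mapsto> u\<^sub>0 t\<close>, \<open>V \<mapsto> v\<^sub>0 t\<close>. Two relations are visible: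
  \<open>E = y U + z V - H\<close> with \<open>H = h t\<close>, and \<open>z\<^bsup>d-1\<^esup> U + 2 y\<^bsup>m-1\<^esup> h V\<close>. That they generate the kernel is the algebraic
  core, \<open>kernel_in_four_variables\<close>, valid over every domain \<open>A\<close> for nonzero \<open>H\<close> and \<open>\<eta> = 2 h\<close>: after inverting \<open>z\<close> and \<open>q\<close> the
  relations eliminate \<open>V\<close> and \<open>U\<close>; and \<open>q\<close> and \<open>z\<close> can be cancelled again, because \<open>q\<close> is monic in \<open>z\<close>
  and because \<open>z\<close> is a nonzerodivisor modulo the two relations.
\<close>

abbreviation lookup :: "('a \<Rightarrow>\<^sub>0 'b::zero) \<Rightarrow> 'a \<Rightarrow> 'b" where "lookup \<equiv> Poly_Mapping.lookup"
abbreviation keys :: "('a \<Rightarrow>\<^sub>0 'b::zero) \<Rightarrow> 'a set" where "keys \<equiv> Poly_Mapping.keys"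
abbreviation single :: "'a \<Rightarrow> 'b \<Rightarrow> 'a \<Rightarrow>\<^sub>0 'b::zero" where "single \<equiv> Poly_Mapping.single"

section \<open>Subrings, homomorphisms and evaluation\<close>

definition is_subring :: "'a::comm_ring_1 set \<Rightarrow> bool" where
  "is_subring A \<longleftrightarrow> 1 \<in> A \<and> (\<forall>a\<in>A. \<forall>b\<in>A. a + b \<in> A \<and> a * b \<in> A) \<and> (\<forall>a\<in>A. - a \<in> A)"

definition is_hom :: "('a::comm_ring_1 \<Rightarrow> 'b::comm_ring_1) \<Rightarrow> bool" where
  "is_hom f \<longleftrightarrow> f 1 = 1 \<and> (\<forall>a b. f (a + b) = f a + f b \<and> f (a * b) = f a * f b)"

lemma is_subringD:
  assumes "is_subring A"
  shows "1 \<in> A" "0 \<in> A" "a \<in> A \<Longrightarrow> b \<in> A \<Longrightarrow> a + b \<in> A" "a \<in> A \<Longrightarrow> b \<in> A \<Longrightarrow> a * b \<in> A"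
    "a \<in> A \<Longrightarrow> - a \<in> A" "a \<in> A \<Longrightarrow> b \<in> A \<Longrightarrow> a - b \<in> A" "a \<in> A \<Longrightarrow> a ^ k \<in> A" "of_nat k \<in> A"
proof -
  show 1: "1 \<in> A" and a: "\<And>a b. a \<in> A \<Longrightarrow> b \<in> A \<Longrightarrow> a + b \<in> A"
    and m: "\<And>a b. a \<in> A \<Longrightarrow> b \<in> A \<Longrightarrow> a * b \<in> A" and u: "\<And>a. a \<in> A \<Longrightarrow> - a \<in> A"
    using assms unfolding is_subring_def by auto
  show 0: "0 \<in> A" using a[OF 1 u[OF 1]] by simp
  show "a \<in> A \<Longrightarrow> b \<in> A \<Longrightarrow> a - b \<in> A" using a u by (metis uminus_add_conv_diff add.commute)
  show "a \<in> A \<Longrightarrow> a ^ k \<in> A" by (induction k) (auto intro: 1 m)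
  show "of_nat k \<in> A" by (induction k) (auto intro: 0 1 a)
qed

lemma is_subring_sum:
  assumes "is_subring A" "\<And>i. i \<in> I \<Longrightarrow> f i \<in> A" shows "sum f I \<in> A"
  using assms(2) by (induction I rule: infinite_finite_induct) (auto intro: is_subringD[OF assms(1)])

lemma is_subring_UNIV [simp]: "is_subring UNIV" unfolding is_subring_def by auto

lemma is_homD:
  assumes "is_hom f"
  shows "f 1 = 1" "f 0 = 0" "f (a + b) = f a + f b" "f (a * b) = f a * f b" "f (- a) = - f a"
    "f (a - b) = f a - f b" "f (a ^ k) = f a ^ k" "f (of_nat k) = of_nat k"
proof -
  show 1: "f 1 = 1" and a: "\<And>a b. f (a + b) = f a + f b" and m: "\<And>a b. f (a * b) = f a * f b"
    using assms unfolding is_hom_def by auto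
  show 0: "f 0 = 0" using a[of 0 0] by simp
  show u: "\<And>a. f (- a) = - f a" by (metis 0 a add.inverse_unique add.right_inverse)
  show "f (a - b) = f a - f b" using a[of a "- b"] u by simp
  show "f (a ^ k) = f a ^ k" by (induction k) (auto simp: 1 m)
  show "f (of_nat k) = of_nat k" by (induction k) (auto simp: 0 1 a)
qed

lemma is_hom_sum: assumes "is_hom f" shows "f (sum g I) = (\<Sum>i\<in>I. f (g i))"
  by (induction I rule: infinite_finite_induct) (auto simp: is_homD[OF assms])

lemma is_hom_id: "is_hom (\<lambda>x. x)" by (simp add: is_hom_def)

lemma is_hom_comp: "is_hom f \<Longrightarrow> is_hom g \<Longrightarrow> is_hom (\<lambda>x. f (g x))" by (simp add: is_hom_def)

lemma is_subring_image: assumes "is_hom f" "is_subring A" shows "is_subring (f ` A)"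
  unfolding is_subring_def
proof (intro conjI ballI)
  show "1 \<in> f ` A" using is_homD(1)[OF assms(1)] is_subringD(1)[OF assms(2)] by (metis imageI)
qed (auto simp flip: is_homD(3,4,5)[OF assms(1)] intro: is_subringD[OF assms(2)])

lemma is_hom_Const: "is_hom Const"
  by (simp add: is_hom_def Const_def single_add mult_single)

lemma is_hom_const_poly: "is_hom (\<lambda>c. [:c:])"
  by (simp add: is_hom_def one_pCons)

lemma mpoly_sum_singles:
  fixes p :: "('b \<Rightarrow>\<^sub>0 'c::comm_monoid_add)"
  shows "p = (\<Sum>m\<in>keys p. single m (lookup p m))"
proof (rule poly_mapping_eqI)
  fix k
  show "lookup p k = lookup (\<Sum>m\<in>keys p. single m (lookup p m)) k"
    by (simp add: lookup_sum lookup_single when_def in_keys_iff)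
qed

lemma mpoly_term_induct [case_names zero single add]:
  fixes p :: "'b \<Rightarrow>\<^sub>0 'c::comm_monoid_add"
  assumes "P 0" "\<And>m c. P (single m c)" "\<And>p q. P p \<Longrightarrow> P q \<Longrightarrow> P (p + q)"
  shows "P p"
proof -
  have "P (\<Sum>m\<in>F. single m (lookup p m))" if "finite F" for F
    using that by (induction F) (auto intro: assms)
  then show ?thesis by (metis mpoly_sum_singles finite_keys)
qed

lemma Var_power: "Var v ^ k = single (single v k) 1"
  by (induction k) (auto simp: Var_def mult_single single_add[symmetric])

lemma exponent_sum: "finite F \<Longrightarrow> keys m \<subseteq> F \<Longrightarrow>
   (\<Sum>v\<in>F. single v (lookup m v)) = m"
  by (rule poly_mapping_eqI) (auto simp: lookup_sum lookup_single when_def in_keys_iff)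

lemma single_eq_prod:
  "single m c = Const c * (\<Prod>v\<in>keys m. Var v ^ lookup m v)"
proof -
  have "(\<Prod>v\<in>F. Var v ^ k v) = single (\<Sum>v\<in>F. single v (k v)) (1::'b)"
    if "finite F" for F and k :: "'a \<Rightarrow> nat"
    using that by (induction F) (auto simp: Var_power mult_single)
  then show ?thesis by (simp add: exponent_sum Const_def mult_single)
qed

lemma is_subring_mpolys: assumes A: "is_subring A" shows "is_subring (mpolys A V)"
  unfolding is_subring_def
proof (intro conjI ballI)
  show "1 \<in> mpolys A V"
    by (auto simp: mpolys_def lookup_one when_def intro: is_subringD[OF A])
next
  fix p q assume p: "p \<in> mpolys A V" and q: "q \<in> mpolys A V"
  have kp: "keys m \<subseteq> V" if "m \<in> keys p" for m
    using p that by (auto simp: mpolys_def in_keys_iff)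
  have kq: "keys m \<subseteq> V" if "m \<in> keys q" for m
    using q that by (auto simp: mpolys_def in_keys_iff)
  show "p + q \<in> mpolys A V"
    unfolding mpolys_def mem_Collect_eq
  proof (intro allI conjI impI)
    fix m
    show "lookup (p + q) m \<in> A"
      using p q by (simp add: mpolys_def lookup_add is_subringD(3)[OF A])
    assume "lookup (p + q) m \<noteq> 0"
    then have "lookup p m \<noteq> 0 \<or> lookup q m \<noteq> 0" by (auto simp: lookup_add)
    then show "keys m \<subseteq> V" using kp kq by (auto simp: in_keys_iff)
  qed
  have "lookup (p * q) m \<in> A" for m
  proof -
    have "p * q = (\<Sum>i\<in>keys p. \<Sum>j\<in>keys q.
        single (i + j) (lookup p i * lookup q j))"
      using arg_cong2[OF mpoly_sum_singles[of p] mpoly_sum_singles[of q], of "(*)"]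
      by (simp add: sum_product mult_single)
    then show ?thesis
      using p q by (auto simp: lookup_sum lookup_single when_def mpolys_def
          intro!: is_subring_sum[OF A] is_subringD[OF A])
  qed
  moreover have "keys m \<subseteq> V" if "m \<in> keys (p * q)" for m
    using that keys_mult[of p q] kp kq keys_add by fastforce
  ultimately show "p * q \<in> mpolys A V" by (auto simp: mpolys_def in_keys_iff)
next
  fix p assume "p \<in> mpolys A V"
  then show "- p \<in> mpolys A V" by (auto simp: mpolys_def intro: is_subringD[OF A])
qed

lemma Var_in_mpolys: "is_subring A \<Longrightarrow> v \<in> V \<Longrightarrow> Var v \<in> mpolys A V"
  by (auto simp: mpolys_def Var_def lookup_single when_def intro: is_subringD)

lemma Const_in_mpolys: "is_subring A \<Longrightarrow> c \<in> A \<Longrightarrow> Const c \<in> mpolys A V"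
  by (auto simp: mpolys_def Const_def lookup_single when_def intro: is_subringD)

lemma mpolys_mono: "A \<subseteq> B \<Longrightarrow> V \<subseteq> W \<Longrightarrow> mpolys A V \<subseteq> mpolys B W"
  unfolding mpolys_def by blast

text \<open>Every polynomial is built from constants and variables by sums and products. This is the
  induction principle for properties compatible with the ring operations: agreement of
  homomorphisms, membership in a subring, validity of the chain rule.\<close>

lemma mpolys_subset_closed:
  assumes A: "is_subring A" and c: "\<And>a. a \<in> A \<Longrightarrow> Const a \<in> X" and v: "\<And>w. w \<in> V \<Longrightarrow> Var w \<in> X"
    and add: "\<And>p q. p \<in> X \<Longrightarrow> q \<in> X \<Longrightarrow> p + q \<in> X" and mult: "\<And>p q. p \<in> X \<Longrightarrow> q \<in> X \<Longrightarrow> p * q \<in> X"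
  shows "mpolys A V \<subseteq> X"
proof
  fix p assume p: "p \<in> mpolys A V"
  have one: "1 \<in> X" using c[OF is_subringD(1)[OF A]] by (simp add: Const_def)
  have zero: "0 \<in> X" using c[OF is_subringD(2)[OF A]] by (simp add: Const_def)
  have pw: "q ^ k \<in> X" if "q \<in> X" for q k using that by (induction k) (auto intro: one mult)
  have pr: "(\<Prod>w\<in>F. g w) \<in> X" if "finite F" "\<And>w. w \<in> F \<Longrightarrow> g w \<in> X" for F and g :: "'b \<Rightarrow> _"
    using that by (induction F) (auto intro: one mult)
  have sm: "(\<Sum>w\<in>F. g w) \<in> X" if "finite F" "\<And>w. w \<in> F \<Longrightarrow> g w \<in> X" for F and g :: "('b \<Rightarrow>\<^sub>0 nat) \<Rightarrow> _"
    using that by (induction F) (auto intro: zero add)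
  have "single m (lookup p m) \<in> X" if "m \<in> keys p" for m
    unfolding single_eq_prod using p that
    by (intro mult c pr pw v) (auto simp: mpolys_def dest!: in_keys_iff[THEN iffD1, of m p] intro: subsetD)
  then show "p \<in> X" by (subst mpoly_sum_singles) (auto intro: sm)
qed

definition evalm :: "('a::comm_ring_1 \<Rightarrow> 'b::comm_ring_1) \<Rightarrow> ('v \<Rightarrow> 'b) \<Rightarrow> ('v, 'a) mpoly \<Rightarrow> 'b" where
  "evalm \<phi> \<sigma> p = (\<Sum>m\<in>keys p. \<phi> (lookup p m) *
     (\<Prod>v\<in>keys m. \<sigma> v ^ lookup m v))"

lemma evalm_single:
  assumes "is_hom \<phi>"
  shows "evalm \<phi> \<sigma> (single m c) = \<phi> c * (\<Prod>v\<in>keys m. \<sigma> v ^ lookup m v)"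
  by (cases "c = 0") (auto simp: evalm_def is_homD[OF assms])

lemma evalm_add:
  assumes "is_hom \<phi>" shows "evalm \<phi> \<sigma> (p + q) = evalm \<phi> \<sigma> p + evalm \<phi> \<sigma> q"
proof -
  have *: "evalm \<phi> \<sigma> r = (\<Sum>m\<in>F. \<phi> (lookup r m) *
     (\<Prod>v\<in>keys m. \<sigma> v ^ lookup m v))"
    if "finite F" "keys r \<subseteq> F" for F r
    unfolding evalm_def using that
    by (intro sum.mono_neutral_left) (auto simp: in_keys_iff is_homD[OF assms])
  let ?F = "keys p \<union> keys q"
  show ?thesis
    using *[of ?F p] *[of ?F q] *[of ?F "p + q"] keys_add[of p q]
    by (simp add: lookup_add is_homD[OF assms] distrib_right sum.distrib)
qed

lemma is_hom_evalm: assumes "is_hom \<phi>" shows "is_hom (evalm \<phi> \<sigma>)"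
proof -
  have zero: "evalm \<phi> \<sigma> 0 = 0" by (simp add: evalm_def)
  have mon: "(\<Prod>v\<in>keys (m + m'). \<sigma> v ^ lookup (m + m') v) =
     (\<Prod>v\<in>keys m. \<sigma> v ^ lookup m v) *
     (\<Prod>v\<in>keys m'. \<sigma> v ^ lookup m' v)" for m m'
  proof -
    let ?F = "keys m \<union> keys m'"
    have *: "(\<Prod>v\<in>keys k. \<sigma> v ^ lookup k v) = (\<Prod>v\<in>?F. \<sigma> v ^ lookup k v)"
      if "keys k \<subseteq> ?F" for k
      using that by (intro prod.mono_neutral_left) (auto simp: in_keys_iff)
    show ?thesis using *[of m] *[of m'] *[of "m + m'"] keys_add[of m m']
      by (simp add: lookup_add power_add prod.distrib)
  qed
  have "evalm \<phi> \<sigma> (p * q) = evalm \<phi> \<sigma> p * evalm \<phi> \<sigma> q" for p q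
  proof (induction p rule: mpoly_term_induct)
    case (single m c)
    show ?case
    proof (induction q rule: mpoly_term_induct)
      case (single m' c')
      show ?case by (simp only: mult_single evalm_single[OF assms] mon is_homD[OF assms]) (simp add: mult_ac)
    qed (auto simp: zero evalm_add[OF assms] distrib_left)
  qed (auto simp: zero evalm_add[OF assms] distrib_right)
  moreover have "evalm \<phi> \<sigma> 1 = 1"
    using evalm_single[OF assms, of \<sigma> 0 1] by (simp add: is_homD[OF assms])
  ultimately show ?thesis by (simp add: is_hom_def evalm_add[OF assms])
qed

lemma evalm_Var: "is_hom \<phi> \<Longrightarrow> evalm \<phi> \<sigma> (Var v) = \<sigma> v"
  unfolding Var_def by (subst evalm_single) (auto simp: is_homD)

lemma evalm_Const: "is_hom \<phi> \<Longrightarrow> evalm \<phi> \<sigma> (Const c) = \<phi> c"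
  unfolding Const_def by (subst evalm_single) (auto simp: is_homD)

lemma hom_eq_on_mpolys:
  assumes A: "is_subring A" and "is_hom f" "is_hom g" "\<And>a. a \<in> A \<Longrightarrow> f (Const a) = g (Const a)"
    "\<And>v. v \<in> V \<Longrightarrow> f (Var v) = g (Var v)" "p \<in> mpolys A V"
  shows "f p = g p"
proof -
  have "mpolys A V \<subseteq> {p. f p = g p}"
    using assms by (intro mpolys_subset_closed) (auto simp: is_homD)
  with assms(6) show ?thesis by auto
qed

lemma mpolys_UNIV [simp]: "mpolys UNIV UNIV = UNIV" by (auto simp: mpolys_def)

section \<open>Polynomials as polynomials in one of the variables\<close>

definition polys :: "'a::comm_ring_1 set \<Rightarrow> 'a poly set" where
  "polys A = {p. \<forall>i. coeff p i \<in> A}"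

lemma coeff_polys: "p \<in> polys A \<Longrightarrow> coeff p i \<in> A" by (auto simp: polys_def)

lemma is_subring_polys: assumes A: "is_subring A" shows "is_subring (polys A)"
  unfolding is_subring_def polys_def
  by (auto simp: coeff_mult intro!: is_subring_sum[OF A] is_subringD[OF A])

lemma const_in_polys: "is_subring A \<Longrightarrow> a \<in> A \<Longrightarrow> [:a:] \<in> polys A"
  by (auto simp: polys_def coeff_pCons split: nat.splits intro: is_subringD)

lemma pCons_in_polys_iff: "pCons a p \<in> polys A \<longleftrightarrow> a \<in> A \<and> p \<in> polys A"
proof -
  have "(\<forall>i. coeff (pCons a p) i \<in> A) \<longleftrightarrow> a \<in> A \<and> (\<forall>i. coeff p i \<in> A)"
    by (metis coeff_pCons_0 coeff_pCons_Suc not0_implies_Suc)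
  then show ?thesis by (simp add: polys_def)
qed

lemma X_in_polys: "is_subring A \<Longrightarrow> [:0, 1:] \<in> polys A"
  by (simp add: pCons_in_polys_iff is_subringD) (simp add: polys_def is_subringD)

lemma polys_subset_closed:
  assumes A: "is_subring A" and c: "\<And>a. a \<in> A \<Longrightarrow> [:a:] \<in> X" and v: "[:0, 1:] \<in> X"
    and add: "\<And>p q. p \<in> X \<Longrightarrow> q \<in> X \<Longrightarrow> p + q \<in> X" and mult: "\<And>p q. p \<in> X \<Longrightarrow> q \<in> X \<Longrightarrow> p * q \<in> X"
  shows "polys A \<subseteq> X"
proof
  fix p assume "p \<in> polys A" then show "p \<in> X"
  proof (induction p rule: pCons_induct)
    case 0 show ?case using c[OF is_subringD(2)[OF A]] by simp
  next
    case (pCons a p)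
    have "pCons a p = [:a:] + [:0, 1:] * p" by simp
    moreover have "a \<in> A" "p \<in> polys A" using pCons.prems by (auto simp: pCons_in_polys_iff)
    ultimately show ?case using pCons.IH c v add mult by metis
  qed
qed

lemma polys_mono: "A \<subseteq> B \<Longrightarrow> polys A \<subseteq> polys B" by (auto simp: polys_def)

text \<open>Multivariate evaluation is also obtained by nesting: \<open>evalp (evalp \<phi> x) y\<close> evaluates a polynomial
  whose coefficients are polynomials.\<close>

definition evalp :: "('a::comm_ring_1 \<Rightarrow> 'b::comm_ring_1) \<Rightarrow> 'b \<Rightarrow> 'a poly \<Rightarrow> 'b" where
  "evalp \<phi> x p = poly (map_poly \<phi> p) x"

lemma is_hom_evalp: assumes "is_hom \<phi>" shows "is_hom (evalp \<phi> x)"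
proof -
  have z: "\<phi> 0 = 0" by (rule is_homD[OF assms])
  have a: "map_poly \<phi> (p + q) = map_poly \<phi> p + map_poly \<phi> q" for p q
    by (rule poly_eqI) (simp add: coeff_map_poly z is_homD[OF assms])
  have m: "map_poly \<phi> (p * q) = map_poly \<phi> p * map_poly \<phi> q" for p q
    by (rule poly_eqI) (simp add: coeff_map_poly z coeff_mult is_hom_sum[OF assms] is_homD[OF assms])
  have o: "map_poly \<phi> 1 = 1"
    by (rule poly_eqI) (auto simp: coeff_map_poly z is_homD[OF assms])
  show ?thesis unfolding is_hom_def evalp_def by (simp add: a m o)
qed

lemma evalp_pCons: "is_hom \<phi> \<Longrightarrow> evalp \<phi> x (pCons a p) = \<phi> a + x * evalp \<phi> x p"
  unfolding evalp_def by (simp add: map_poly_pCons is_homD)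

lemma evalp_0: "evalp \<phi> x 0 = 0"
  by (simp add: evalp_def)

lemma is_hom_map_poly: assumes "is_hom \<phi>" shows "is_hom (map_poly \<phi>)"
proof -
  have z: "\<phi> 0 = 0" by (rule is_homD[OF assms])
  show ?thesis unfolding is_hom_def
    by (auto intro!: poly_eqI simp: coeff_map_poly z coeff_mult is_hom_sum[OF assms] is_homD[OF assms])
qed

lemma is_hom_poly: "is_hom (\<lambda>p. poly p x)" by (simp add: is_hom_def)

text \<open>\<open>univ_in v\<close> reads a multivariate polynomial as a polynomial in the variable \<open>v\<close>. It is the
  inverse of evaluation at \<open>Var v\<close>, and being a homomorphism it transports questions of
  divisibility to univariate polynomials.\<close>

definition univ_in :: "'v \<Rightarrow> ('v, 'a::comm_ring_1) mpoly \<Rightarrow> ('v, 'a) mpoly poly" where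
  "univ_in v = evalm (\<lambda>c. [:Const c:]) (\<lambda>w. if w = v then [:0, 1:] else [:Var w:])"

lemma is_hom_const_Const: "is_hom (\<lambda>c. [:Const c:])"
  using is_hom_comp[OF is_hom_const_poly is_hom_Const] .

lemma is_hom_univ: "is_hom (univ_in v)"
  unfolding univ_in_def by (rule is_hom_evalm[OF is_hom_const_Const])

lemma univ_Var: "univ_in v (Var w) = (if w = v then [:0, 1:] else [:Var w:])"
  unfolding univ_in_def by (rule evalm_Var[OF is_hom_const_Const])

lemma univ_Const: "univ_in v (Const c) = [:Const c:]"
  unfolding univ_in_def by (rule evalm_Const[OF is_hom_const_Const])

lemma poly_univ: "poly (univ_in v p) (Var v) = p"
  by (rule hom_eq_on_mpolys[where A = UNIV and V = UNIV,
        OF _ is_hom_comp[OF is_hom_poly is_hom_univ] is_hom_id])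
    (auto simp: univ_Var univ_Const)

lemma univ_free:
  assumes "p \<in> mpolys UNIV V" "v \<notin> V" shows "univ_in v p = [:p:]"
  by (rule hom_eq_on_mpolys[where A = UNIV and V = V, OF _ is_hom_univ is_hom_const_poly])
    (use assms in \<open>auto simp: univ_Var univ_Const\<close>)

lemma univ_in_polys:
  fixes p :: "('v, 'a::comm_ring_1) mpoly"
  assumes "p \<in> mpolys UNIV V" shows "univ_in v p \<in> polys (mpolys UNIV (V - {v}))"
proof -
  have s: "is_subring (polys (mpolys UNIV (V - {v})) :: ('v, 'a) mpoly poly set)"
    by (intro is_subring_polys is_subring_mpolys) simp
  have "mpolys UNIV V \<subseteq> {p :: ('v, 'a) mpoly. univ_in v p \<in> polys (mpolys UNIV (V - {v}))}"
    by (rule mpolys_subset_closed[OF is_subring_UNIV])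
      (simp_all add: univ_Const univ_Var const_in_polys is_subring_mpolys Const_in_mpolys Var_in_mpolys
        X_in_polys is_homD(3,4)[OF is_hom_univ] is_subringD(3,4)[OF s])
  then show ?thesis using assms by auto
qed

lemma univ_poly:
  assumes "P \<in> polys (mpolys UNIV V)" "v \<notin> V" shows "univ_in v (poly P (Var v)) = P"
  using assms(1)
proof (induction P rule: pCons_induct)
  case 0 then show ?case by (simp add: is_homD[OF is_hom_univ])
next
  case (pCons a P)
  have a: "a \<in> mpolys UNIV V" "P \<in> polys (mpolys UNIV V)"
    using pCons.prems by (auto simp: pCons_in_polys_iff)
  then show ?case using pCons.IH by (simp add: is_homD[OF is_hom_univ] univ_free[OF a(1) assms(2)] univ_Var)
qed

section \<open>Partial derivatives\<close>

lemma pd_single: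
  "partial_deriv v (single m c) =
     single (m - single v 1) (of_nat (lookup m v) * c)"
  by (cases "c = 0") (auto simp: partial_deriv_def)

lemma pd_add: "partial_deriv v (p + q) = partial_deriv v p + partial_deriv v q"
proof -
  have *: "partial_deriv v r = (\<Sum>m\<in>F. single (m - single v 1)
                      (of_nat (lookup m v) * lookup r m))"
    if "finite F" "keys r \<subseteq> F" for F and r :: "('a, 'b) mpoly"
    unfolding partial_deriv_def using that
    by (intro sum.mono_neutral_left) (auto simp: in_keys_iff)
  let ?F = "keys p \<union> keys q"
  show ?thesis
    using *[of ?F p] *[of ?F q] *[of ?F "p + q"] keys_add[of p q]
    by (simp add: lookup_add distrib_left single_add sum.distrib)
qed

lemma pd_0 [simp]: "partial_deriv v 0 = 0"
  by (simp add: partial_deriv_def)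

lemma pd_Const [simp]: "partial_deriv v (Const c) = 0"
  by (simp add: Const_def pd_single)

lemma pd_1 [simp]: "partial_deriv v 1 = 0"
  using pd_Const[of v 1] by (simp add: Const_def)

lemma pd_Var: "partial_deriv v (Var w) = (if v = w then 1 else 0)"
  by (auto simp: Var_def pd_single lookup_single)

lemma pd_sum: "partial_deriv v (sum f I) = (\<Sum>i\<in>I. partial_deriv v (f i))"
  by (induction I rule: infinite_finite_induct) (auto simp: pd_add)

lemma pd_mult: "partial_deriv v (p * q) = partial_deriv v p * q + p * partial_deriv v q"
proof (induction p rule: mpoly_term_induct)
  case (single m c)
  show ?case
  proof (induction q rule: mpoly_term_induct)
    case (single m' c')
    let ?e = "single v (1::nat)"
    have sh: "k - ?e + l = k + l - ?e" if "lookup k v \<noteq> 0" for k l :: "'a \<Rightarrow>\<^sub>0 nat"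
      using that by (intro poly_mapping_eqI) (auto simp: lookup_add lookup_minus lookup_single when_def)
    have sh2: "l + (k - ?e) = l + k - ?e" if "lookup k v \<noteq> 0" for k l :: "'a \<Rightarrow>\<^sub>0 nat"
      using sh[OF that, of l] by (metis add.commute)
    have 1: "single (m - ?e + m') (of_nat (lookup m v) * c * c') =
        single (m + m' - ?e) (of_nat (lookup m v) * c * c')"
      by (cases "lookup m v = 0") (auto simp: sh simp del: One_nat_def)
    have 2: "single (m + (m' - ?e)) (c * (of_nat (lookup m' v) * c')) =
        single (m + m' - ?e) (c * (of_nat (lookup m' v) * c'))"
      by (cases "lookup m' v = 0") (auto simp: sh2 simp del: One_nat_def)
    show ?case
      unfolding mult_single pd_single 1 2 by (simp add: lookup_add algebra_simps flip: single_add)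
  qed (auto simp: pd_add algebra_simps)
qed (auto simp: pd_add algebra_simps)

lemma pd_uminus: "partial_deriv v (- p) = - partial_deriv v p"
  using pd_add[of v p "- p"] by (simp add: eq_neg_iff_add_eq_0 add.commute)

lemma pd_diff: "partial_deriv v (p - q) = partial_deriv v p - partial_deriv v q"
  using pd_add[of v p "- q"] by (simp add: pd_uminus)

lemma pd_power: "partial_deriv v (p ^ k) = of_nat k * p ^ (k - 1) * partial_deriv v p"
proof (induction k)
  case (Suc k)
  show ?case by (cases k) (use Suc in \<open>auto simp: pd_mult algebra_simps\<close>)
qed simp

lemma pd_free:
  assumes "p \<in> mpolys UNIV V" "v \<notin> V" shows "partial_deriv v p = 0"
proof -
  have "mpolys UNIV V \<subseteq> {p :: ('a, 'b) mpoly. partial_deriv v p = 0}"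
    using assms(2) by (intro mpolys_subset_closed) (auto simp: pd_Var pd_mult pd_add)
  then show ?thesis using assms(1) by auto
qed

lemma pd_closed:
  fixes p :: "('v, 'a::comm_ring_1) mpoly"
  assumes "p \<in> mpolys UNIV V" shows "partial_deriv v p \<in> mpolys UNIV V"
proof -
  have s: "is_subring (mpolys UNIV V :: ('v, 'a) mpoly set)" by (simp add: is_subring_mpolys)
  have "mpolys UNIV V \<subseteq> {p :: ('v, 'a) mpoly. p \<in> mpolys UNIV V \<and> partial_deriv v p \<in> mpolys UNIV V}"
    by (rule mpolys_subset_closed)
      (auto simp: pd_Var pd_mult pd_add intro!: Const_in_mpolys Var_in_mpolys is_subringD[OF s])
  then show ?thesis using assms by auto
qed

lemma of_nat_mpoly: "of_nat k = Const (of_nat k)"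
  by (simp add: is_homD[OF is_hom_Const])

lemma Const_mult_eq_0_iff: fixes c :: "'k::field" shows "Const c * p = 0 \<longleftrightarrow> c = 0 \<or> p = 0"
proof (cases "c = 0")
  case False
  then have "Const (inverse c) * (Const c * p) = p"
    by (simp add: mult.assoc[symmetric] is_homD(4)[OF is_hom_Const, symmetric]) (simp add: Const_def)
  then show ?thesis using False by auto
qed (simp add: is_homD[OF is_hom_Const])

lemma homogeneous_euler:
  fixes p :: "(nat, 'k::field) mpoly"
  assumes "homogeneous d p" "p \<in> mpolys UNIV V" "finite V"
  shows "(\<Sum>i\<in>V. Var i * partial_deriv i p) = of_nat d * p"
proof -
  have *: "(\<Sum>i\<in>V. Var i * partial_deriv i (single m c)) = of_nat d * single m c"
    if m: "keys m \<subseteq> V" "(\<Sum>v\<in>keys m. lookup m v) = d" for m and c :: 'k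
  proof -
    have "Var i * partial_deriv i (single m c) = of_nat (lookup m i) * single m c" for i
    proof (cases "lookup m i = 0")
      case False
      then have "single i 1 + (m - single i 1) = m"
        by (intro poly_mapping_eqI) (auto simp: lookup_add lookup_minus lookup_single when_def)
      then show ?thesis by (simp add: pd_single Var_def mult_single of_nat_mpoly Const_def del: single_of_nat)
    qed (simp add: pd_single)
    then have "(\<Sum>i\<in>V. Var i * partial_deriv i (single m c)) = of_nat (\<Sum>i\<in>V. lookup m i) * single m c"
      by (simp add: sum_distrib_right)
    moreover have "(\<Sum>i\<in>V. lookup m i) = d"
      unfolding m(2)[symmetric] using assms(3) m(1)
      by (intro sum.mono_neutral_right) (auto simp: in_keys_iff)
    ultimately show ?thesis by simp
  qed
  have "(\<Sum>i\<in>V. Var i * partial_deriv i p) =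
      (\<Sum>m\<in>keys p. \<Sum>i\<in>V. Var i * partial_deriv i (single m (lookup p m)))"
    unfolding arg_cong[OF mpoly_sum_singles[of p], of "\<lambda>p. \<Sum>i\<in>V. Var i * partial_deriv i p"]
      pd_sum sum_distrib_left by (rule sum.swap)
  also have "\<dots> = (\<Sum>m\<in>keys p. of_nat d * single m (lookup p m))"
    using assms by (intro sum.cong refl *) (auto simp: homogeneous_def mpolys_def in_keys_iff)
  also have "\<dots> = of_nat d * (\<Sum>m\<in>keys p. single m (lookup p m))"
    by (simp only: sum_distrib_left)
  also have "\<dots> = of_nat d * p" by (rule arg_cong[OF mpoly_sum_singles[symmetric]])
  finally show ?thesis .
qed

section \<open>Ideals of subrings\<close>

lemma ring_on_simps [simp]:
  "carrier (ring_on A) = A" "mult (ring_on A) = (*)" "one (ring_on A) = 1"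
  "zero (ring_on A) = 0" "add (ring_on A) = (+)"
  by (simp_all add: ring_on_def)

lemma cring_ring_on: assumes "is_subring A" shows "cring (ring_on A)"
proof (rule cringI)
  show "abelian_group (ring_on A)"
  proof (rule abelian_groupI)
    show "\<exists>y\<in>carrier (ring_on A). y \<oplus>\<^bsub>ring_on A\<^esub> x = \<zero>\<^bsub>ring_on A\<^esub>" if "x \<in> carrier (ring_on A)" for x
      using that is_subringD(5)[OF assms, of x] by (auto intro!: bexI[of _ "- x"])
  qed (auto simp: add_ac is_subringD[OF assms])
  show "Group.comm_monoid (ring_on A)"
    by (rule comm_monoidI) (auto simp: mult_ac is_subringD[OF assms])
qed (auto simp: distrib_right)

definition ideal_in :: "'a::comm_ring_1 set \<Rightarrow> 'a set \<Rightarrow> bool" where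
  "ideal_in A I \<longleftrightarrow> I \<subseteq> A \<and> 0 \<in> I \<and> (\<forall>a\<in>I. \<forall>b\<in>I. a + b \<in> I) \<and> (\<forall>a\<in>A. \<forall>b\<in>I. a * b \<in> I)"

lemma ideal_inD:
  assumes "is_subring A" "ideal_in A I"
  shows "I \<subseteq> A" "0 \<in> I" "a \<in> I \<Longrightarrow> b \<in> I \<Longrightarrow> a + b \<in> I" "a \<in> A \<Longrightarrow> b \<in> I \<Longrightarrow> a * b \<in> I"
    "a \<in> I \<Longrightarrow> b \<in> A \<Longrightarrow> a * b \<in> I" "a \<in> I \<Longrightarrow> - a \<in> I" "a \<in> I \<Longrightarrow> b \<in> I \<Longrightarrow> a - b \<in> I"
proof -
  show "I \<subseteq> A" "0 \<in> I" and a: "\<And>a b. a \<in> I \<Longrightarrow> b \<in> I \<Longrightarrow> a + b \<in> I"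
    and m: "\<And>a b. a \<in> A \<Longrightarrow> b \<in> I \<Longrightarrow> a * b \<in> I"
    using assms(2) by (auto simp: ideal_in_def)
  show "a \<in> I \<Longrightarrow> b \<in> A \<Longrightarrow> a * b \<in> I" using m[of b a] by (simp add: mult.commute)
  show u: "\<And>a. a \<in> I \<Longrightarrow> - a \<in> I" using m[of "- 1"] is_subringD[OF assms(1)] by fastforce
  show "a \<in> I \<Longrightarrow> b \<in> I \<Longrightarrow> a - b \<in> I" using a[of a "- b"] u by simp
qed

lemma ideal_in_sum:
  assumes "ideal_in A I" "\<And>i. i \<in> T \<Longrightarrow> f i \<in> I" shows "sum f T \<in> I"
  using assms(2) by (induction T rule: infinite_finite_induct) (use assms(1) in \<open>auto simp: ideal_in_def\<close>)

lemma ideal_ring_on_iff: assumes A: "is_subring A" shows "ideal I (ring_on A) \<longleftrightarrow> ideal_in A I"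
proof
  assume I: "ideal I (ring_on A)"
  show "ideal_in A I" unfolding ideal_in_def
    using additive_subgroup.a_subset[OF ideal.axioms(1)[OF I]]
      additive_subgroup.zero_closed[OF ideal.axioms(1)[OF I]]
      additive_subgroup.a_closed[OF ideal.axioms(1)[OF I]] ideal.I_l_closed[OF I] by auto
next
  assume I: "ideal_in A I"
  interpret cring "ring_on A" by (rule cring_ring_on[OF A])
  show "ideal I (ring_on A)"
  proof (rule idealI)
    show "ring (ring_on A)" by unfold_locales
    show "subgroup I (add_monoid (ring_on A))"
    proof (rule subgroup.intro)
      fix x assume x: "x \<in> I"
      then have "\<ominus>\<^bsub>ring_on A\<^esub> x = - x"
        using ideal_inD(1)[OF A I] ideal_inD(6)[OF A I, of x] by (intro minus_equality) auto
      then have "inv\<^bsub>add_monoid (ring_on A)\<^esub> x = - x" by (simp add: a_inv_def)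
      then show "inv\<^bsub>add_monoid (ring_on A)\<^esub> x \<in> I" using x ideal_inD[OF A I] by simp
    qed (use ideal_inD[OF A I] in auto)
  qed (use ideal_inD[OF A I] in auto)
qed

lemma genideal_ring_on:
  assumes A: "is_subring A" and S: "S \<subseteq> A"
  shows "ideal_in A (Idl\<^bsub>ring_on A\<^esub> S)" "S \<subseteq> Idl\<^bsub>ring_on A\<^esub> S"
    "ideal_in A I \<Longrightarrow> S \<subseteq> I \<Longrightarrow> Idl\<^bsub>ring_on A\<^esub> S \<subseteq> I"
proof -
  interpret cring "ring_on A" by (rule cring_ring_on[OF A])
  show "ideal_in A (Idl\<^bsub>ring_on A\<^esub> S)" using genideal_ideal[of S] S ideal_ring_on_iff[OF A] by simp
  show "S \<subseteq> Idl\<^bsub>ring_on A\<^esub> S" using genideal_self[of S] S by simp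
  show "ideal_in A I \<Longrightarrow> S \<subseteq> I \<Longrightarrow> Idl\<^bsub>ring_on A\<^esub> S \<subseteq> I"
    using genideal_minimal[of I S] ideal_ring_on_iff[OF A] by simp
qed

definition mpolyn :: "nat \<Rightarrow> (nat, 'k::field) mpoly set" where
  "mpolyn n = mpolys UNIV {1..n}"

lemma carrier_mpoly_ring: "carrier (mpoly_ring n) = mpolyn n"
  by (simp add: mpoly_ring_def mpolyn_def)

lemma mpoly_ring_eq: "mpoly_ring n = ring_on (mpolyn n)"
  by (simp add: mpoly_ring_def mpolyn_def)

lemma is_subring_mpolyn: "is_subring (mpolyn n)"
  unfolding mpolyn_def by (rule is_subring_mpolys) simp

lemma pd_closed_mpolyn: "p \<in> mpolyn n \<Longrightarrow> partial_deriv i p \<in> mpolyn n"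
  unfolding mpolyn_def by (rule pd_closed)

lemma Var_in_mpolyn: "1 \<le> i \<Longrightarrow> i \<le> n \<Longrightarrow> Var i \<in> mpolyn n"
  unfolding mpolyn_def by (rule Var_in_mpolys) auto

lemma Const_in_mpolyn: "Const c \<in> mpolyn n"
  unfolding mpolyn_def by (rule Const_in_mpolys) auto

lemma mpolyn_mono: "n \<le> k \<Longrightarrow> mpolyn n \<subseteq> mpolyn k"
  unfolding mpolyn_def by (rule mpolys_mono) auto

lemma gradient_ideal_iff:
  fixes F :: "(nat, 'k::field) mpoly"
  assumes F: "F \<in> mpolyn n"
  shows "a \<in> gradient_ideal n F \<longleftrightarrow> (\<exists>r. (\<forall>i. r i \<in> mpolyn n) \<and> a = (\<Sum>i\<in>{1..n}. r i * partial_deriv i F))"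
proof
  let ?I = "{\<Sum>i\<in>{1..n}. r i * partial_deriv i F | r. \<forall>i. r i \<in> mpolyn n}"
  note s = is_subringD[OF is_subring_mpolyn]
  have S: "(\<lambda>i. partial_deriv i F) ` {1..n} \<subseteq> mpolyn n" using pd_closed_mpolyn[OF F] by auto
  note G = genideal_ring_on[OF is_subring_mpolyn S, folded mpoly_ring_eq, folded gradient_ideal_def]
  assume a: "a \<in> gradient_ideal n F"
  have "ideal_in (mpolyn n :: (nat, 'k) mpoly set) ?I" unfolding ideal_in_def
  proof (intro conjI ballI)
    show "?I \<subseteq> mpolyn n" using pd_closed_mpolyn[OF F] by (auto intro!: is_subring_sum[OF is_subring_mpolyn] s)
    show "0 \<in> ?I" by (auto intro!: exI[of _ "\<lambda>_. 0"] s)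
  next
    fix x y assume "x \<in> ?I" "y \<in> ?I"
    then obtain r r' where "\<forall>i. r i \<in> mpolyn n" "x = (\<Sum>i\<in>{1..n}. r i * partial_deriv i F)"
      "\<forall>i. r' i \<in> mpolyn n" "y = (\<Sum>i\<in>{1..n}. r' i * partial_deriv i F)" by auto
    then show "x + y \<in> ?I"
      by (auto intro!: exI[of _ "\<lambda>i. r i + r' i"] s simp: distrib_right sum.distrib)
  next
    fix x y :: "(nat, 'k) mpoly" assume "x \<in> mpolyn n" and "y \<in> ?I"
    then obtain r where "\<forall>i. r i \<in> mpolyn n" "y = (\<Sum>i\<in>{1..n}. r i * partial_deriv i F)" by auto
    then show "x * y \<in> ?I" using \<open>x \<in> mpolyn n\<close>
      by (auto intro!: exI[of _ "\<lambda>i. x * r i"] s simp: sum_distrib_left mult_ac)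
  qed
  moreover have "partial_deriv j F \<in> ?I" if "j \<in> {1..n}" for j
    using that by (auto intro!: exI[of _ "\<lambda>i. if i = j then 1 else 0"] s simp: if_distrib[of "\<lambda>x. x * _"] cong: if_cong)
  ultimately have "gradient_ideal n F \<subseteq> ?I" by (intro G(3)) auto
  then show "\<exists>r. (\<forall>i. r i \<in> mpolyn n) \<and> a = (\<Sum>i\<in>{1..n}. r i * partial_deriv i F)" using a by auto
next
  have S: "(\<lambda>i. partial_deriv i F) ` {1..n} \<subseteq> mpolyn n" using pd_closed_mpolyn[OF F] by auto
  note G = genideal_ring_on[OF is_subring_mpolyn S, folded mpoly_ring_eq, folded gradient_ideal_def]
  assume "\<exists>r. (\<forall>i. r i \<in> mpolyn n) \<and> a = (\<Sum>i\<in>{1..n}. r i * partial_deriv i F)"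
  then show "a \<in> gradient_ideal n F"
    using G(2) by (auto intro!: ideal_in_sum[OF G(1)] ideal_inD(4)[OF is_subring_mpolyn G(1)])
qed

lemma ideal_in_gradient: "F \<in> mpolyn n \<Longrightarrow> ideal_in (mpolyn n) (gradient_ideal n F)"
  unfolding gradient_ideal_def mpoly_ring_eq
  by (intro genideal_ring_on is_subring_mpolyn) (auto intro: pd_closed_mpolyn)

lemma pd_in_gradient_ideal: "F \<in> mpolyn n \<Longrightarrow> i \<in> {1..n} \<Longrightarrow> partial_deriv i F \<in> gradient_ideal n F"
  unfolding gradient_ideal_def mpoly_ring_eq
  using genideal_ring_on(2)[OF is_subring_mpolyn, of "(\<lambda>i. partial_deriv i F) ` {1..n}" n] pd_closed_mpolyn[of F]
  by (auto simp: image_subset_iff)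

lemma PIdl_iff: "a \<in> PIdl\<^bsub>mpoly_ring n\<^esub> F \<longleftrightarrow> (\<exists>r\<in>mpolyn n. a = r * F)"
  by (auto simp: cgenideal_def mpoly_ring_eq)

section \<open>Derivations, and bases of logarithmic derivations\<close>

definition vfield :: "nat \<Rightarrow> (nat \<Rightarrow> (nat, 'k::field) mpoly) \<Rightarrow> (nat, 'k) mpoly \<Rightarrow> (nat, 'k) mpoly" where
  "vfield n a = (\<lambda>p\<in>mpolyn n. \<Sum>i\<in>{1..n}. a i * partial_deriv i p)"

lemma derivations_iff:
  "\<theta> \<in> derivations n \<longleftrightarrow> \<theta> \<in> extensional (mpolyn n) \<and> (\<forall>p\<in>mpolyn n. \<theta> p \<in> mpolyn n) \<and>
     (\<forall>p\<in>mpolyn n. \<forall>q\<in>mpolyn n. \<theta> (p + q) = \<theta> p + \<theta> q) \<and>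
     (\<forall>c. \<forall>p\<in>mpolyn n. \<theta> (Const c * p) = Const c * \<theta> p) \<and>
     (\<forall>p\<in>mpolyn n. \<forall>q\<in>mpolyn n. \<theta> (p * q) = \<theta> p * q + p * \<theta> q)"
  unfolding derivations_def carrier_mpoly_ring Let_def PiE_def by auto

lemma vfield_apply: "p \<in> mpolyn n \<Longrightarrow> vfield n a p = (\<Sum>i\<in>{1..n}. a i * partial_deriv i p)"
  by (simp add: vfield_def)

lemma vfield_Var: "i \<in> {1..n} \<Longrightarrow> vfield n a (Var i) = a i"
  by (auto simp: vfield_apply Var_in_mpolyn pd_Var if_distrib[of "\<lambda>x. _ * x"] cong: if_cong)

lemma vfield_cong: "(\<And>i. i \<in> {1..n} \<Longrightarrow> a i = b i) \<Longrightarrow> vfield n a = vfield n b"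
  unfolding vfield_def by (intro restrict_ext sum.cong) auto

lemma vfield_in_derivations:
  fixes a :: "nat \<Rightarrow> (nat, 'k::field) mpoly"
  assumes a: "\<And>i. i \<in> {1..n} \<Longrightarrow> a i \<in> mpolyn n"
  shows "vfield n a \<in> derivations n"
proof -
  note s = is_subringD[OF is_subring_mpolyn]
  have c: "(\<Sum>i\<in>{1..n}. a i * partial_deriv i p) \<in> mpolyn n" if "p \<in> mpolyn n" for p
    using that a by (intro is_subring_sum is_subring_mpolyn s pd_closed_mpolyn) auto
  have Cp: "Const c * p \<in> mpolyn n" if "p \<in> mpolyn n" for p c using that by (intro s Const_in_mpolyn)
  have pq: "p + q \<in> mpolyn n" "p * q \<in> mpolyn n" if "p \<in> mpolyn n" "q \<in> mpolyn n" for p q :: "(nat, 'k) mpoly"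
    using that by (auto intro: s)
  show ?thesis unfolding derivations_iff
  proof (intro conjI ballI allI)
    show "vfield n a \<in> extensional (mpolyn n)" by (simp add: vfield_def)
  next
    fix p :: "(nat, 'k) mpoly" assume p: "p \<in> mpolyn n"
    show "vfield n a p \<in> mpolyn n" using c p by (simp add: vfield_apply)
  next
    fix k and p :: "(nat, 'k) mpoly" assume "p \<in> mpolyn n"
    then show "vfield n a (Const k * p) = Const k * vfield n a p"
      by (simp add: vfield_apply Cp pd_mult) (simp add: sum_distrib_left mult_ac)
  next
    fix p q :: "(nat, 'k) mpoly" assume p: "p \<in> mpolyn n" "q \<in> mpolyn n"
    show "vfield n a (p + q) = vfield n a p + vfield n a q"
      using p by (simp add: vfield_apply pq pd_add distrib_left sum.distrib)
    show "vfield n a (p * q) = vfield n a p * q + p * vfield n a q"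
      using p by (simp add: vfield_apply pq pd_mult distrib_left sum.distrib sum_distrib_left sum_distrib_right mult_ac add_ac)
  qed
qed

text \<open>A derivation kills \<open>1 = 1 * 1\<close>, hence by linearity all constants; so both sides are derivations
  that agree on constants and variables.\<close>

lemma derivation_chain_rule:
  fixes \<theta> :: "(nat, 'k::field) mpoly \<Rightarrow> (nat, 'k) mpoly"
  assumes "\<theta> \<in> derivations n" "p \<in> mpolyn n"
  shows "\<theta> p = (\<Sum>i\<in>{1..n}. \<theta> (Var i) * partial_deriv i p)"
proof -
  note s = is_subringD[OF is_subring_mpolyn]
  note d = assms(1)[unfolded derivations_iff]
  have "\<theta> (1 * 1) = \<theta> 1 * 1 + 1 * \<theta> 1" using d s(1) by blast
  then have "\<theta> 1 = \<theta> 1 + \<theta> 1" by (simp only: mult_1_left mult_1_right)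
  then have 1: "\<theta> 1 = 0" by (metis add_cancel_right_right)
  have C: "\<theta> (Const c) = 0" for c
  proof -
    have "\<theta> (Const c * 1) = Const c * \<theta> 1" using d s(1) by blast
    then show ?thesis using 1 by simp
  qed
  let ?X = "{p \<in> mpolyn n. \<theta> p = (\<Sum>i\<in>{1..n}. \<theta> (Var i) * partial_deriv i p)}"
  have "mpolys UNIV {1..n} \<subseteq> ?X"
  proof (rule mpolys_subset_closed)
    show "Const c \<in> ?X" for c by (simp add: C Const_in_mpolyn)
    show "Var i \<in> ?X" if "i \<in> {1..n}" for i
      using that by (auto simp: Var_in_mpolyn pd_Var if_distrib[of "\<lambda>x. _ * x"] cong: if_cong)
  next
    fix p q assume pq: "p \<in> ?X" "q \<in> ?X"
    then have "\<theta> (p + q) = \<theta> p + \<theta> q" "\<theta> (p * q) = \<theta> p * q + p * \<theta> q" using d by auto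
    then show "p + q \<in> ?X" "p * q \<in> ?X"
      using pq by (auto simp: pd_add pd_mult distrib_left sum.distrib sum_distrib_left sum_distrib_right mult_ac intro: s)
  qed simp
  then show ?thesis using assms(2) unfolding mpolyn_def by blast
qed

lemma derivation_eq_vfield:
  assumes "\<theta> \<in> derivations n" shows "\<theta> = vfield n (\<lambda>i. \<theta> (Var i))"
proof (rule extensionalityI)
  show "\<theta> \<in> extensional (mpolyn n)" using assms by (simp add: derivations_iff)
qed (auto simp: vfield_apply derivation_chain_rule[OF assms] vfield_def)

lemma derivation_Var_closed: "\<theta> \<in> derivations n \<Longrightarrow> i \<in> {1..n} \<Longrightarrow> \<theta> (Var i) \<in> mpolyn n"
  by (simp add: derivations_iff Var_in_mpolyn)

lemma derivation_eqI:
  assumes "\<theta> \<in> derivations n" "\<eta> \<in> derivations n" "\<And>i. i \<in> {1..n} \<Longrightarrow> \<theta> (Var i) = \<eta> (Var i)"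
  shows "\<theta> = \<eta>"
proof -
  have "\<theta> = vfield n (\<lambda>i. \<theta> (Var i))" by (rule derivation_eq_vfield[OF assms(1)])
  also have "\<dots> = vfield n (\<lambda>i. \<eta> (Var i))" by (rule vfield_cong[OF assms(3)])
  also have "\<dots> = \<eta>" by (rule derivation_eq_vfield[OF assms(2), symmetric])
  finally show ?thesis .
qed

lemma log_derivations_simps:
  "carrier (log_derivations n F) = {\<theta> \<in> derivations n. \<exists>r\<in>mpolyn n. \<theta> F = r * F}"
  "zero (log_derivations n F) = (\<lambda>p\<in>mpolyn n. 0)"
  "add (log_derivations n F) = (\<lambda>\<theta> \<eta>. \<lambda>p\<in>mpolyn n. \<theta> p + \<eta> p)"
  "smult (log_derivations n F) = (\<lambda>r \<theta>. \<lambda>p\<in>mpolyn n. r * \<theta> p)"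
  by (simp_all add: log_derivations_def Let_def carrier_mpoly_ring PIdl_iff)

lemma derivation_add: assumes "\<theta> \<in> derivations n" "\<eta> \<in> derivations n"
  shows "(\<lambda>p\<in>mpolyn n. \<theta> p + \<eta> p) \<in> derivations n"
proof -
  have "(\<lambda>p\<in>mpolyn n. \<theta> p + \<eta> p) = vfield n (\<lambda>i. \<theta> (Var i) + \<eta> (Var i))"
    unfolding vfield_def using assms
    by (intro restrict_ext) (simp add: derivation_chain_rule[of _ n] distrib_right sum.distrib)
  then show ?thesis using assms
    by (auto intro!: vfield_in_derivations derivation_Var_closed is_subringD[OF is_subring_mpolyn])
qed

lemma derivation_smult: assumes "\<theta> \<in> derivations n" "r \<in> mpolyn n"
  shows "(\<lambda>p\<in>mpolyn n. r * \<theta> p) \<in> derivations n"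
proof -
  have "(\<lambda>p\<in>mpolyn n. r * \<theta> p) = vfield n (\<lambda>i. r * \<theta> (Var i))"
    unfolding vfield_def using assms
    by (intro restrict_ext) (simp add: derivation_chain_rule[of _ n] sum_distrib_left mult.assoc)
  then show ?thesis using assms
    by (auto intro!: vfield_in_derivations derivation_Var_closed is_subringD[OF is_subring_mpolyn])
qed

lemma derivation_0: "(\<lambda>p\<in>mpolyn n. 0) \<in> derivations n"
  using vfield_in_derivations[OF is_subringD(2)[OF is_subring_mpolyn], of n] by (simp add: vfield_def)

lemma module_log_derivations:
  fixes F :: "(nat, 'k::field) mpoly"
  assumes F: "F \<in> mpolyn n"
  shows "module (mpoly_ring n) (log_derivations n F)"
proof -
  note s = is_subringD[OF is_subring_mpolyn]
  have P: "\<theta> p \<in> mpolyn n" if "\<theta> \<in> derivations n" "p \<in> mpolyn n" for \<theta> and p :: "(nat, 'k) mpoly"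
    using that by (auto simp: derivations_iff)
  have E: "\<theta> \<in> extensional (mpolyn n)" if "\<theta> \<in> derivations n" for \<theta> :: "(nat, 'k) mpoly \<Rightarrow> _"
    using that by (auto simp: derivations_iff)
  have add: "\<exists>r\<in>mpolyn n. a + b = r * F" if "\<exists>r\<in>mpolyn n. a = r * F" "\<exists>r\<in>mpolyn n. b = r * F" for a b
    using that by (metis distrib_right s(3))
  have mul: "\<exists>r\<in>mpolyn n. t * a = r * F" if "t \<in> mpolyn n" "\<exists>r\<in>mpolyn n. a = r * F" for a t
    using that by (metis mult.assoc s(4))
  show ?thesis
  proof (rule moduleI)
    show "cring (mpoly_ring n)" unfolding mpoly_ring_eq by (rule cring_ring_on[OF is_subring_mpolyn])
    show "abelian_group (log_derivations n F)"
    proof (rule abelian_groupI; unfold log_derivations_simps)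
      show "(\<lambda>p\<in>mpolyn n. 0) \<in> {\<theta> \<in> derivations n. \<exists>r\<in>mpolyn n. \<theta> F = r * F}"
        using F s(2) by (auto simp: derivation_0 intro!: bexI[of _ 0])
      fix x assume x: "x \<in> {\<theta> \<in> derivations n. \<exists>r\<in>mpolyn n. \<theta> F = r * F}"
      show "\<exists>y\<in>{\<theta> \<in> derivations n. \<exists>r\<in>mpolyn n. \<theta> F = r * F}. (\<lambda>p\<in>mpolyn n. y p + x p) = (\<lambda>p\<in>mpolyn n. 0)"
      proof
        have m1: "- 1 \<in> mpolyn n" by (intro s)
        show "(\<lambda>p\<in>mpolyn n. (- 1) * x p) \<in> {\<theta> \<in> derivations n. \<exists>r\<in>mpolyn n. \<theta> F = r * F}"
          using x F mul[OF m1, of "x F"] derivation_smult[OF _ m1, of x] by simp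
        show "(\<lambda>p\<in>mpolyn n. (\<lambda>p\<in>mpolyn n. (- 1) * x p) p + x p) = (\<lambda>p\<in>mpolyn n. 0)"
          by (intro restrict_ext) simp
      qed
    qed (use F add E in \<open>auto simp: derivation_add P add_ac s intro!: restrict_ext extensionalityI[of _ "mpolyn n"]\<close>)
  next
    fix a :: "(nat, 'k) mpoly" and x assume "a \<in> carrier (mpoly_ring n)" "x \<in> carrier (log_derivations n F)"
    then show "a \<odot>\<^bsub>log_derivations n F\<^esub> x \<in> carrier (log_derivations n F)"
      using F mul[of a "x F"] by (auto simp: log_derivations_simps carrier_mpoly_ring derivation_smult)
  qed (use F E in \<open>auto simp: log_derivations_simps mpoly_ring_eq P s algebra_simps intro!: restrict_ext extensionalityI[of _ "mpolyn n"]\<close>)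
qed

lemma finsum_log_derivations:
  fixes F :: "(nat, 'k::field) mpoly"
  assumes F: "F \<in> mpolyn n" and T: "finite T" "T \<subseteq> carrier (log_derivations n F)"
    and c: "\<And>b. b \<in> T \<Longrightarrow> c b \<in> mpolyn n"
  shows "finsum (log_derivations n F) (\<lambda>b. c b \<odot>\<^bsub>log_derivations n F\<^esub> b) T = (\<lambda>p\<in>mpolyn n. \<Sum>b\<in>T. c b * b p)"
proof -
  interpret module "mpoly_ring n" "log_derivations n F" by (rule module_log_derivations[OF F])
  show ?thesis using T c
  proof (induction T)
    case empty then show ?case by (simp add: log_derivations_simps)
  next
    case (insert b T)
    have "finsum (log_derivations n F) (\<lambda>b. c b \<odot>\<^bsub>log_derivations n F\<^esub> b) (insert b T) =
       (c b \<odot>\<^bsub>log_derivations n F\<^esub> b) \<oplus>\<^bsub>log_derivations n F\<^esub>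
       finsum (log_derivations n F) (\<lambda>b. c b \<odot>\<^bsub>log_derivations n F\<^esub> b) T"
      using insert.prems insert.hyps
      by (intro M.finsum_insert) (auto intro!: smult_closed simp: carrier_mpoly_ring)
    moreover have "finsum (log_derivations n F) (\<lambda>b. c b \<odot>\<^bsub>log_derivations n F\<^esub> b) T = (\<lambda>p\<in>mpolyn n. \<Sum>b\<in>T. c b * b p)"
      using insert by auto
    ultimately have "finsum (log_derivations n F) (\<lambda>b. c b \<odot>\<^bsub>log_derivations n F\<^esub> b) (insert b T) =
       (c b \<odot>\<^bsub>log_derivations n F\<^esub> b) \<oplus>\<^bsub>log_derivations n F\<^esub> (\<lambda>p\<in>mpolyn n. \<Sum>b\<in>T. c b * b p)"
      by (simp only:)
    also have "\<dots> = (\<lambda>p\<in>mpolyn n. \<Sum>b\<in>insert b T. c b * b p)"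
      unfolding log_derivations_simps using insert.hyps by (intro restrict_ext) simp
    finally show ?case .
  qed
qed

text \<open>Derivations are determined by their values on the variables, so bases can be recognised on
  vectors of polynomials. Coefficients are taken over arbitrary finite subsets of \<open>B\<close>, in place of the
  support of a coefficient function on \<open>B\<close>.\<close>

definition spans_log_derivations :: "nat \<Rightarrow> (nat, 'k::field) mpoly \<Rightarrow> ((nat, 'k) mpoly \<Rightarrow> (nat, 'k) mpoly) set \<Rightarrow> bool" where
  "spans_log_derivations n F B \<longleftrightarrow> (\<forall>\<theta>\<in>carrier (log_derivations n F). \<exists>T c. finite T \<and> T \<subseteq> B \<and> (\<forall>b\<in>T. c b \<in> mpolyn n) \<and>
     (\<forall>i\<in>{1..n}. \<theta> (Var i) = (\<Sum>b\<in>T. c b * b (Var i))))"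

definition indep_derivations :: "nat \<Rightarrow> ((nat, 'k::field) mpoly \<Rightarrow> (nat, 'k) mpoly) set \<Rightarrow> bool" where
  "indep_derivations n B \<longleftrightarrow> (\<forall>T c. finite T \<longrightarrow> T \<subseteq> B \<longrightarrow> (\<forall>b\<in>T. c b \<in> mpolyn n) \<longrightarrow>
     (\<forall>i\<in>{1..n}. (\<Sum>b\<in>T. c b * b (Var i)) = 0) \<longrightarrow> (\<forall>b\<in>T. c b = 0))"

lemma module_basis_iff:
  fixes F :: "(nat, 'k::field) mpoly"
  assumes F: "F \<in> mpolyn n"
  shows "module_basis (mpoly_ring n) (log_derivations n F) B \<longleftrightarrow>
    B \<subseteq> carrier (log_derivations n F) \<and> spans_log_derivations n F B \<and> indep_derivations n B"
proof (cases "B \<subseteq> carrier (log_derivations n F)")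
  case B: True
  note s = is_subringD[OF is_subring_mpolyn]
  let ?D = "carrier (log_derivations n F)"
  let ?comb = "\<lambda>c T. (\<lambda>p\<in>mpolyn n. \<Sum>b\<in>T. c b * b p)"
  let ?ok = "\<lambda>c \<theta>. c \<in> B \<rightarrow>\<^sub>E mpolyn n \<and> finite {b\<in>B. c b \<noteq> 0} \<and>
    (\<forall>i\<in>{1..n}. \<theta> (Var i) = (\<Sum>b\<in>{b\<in>B. c b \<noteq> 0}. c b * b (Var i)))"
  have der: "\<theta> \<in> derivations n" if "\<theta> \<in> ?D" for \<theta> using that by (simp add: log_derivations_simps)
  have comb: "?comb c T \<in> derivations n" if "finite T" "T \<subseteq> B" "\<And>b. b \<in> T \<Longrightarrow> c b \<in> mpolyn n" for c T
    using that
  proof (induction T)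
    case empty
    have "?comb c {} = (\<lambda>p\<in>mpolyn n. 0)" by (intro restrict_ext) simp
    then show ?case by (simp only: derivation_0)
  next
    case (insert b T)
    have "(\<lambda>p\<in>mpolyn n. (\<lambda>p\<in>mpolyn n. c b * b p) p + ?comb c T p) \<in> derivations n"
      using insert der[of b] B by (intro derivation_add derivation_smult) auto
    moreover have "(\<lambda>p\<in>mpolyn n. (\<lambda>p\<in>mpolyn n. c b * b p) p + ?comb c T p) = ?comb c (insert b T)"
      using insert.hyps by (intro restrict_ext) auto
    ultimately show ?case by (simp only:)
  qed
  have eq: "c \<in> B \<rightarrow>\<^sub>E carrier (mpoly_ring n) \<and> finite {b\<in>B. c b \<noteq> \<zero>\<^bsub>mpoly_ring n\<^esub>} \<and>
      \<theta> = (\<Oplus>\<^bsub>log_derivations n F\<^esub>b\<in>{b\<in>B. c b \<noteq> \<zero>\<^bsub>mpoly_ring n\<^esub>}. c b \<odot>\<^bsub>log_derivations n F\<^esub> b) \<longleftrightarrow> ?ok c \<theta>"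
    if "\<theta> \<in> ?D" for c \<theta>
  proof -
    let ?T = "{b\<in>B. c b \<noteq> 0}"
    have "\<theta> = (\<Oplus>\<^bsub>log_derivations n F\<^esub>b\<in>?T. c b \<odot>\<^bsub>log_derivations n F\<^esub> b) \<longleftrightarrow>
       (\<forall>i\<in>{1..n}. \<theta> (Var i) = (\<Sum>b\<in>?T. c b * b (Var i)))" if c: "c \<in> B \<rightarrow>\<^sub>E mpolyn n" "finite ?T"
    proof -
      have *: "c b \<in> mpolyn n" if "b \<in> ?T" for b using c that by (auto dest: PiE_mem)
      have cd: "?comb c ?T \<in> derivations n" using c * by (intro comb) auto
      have f: "finsum (log_derivations n F) (\<lambda>b. c b \<odot>\<^bsub>log_derivations n F\<^esub> b) ?T = ?comb c ?T"
        using B c * by (intro finsum_log_derivations[OF F]) auto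
      show ?thesis unfolding f
      proof
        assume "\<theta> = ?comb c ?T"
        then show "\<forall>i\<in>{1..n}. \<theta> (Var i) = (\<Sum>b\<in>?T. c b * b (Var i))" by (auto simp: Var_in_mpolyn)
      next
        assume "\<forall>i\<in>{1..n}. \<theta> (Var i) = (\<Sum>b\<in>?T. c b * b (Var i))"
        then show "\<theta> = ?comb c ?T"
          by (intro derivation_eqI[OF der[OF \<open>\<theta> \<in> ?D\<close>] cd]) (auto simp: Var_in_mpolyn)
      qed
    qed
    then show ?thesis by (auto simp: mpoly_ring_eq)
  qed
  have mb: "module_basis (mpoly_ring n) (log_derivations n F) B \<longleftrightarrow> (\<forall>\<theta>\<in>?D. \<exists>!c. ?ok c \<theta>)"
    unfolding module_basis_def using B eq by (simp cong: ball_cong)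
  let ?cut = "\<lambda>T c. \<lambda>b\<in>B. if b \<in> T then c b else 0"
  have ok: "?ok (?cut T c) \<theta> \<longleftrightarrow> (\<forall>i\<in>{1..n}. \<theta> (Var i) = (\<Sum>b\<in>T. c b * b (Var i)))"
    if T: "finite T" "T \<subseteq> B" "\<And>b. b \<in> T \<Longrightarrow> c b \<in> mpolyn n"
    for T and c :: "((nat, 'k) mpoly \<Rightarrow> (nat, 'k) mpoly) \<Rightarrow> (nat, 'k) mpoly" and \<theta>
  proof -
    have "?cut T c \<in> B \<rightarrow>\<^sub>E mpolyn n" using T s(2) by auto
    moreover have "finite {b\<in>B. ?cut T c b \<noteq> 0}" by (rule finite_subset[OF _ T(1)]) auto
    moreover have "(\<Sum>b\<in>{b\<in>B. ?cut T c b \<noteq> 0}. ?cut T c b * b (Var i)) = (\<Sum>b\<in>T. c b * b (Var i))" for i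
    proof -
      have "(\<Sum>b\<in>{b\<in>B. ?cut T c b \<noteq> 0}. ?cut T c b * b (Var i)) = (\<Sum>b\<in>T. ?cut T c b * b (Var i))"
        using T by (intro sum.mono_neutral_left) auto
      also have "\<dots> = (\<Sum>b\<in>T. c b * b (Var i))" using T by (intro sum.cong) auto
      finally show ?thesis .
    qed
    ultimately show ?thesis by auto
  qed
  have "(\<forall>\<theta>\<in>?D. \<exists>!c. ?ok c \<theta>) \<longleftrightarrow> spans_log_derivations n F B \<and> indep_derivations n B"
  proof (intro iffI conjI)
    assume L: "\<forall>\<theta>\<in>?D. \<exists>!c. ?ok c \<theta>"
    show "spans_log_derivations n F B" unfolding spans_log_derivations_def
    proof
      fix \<theta> assume "\<theta> \<in> ?D"
      then obtain c where c: "?ok c \<theta>" using L by blast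
      then show "\<exists>T c. finite T \<and> T \<subseteq> B \<and> (\<forall>b\<in>T. c b \<in> mpolyn n) \<and>
         (\<forall>i\<in>{1..n}. \<theta> (Var i) = (\<Sum>b\<in>T. c b * b (Var i)))"
        by (intro exI[of _ "{b\<in>B. c b \<noteq> 0}"] exI[of _ c]) (auto dest: PiE_mem)
    qed
    show "indep_derivations n B" unfolding indep_derivations_def
    proof (intro allI impI)
      fix T and c :: "((nat, 'k) mpoly \<Rightarrow> (nat, 'k) mpoly) \<Rightarrow> (nat, 'k) mpoly"
      assume T: "finite T" "T \<subseteq> B" "\<forall>b\<in>T. c b \<in> mpolyn n" "\<forall>i\<in>{1..n}. (\<Sum>b\<in>T. c b * b (Var i)) = 0"
      interpret module "mpoly_ring n" "log_derivations n F" by (rule module_log_derivations[OF F])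
      let ?z = "\<lambda>p\<in>mpolyn n. 0 :: (nat, 'k) mpoly"
      have z: "?z \<in> ?D" using M.zero_closed by (simp add: log_derivations_simps)
      have "?ok (?cut T c) ?z" using T by (subst ok) (auto simp: Var_in_mpolyn)
      moreover have "?ok (?cut {} c) ?z" by (subst ok) (auto simp: Var_in_mpolyn)
      ultimately have "?cut T c = ?cut {} c" using L z by blast
      then have cut: "?cut T c b = ?cut {} c b" for b by (rule fun_cong)
      show "\<forall>b\<in>T. c b = 0"
      proof
        fix b assume "b \<in> T"
        then show "c b = 0" using cut[of b] T(2) by auto
      qed
    qed
  next
    assume R: "spans_log_derivations n F B \<and> indep_derivations n B"
    show "\<forall>\<theta>\<in>?D. \<exists>!c. ?ok c \<theta>"
    proof
      fix \<theta> assume "\<theta> \<in> ?D"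
      then obtain T c where T: "finite T" "T \<subseteq> B" "\<forall>b\<in>T. c b \<in> mpolyn n"
        "\<forall>i\<in>{1..n}. \<theta> (Var i) = (\<Sum>b\<in>T. c b * b (Var i))"
        using R unfolding spans_log_derivations_def by meson
      have ex: "?ok (?cut T c) \<theta>" using T by (subst ok) auto
      have uni: "c1 = c2" if c1: "?ok c1 \<theta>" and c2: "?ok c2 \<theta>" for c1 c2
      proof -
        let ?T = "{b\<in>B. c1 b \<noteq> 0} \<union> {b\<in>B. c2 b \<noteq> 0}"
        have ft: "finite ?T" using c1 c2 by auto
        have 1: "(\<Sum>b\<in>{b\<in>B. c1 b \<noteq> 0}. c1 b * b (Var i)) = (\<Sum>b\<in>?T. c1 b * b (Var i))" for i
          using ft by (intro sum.mono_neutral_left) auto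
        have 2: "(\<Sum>b\<in>{b\<in>B. c2 b \<noteq> 0}. c2 b * b (Var i)) = (\<Sum>b\<in>?T. c2 b * b (Var i))" for i
          using ft by (intro sum.mono_neutral_left) auto
        have "\<forall>i\<in>{1..n}. (\<Sum>b\<in>?T. (c1 b - c2 b) * b (Var i)) = 0"
          using c1 c2 unfolding 1 2 by (simp add: left_diff_distrib sum_subtractf)
        moreover have "\<forall>b\<in>?T. c1 b - c2 b \<in> mpolyn n" using c1 c2 by (auto intro!: s dest: PiE_mem)
        ultimately have diff: "\<forall>b\<in>?T. c1 b - c2 b = 0"
          using R[THEN conjunct2, unfolded indep_derivations_def, rule_format, of ?T "\<lambda>b. c1 b - c2 b"] ft by blast
        have eq12: "c1 b = c2 b" if "b \<in> B" for b
        proof (cases "b \<in> ?T")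
          case True
          then have "c1 b - c2 b = 0" using diff by blast
          then show ?thesis by (simp only: right_minus_eq)
        next
          case False
          then have "c1 b = 0" "c2 b = 0" using that by blast+
          then show ?thesis by simp
        qed
        have "c1 \<in> B \<rightarrow>\<^sub>E mpolyn n" "c2 \<in> B \<rightarrow>\<^sub>E mpolyn n" using c1 c2 by simp_all
        then show "c1 = c2" by (rule PiE_ext) (rule eq12)
      qed
      show "\<exists>!c. ?ok c \<theta>" by (rule ex1I[of "\<lambda>c. ?ok c \<theta>", OF ex]) (rule uni[OF _ ex])
    qed
  qed
  then show ?thesis using mb B by simp
qed (simp add: module_basis_def)

section \<open>Divisibility by a variable and squarefree polynomials\<close>

lemma poly_in_mpolys:
  assumes "Q \<in> polys (mpolys UNIV V)" "v \<in> V" shows "poly Q (Var v) \<in> mpolys UNIV V"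
  using assms(1)
  by (induction Q rule: pCons_induct)
    (auto simp: pCons_in_polys_iff intro!: is_subringD[OF is_subring_mpolys] Var_in_mpolys assms(2))

lemma Var_dvdI:
  assumes "w \<in> mpolys UNIV V" "v \<in> V" "coeff (univ_in v w) 0 = 0"
  shows "\<exists>w'\<in>mpolys UNIV V. w = Var v * w'"
proof -
  obtain Q where Q: "univ_in v w = pCons 0 Q" using assms(3) by (metis pCons_cases coeff_pCons_0)
  have "Q \<in> polys (mpolys UNIV V)"
    using univ_in_polys[OF assms(1), of v] polys_mono[OF mpolys_mono[OF subset_refl, of "V - {v}" V]]
    unfolding Q pCons_in_polys_iff by blast
  then have "poly Q (Var v) \<in> mpolys UNIV V" using assms(2) by (rule poly_in_mpolys)
  moreover have "w = Var v * poly Q (Var v)" using poly_univ[of v w] unfolding Q by simp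
  ultimately show ?thesis by blast
qed

lemma univ_coeff_0_hom: "is_hom (\<lambda>p. coeff (univ_in v p) 0)"
  unfolding is_hom_def by (simp add: is_homD[OF is_hom_univ] coeff_mult_0)

lemma univ_coeff_closed: "p \<in> mpolyn n \<Longrightarrow> 0 < n \<Longrightarrow> coeff (univ_in n p) k \<in> mpolyn (n - 1)"
proof -
  assume p: "p \<in> mpolyn n" "0 < n"
  have "{1..n} - {n} = {1..n-1}" using p(2) by auto
  then show ?thesis using univ_in_polys[OF p(1)[unfolded mpolyn_def], of n] by (simp add: mpolyn_def polys_def)
qed

lemma univ_in_free_mpolyn: "p \<in> mpolyn k \<Longrightarrow> k < v \<Longrightarrow> univ_in v p = [:p:]"
  unfolding mpolyn_def by (rule univ_free) auto

lemma Var_nonzero: "Var v \<noteq> (0 :: ('v, 'k::field) mpoly)"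
  unfolding Var_def by (metis lookup_single_eq lookup_zero zero_neq_one)

text \<open>The variable \<open>v\<close> is prime, as setting it to zero is a homomorphism to a domain. Hence a factor
  \<open>p\<close> that \<open>v\<close> does not divide can be separated from a power of \<open>v\<close>.\<close>

lemma cancel_Var_power:
  fixes p :: "(nat, 'k::field) mpoly"
  assumes "p * w = Var v ^ k * c" "w \<in> mpolyn n" "v \<in> {1..n}" "coeff (univ_in v p) 0 \<noteq> 0"
  shows "\<exists>w'\<in>mpolyn n. p * w' = c"
  using assms(1,2)
proof (induction k arbitrary: w)
  case 0 then show ?case by auto
next
  case (Suc k)
  note h = is_homD[OF univ_coeff_0_hom[of v]]
  have "coeff (univ_in v p) 0 * coeff (univ_in v w) 0 = coeff (univ_in v (Var v ^ Suc k * c)) 0"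
    using Suc.prems(1) h(4) by metis
  also have "\<dots> = 0" by (simp add: h univ_Var)
  finally have "coeff (univ_in v w) 0 = 0" using assms(4) by simp
  then obtain w' where w': "w' \<in> mpolyn n" "w = Var v * w'"
    using Var_dvdI[of w "{1..n}" v] Suc.prems(2) assms(3) unfolding mpolyn_def by auto
  have "Var v * (p * w') = Var v * (Var v ^ k * c)" using Suc.prems(1) w'(2) by (simp add: mult_ac)
  then have "p * w' = Var v ^ k * c" by (simp add: Var_nonzero)
  then show ?case using Suc.IH w'(1) by auto
qed

lemma Const_inverse: "c \<noteq> 0 \<Longrightarrow> Const (inverse c) * (Const c * p) = (p :: ('v, 'k::field) mpoly)"
  by (simp add: mult.assoc[symmetric] is_homD(4)[OF is_hom_Const, symmetric] is_homD(1)[OF is_hom_Const])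

lemma of_nat_mpoly_neq_0: "0 < k \<Longrightarrow> of_nat k \<noteq> (0 :: (nat, 'k::field_char_0) mpoly)"
  using Const_mult_eq_0_iff[of "of_nat k :: 'k" 1] by (simp add: of_nat_mpoly)

text \<open>Degrees in the last variable add up, so no factor involves that variable if the product does not.\<close>

lemma factor_free_of_last_variable:
  fixes p :: "(nat, 'k::field) mpoly"
  assumes "p * w \<in> mpolyn (n - 1)" "p * w \<noteq> 0" "p \<in> mpolyn n" "0 < n"
  shows "p \<in> mpolyn (n - 1)"
proof -
  have "univ_in n p * univ_in n w = [:p * w:]"
    using univ_in_free_mpolyn[OF assms(1), of n] assms(4) by (simp add: is_homD[OF is_hom_univ])
  moreover have "univ_in n p \<noteq> 0" "univ_in n w \<noteq> 0"
    using assms(2) poly_univ[of n p] poly_univ[of n w] by auto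
  ultimately have "degree (univ_in n p) = 0"
    by (metis add_is_0 degree_mult_eq degree_pCons_0)
  then have "univ_in n p = [:coeff (univ_in n p) 0:]" by (metis degree_0_id)
  then have "p = coeff (univ_in n p) 0" using poly_univ[of n p] by (metis mult_zero_right poly_0 poly_pCons add.right_neutral)
  then show ?thesis using univ_coeff_closed[OF assms(3,4), of 0] by simp
qed

lemma squarefree_iff:
  "squarefree_in (mpoly_ring n) a \<longleftrightarrow> a \<in> mpolyn n \<and>
     (\<forall>p\<in>mpolyn n. \<forall>r\<in>mpolyn n. a = p * p * r \<longrightarrow> (\<exists>u\<in>mpolyn n. p * u = 1))"
  unfolding squarefree_in_def carrier_mpoly_ring factor_def Units_def
  by (auto simp: mpoly_ring_eq mult_ac)

lemma squarefree_nonzero: "squarefree_in (mpoly_ring n) a \<Longrightarrow> a \<noteq> 0"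
  unfolding squarefree_iff using is_subringD(2)[OF is_subring_mpolyn] by force

section \<open>The divisor \<open>g\<close> and its gradient\<close>

locale cone_family =
  fixes n d m :: nat and h :: "(nat, 'k::field_char_0) mpoly"
  assumes n3: "n \<ge> 3" and md: "d > m" and m1: "m \<ge> 1"
    and hS: "h \<in> mpolyn (n - 2)" and h_sqf: "squarefree_in (mpoly_ring (n - 2)) h"
    and h_hom: "homogeneous (d - m) h"
begin

abbreviation "y \<equiv> Var (n - 1) :: (nat, 'k) mpoly"
abbreviation "z \<equiv> Var n :: (nat, 'k) mpoly"
definition g where "g = z ^ d - y ^ m * h"

lemma h_nonzero: "h \<noteq> 0" using squarefree_nonzero[OF h_sqf] .

lemma hR: "h \<in> mpolyn n" and hR1: "h \<in> mpolyn (n - 1)"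
  using hS mpolyn_mono[of "n - 2" n] mpolyn_mono[OF diff_le_mono2[of 1 2 n]] by auto

lemma yR: "y \<in> mpolyn n" and yR1: "y \<in> mpolyn (n - 1)" and zR: "z \<in> mpolyn n"
  using n3 by (auto intro: Var_in_mpolyn)

lemma gR: "g \<in> mpolyn n"
  unfolding g_def by (intro is_subringD[OF is_subring_mpolyn] yR zR hR)

lemma pd_h_zero: "n - 2 < i \<Longrightarrow> partial_deriv i h = 0"
  using hS unfolding mpolyn_def by (rule pd_free) auto

lemma pd_g: "partial_deriv n g = of_nat d * z ^ (d - 1)"
  "partial_deriv (n - 1) g = - (of_nat m * y ^ (m - 1) * h)"
  "i \<le> n - 2 \<Longrightarrow> partial_deriv i g = - (y ^ m * partial_deriv i h)"
  using n3 pd_h_zero[of n] pd_h_zero[of "n - 1"] unfolding g_def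
  by (auto simp: pd_diff pd_power pd_mult pd_Var)

lemma univ_z: "univ_in n z = [:0, 1:]" "univ_in n y = [:y:]" "univ_in n h = [:h:]"
  "univ_in (n - 1) y = [:0, 1:]" "univ_in (n - 1) h = [:h:]"
  using n3 hS by (auto simp: univ_Var univ_in_free_mpolyn)

lemma univ_g: "univ_in n g = monom 1 d - [:y ^ m * h:]"
proof -
  have "univ_in n g = [:0, 1:] ^ d - [:y:] ^ m * [:h:]"
    unfolding g_def by (simp only: is_homD[OF is_hom_univ] univ_z)
  moreover have "[:y:] ^ m * [:h:] = [:y ^ m * h:]"
    by (simp add: is_homD(7)[OF is_hom_const_poly, symmetric])
  ultimately show ?thesis by (simp only: monom_altdef mult_1_left smult_1_left)
qed

lemma y_power_nonzero: "y ^ k \<noteq> 0" by (simp add: Var_nonzero)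

lemma univ_g_0: "coeff (univ_in n g) 0 = - (y ^ m * h)"
  using md by (simp add: univ_g)

text \<open>If \<open>g = p\<^sup>2 r\<close>, the product rule makes \<open>p\<close> a divisor of \<open>\<partial>g/\<partial>z = d z\<^bsup>d-1\<^esup>\<close>; but \<open>z\<close> does not divide \<open>g\<close>.\<close>

lemma squarefree_g: "squarefree_in (mpoly_ring n) g"
  unfolding squarefree_iff
proof (intro conjI ballI impI gR)
  note s = is_subringD[OF is_subring_mpolyn]
  fix p r assume p: "p \<in> mpolyn n" and r: "r \<in> mpolyn n" and g: "g = p * p * r"
  have "coeff (univ_in n g) 0 \<noteq> 0" using h_nonzero y_power_nonzero by (simp add: univ_g_0)
  then have p0: "coeff (univ_in n p) 0 \<noteq> 0" unfolding g by (auto simp: is_homD[OF univ_coeff_0_hom])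
  define w where "w = Const (inverse (of_nat d)) * (of_nat 2 * partial_deriv n p * r + p * partial_deriv n r)"
  have "p * (of_nat 2 * partial_deriv n p * r + p * partial_deriv n r) = of_nat d * z ^ (d - 1)"
    unfolding pd_g(1)[symmetric] g by (simp add: pd_mult algebra_simps)
  then have eq: "p * (of_nat 2 * partial_deriv n p * r + p * partial_deriv n r) = of_nat d * z ^ (d - 1)"
    by (simp only: )
  have "p * w = Const (inverse (of_nat d)) * (p * (of_nat 2 * partial_deriv n p * r + p * partial_deriv n r))"
    unfolding w_def by (rule mult.left_commute)
  then have "p * w = Const (inverse (of_nat d)) * (Const (of_nat d) * z ^ (d - 1))"
    by (simp only: eq of_nat_mpoly[of d])
  then have "p * w = z ^ (d - 1) * 1" using md by (simp only: Const_inverse mult_1_right of_nat_eq_0_iff)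
  moreover have "w \<in> mpolyn n" unfolding w_def by (intro s p r Const_in_mpolyn pd_closed_mpolyn)
  ultimately show "\<exists>u\<in>mpolyn n. p * u = 1" using n3 p0 by (intro cancel_Var_power[of p w n "d - 1" 1]) auto
qed

text \<open>If \<open>g h = p\<^sup>2 r\<close>, then \<open>p\<close> divides \<open>\<partial>(g h)/\<partial>z = d z\<^bsup>d-1\<^esup> h\<close> and hence \<open>h\<close>, so it involves neither \<open>z\<close> nor
  \<open>y\<close>. Since \<open>g h = z\<^sup>d h - y\<^sup>m h\<^sup>2\<close>, the coefficient of \<open>z\<^sup>d\<close>, at \<open>y = 0\<close>, exhibits \<open>p\<^sup>2\<close> as a divisor of \<open>h\<close>.\<close>

lemma squarefree_gh: "squarefree_in (mpoly_ring n) (g * h)"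
  unfolding squarefree_iff
proof (intro conjI ballI impI)
  note s = is_subringD[OF is_subring_mpolyn]
  show "g * h \<in> mpolyn n" by (intro s gR hR)
  fix p r assume p: "p \<in> mpolyn n" and r: "r \<in> mpolyn n" and g: "g * h = p * p * r"
  have "coeff (univ_in n (g * h)) 0 \<noteq> 0"
    using h_nonzero y_power_nonzero by (simp add: univ_g_0 is_homD[OF univ_coeff_0_hom] univ_z)
  then have p0: "coeff (univ_in n p) 0 \<noteq> 0" unfolding g by (auto simp: is_homD[OF univ_coeff_0_hom])
  define w where "w = Const (inverse (of_nat d)) * (of_nat 2 * partial_deriv n p * r + p * partial_deriv n r)"
  have "p * (of_nat 2 * partial_deriv n p * r + p * partial_deriv n r) = partial_deriv n (g * h)"
    unfolding g by (simp add: pd_mult algebra_simps)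
  also have "\<dots> = of_nat d * (z ^ (d - 1) * h)" using n3 by (simp add: pd_mult pd_g(1) pd_h_zero)
  finally have eq: "p * (of_nat 2 * partial_deriv n p * r + p * partial_deriv n r) = of_nat d * (z ^ (d - 1) * h)"
    by (simp only: )
  have "p * w = Const (inverse (of_nat d)) * (p * (of_nat 2 * partial_deriv n p * r + p * partial_deriv n r))"
    unfolding w_def by (rule mult.left_commute)
  then have "p * w = Const (inverse (of_nat d)) * (Const (of_nat d) * (z ^ (d - 1) * h))"
    by (simp only: eq of_nat_mpoly[of d])
  then have "p * w = z ^ (d - 1) * h" using md by (simp only: Const_inverse of_nat_eq_0_iff)
  moreover have "w \<in> mpolyn n" unfolding w_def by (intro s p r Const_in_mpolyn pd_closed_mpolyn)
  ultimately obtain w' where w': "w' \<in> mpolyn n" "p * w' = h"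
    using n3 p0 cancel_Var_power[of p w n "d - 1" h n] by auto
  have p1: "p \<in> mpolyn (n - 1)"
    using w' hR1 h_nonzero n3 p by (intro factor_free_of_last_variable[of p w']) auto
  have p2: "p \<in> mpolyn (n - 1 - 1)"
    using w' hS h_nonzero n3 p1 by (intro factor_free_of_last_variable[of p w' "n - 1"]) (simp_all add: numeral_2_eq_2)
  then have pS: "p \<in> mpolyn (n - 2)" by (simp add: numeral_2_eq_2)
  define r1 where "r1 = coeff (univ_in n r) d"
  define r2 where "r2 = coeff (univ_in (n - 1) r1) 0"
  have r1: "r1 \<in> mpolyn (n - 1)" unfolding r1_def using r n3 by (intro univ_coeff_closed) auto
  have "r2 \<in> mpolyn (n - 1 - 1)" unfolding r2_def using r1 n3 by (intro univ_coeff_closed) auto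
  then have r2: "r2 \<in> mpolyn (n - 2)" by (simp add: numeral_2_eq_2)
  have up: "univ_in n p = [:p:]" "univ_in (n - 1) p = [:p:]"
    using pS n3 by (auto simp: univ_in_free_mpolyn)
  have "univ_in n (g * h) = univ_in n (p * p * r)" using g by simp
  then have "(monom 1 d - [:y ^ m * h:]) * [:h:] = [:p * p:] * univ_in n r"
    by (simp add: is_homD[OF is_hom_univ] univ_g univ_z up)
  then have "coeff ((monom 1 d - [:y ^ m * h:]) * [:h:]) d = coeff ([:p * p:] * univ_in n r) d" by simp
  then have "h = p * p * r1"
    using md by (simp add: r1_def coeff_pCons split: nat.splits)
  from arg_cong[OF this, of "\<lambda>q. coeff (univ_in (n - 1) q) 0"] have "h = p * p * r2"
    unfolding is_homD(4)[OF univ_coeff_0_hom] up univ_z r2_def by (simp only: coeff_pCons_0)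
  then obtain u where "u \<in> mpolyn (n - 2)" "p * u = 1" using h_sqf pS r2 unfolding squarefree_iff by blast
  then show "\<exists>u\<in>mpolyn n. p * u = 1" using mpolyn_mono[of "n - 2" n] by auto
qed

lemma euler_h: "(\<Sum>i\<in>{1..n-2}. Var i * partial_deriv i h) = of_nat (d - m) * h"
  using homogeneous_euler[OF h_hom hS[unfolded mpolyn_def]] by simp

lemma exists_pd_h_nonzero: "\<exists>i\<in>{1..n-2}. partial_deriv i h \<noteq> 0"
proof (rule ccontr)
  assume "\<not> ?thesis"
  then have "of_nat (d - m) * h = 0" unfolding euler_h[symmetric] by (auto intro!: sum.neutral)
  then show False using h_nonzero of_nat_mpoly_neq_0[of "d - m", where ?'k = 'k] md by simp
qed

end

section \<open>The divisor \<open>g\<close> is not free\<close>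

lemma lookup_single_times:
  "lookup (single s 1 * p) (s + k) = (lookup p k :: 'a::comm_ring_1)"
  for s k :: "'v \<Rightarrow>\<^sub>0 nat"
  by (induction p rule: mpoly_term_induct) (auto simp: mult_single lookup_single when_def lookup_add distrib_left)

lemma exponent_add_eq_0_iff: "m + m' = 0 \<longleftrightarrow> m = 0 \<and> m' = (0 :: 'v \<Rightarrow>\<^sub>0 nat)"
  by (auto simp: poly_mapping_eq_iff lookup_add fun_eq_iff)

lemma is_hom_constant_term: "is_hom (\<lambda>p :: ('v, 'a::comm_ring_1) mpoly. lookup p 0)"
proof -
  have "lookup (p * q) 0 = lookup p 0 * lookup q 0" for p q :: "('v, 'a) mpoly"
  proof (induction p rule: mpoly_term_induct)
    case (single m c)
    show ?case
      by (induction q rule: mpoly_term_induct)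
        (auto simp: mult_single lookup_single when_def lookup_add distrib_left exponent_add_eq_0_iff)
  qed (auto simp: lookup_add distrib_right)
  then show ?thesis by (simp add: is_hom_def lookup_add)
qed

definition other_degree :: "'v \<Rightarrow> ('v \<Rightarrow>\<^sub>0 nat) \<Rightarrow> nat" where
  "other_degree v k = (\<Sum>w\<in>keys k - {v}. lookup k w)"

lemma other_degree_eq: "finite F \<Longrightarrow> keys k \<subseteq> F \<Longrightarrow> other_degree v k = (\<Sum>w\<in>F - {v}. lookup k w)"
  unfolding other_degree_def by (intro sum.mono_neutral_left) (auto simp: in_keys_iff)

lemma other_degree_add: "other_degree v (k + l) = other_degree v k + other_degree v l"
proof -
  let ?F = "keys k \<union> keys l"
  have "other_degree v (k + l) = (\<Sum>w\<in>?F - {v}. lookup (k + l) w)"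
    using keys_add[of k l] by (intro other_degree_eq) auto
  also have "\<dots> = (\<Sum>w\<in>?F - {v}. lookup k w) + (\<Sum>w\<in>?F - {v}. lookup l w)"
    by (simp add: lookup_add sum.distrib)
  also have "\<dots> = other_degree v k + other_degree v l"
    by (simp add: other_degree_eq[of ?F])
  finally show ?thesis .
qed

lemma other_degree_single: "other_degree v (single w c) = (if v = w then 0 else c)"
  by (simp add: other_degree_def lookup_single)

lemma other_degree_0 [simp]: "other_degree v 0 = 0" by (simp add: other_degree_def)

definition bihomogeneous :: "'v \<Rightarrow> nat \<Rightarrow> nat \<Rightarrow> ('v, 'a::zero) mpoly \<Rightarrow> bool" where
  "bihomogeneous v a b p \<longleftrightarrow> (\<forall>k\<in>keys p. lookup k v = a \<and> other_degree v k = b)"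

lemma bihomogeneous_mult:
  assumes "bihomogeneous v a b p" "bihomogeneous v a' b' (q :: ('v, 'a::comm_ring_1) mpoly)"
  shows "bihomogeneous v (a + a') (b + b') (p * q)"
  using assms keys_mult[of p q] unfolding bihomogeneous_def
  by (fastforce simp: lookup_add other_degree_add)

lemma bihomogeneous_add:
  "bihomogeneous v a b p \<Longrightarrow> bihomogeneous v a b q \<Longrightarrow> bihomogeneous v a b (p + q :: ('v, 'a::comm_ring_1) mpoly)"
  using keys_add[of p q] unfolding bihomogeneous_def by blast

lemma bihomogeneous_uminus:
  "bihomogeneous v a b p \<Longrightarrow> bihomogeneous v a b (- p :: ('v, 'a::comm_ring_1) mpoly)"
  unfolding bihomogeneous_def by (auto simp: in_keys_iff)

lemma bihomogeneous_Const: "bihomogeneous v 0 0 (Const c)"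
  unfolding bihomogeneous_def Const_def by (auto split: if_splits)

lemma bihomogeneous_Var_power:
  "bihomogeneous v k 0 (Var v ^ k)" "v \<noteq> w \<Longrightarrow> bihomogeneous v 0 k (Var w ^ k)"
  unfolding bihomogeneous_def Var_power by (auto simp: lookup_single other_degree_single)

lemma bihomogeneous_pd:
  fixes p :: "('v, 'a::comm_ring_1) mpoly"
  assumes "bihomogeneous v a b p" "w \<noteq> v" shows "bihomogeneous v a (b - 1) (partial_deriv w p)"
  unfolding bihomogeneous_def
proof
  fix k assume "k \<in> keys (partial_deriv w p)"
  then obtain l where l: "l \<in> keys p" "k \<in> keys (single (l - single w 1)
                      (of_nat (lookup l w) * lookup p l))"
    using keys_sum unfolding partial_deriv_def by (smt (verit) UN_iff subsetD)
  then have k: "k = l - single w 1" and "lookup l w \<noteq> 0"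
    by (auto split: if_splits intro: ccontr)
  then have lk: "l = k + single w 1"
    by (intro poly_mapping_eqI) (auto simp: lookup_add lookup_minus lookup_single when_def)
  have "lookup l v = a" "other_degree v l = b" using assms(1) l(1) by (auto simp: bihomogeneous_def)
  then show "lookup k v = a \<and> other_degree v k = b - 1"
    using assms(2) unfolding lk by (auto simp: lookup_add lookup_single other_degree_add other_degree_single)
qed

definition monomials_in :: "('v \<Rightarrow>\<^sub>0 nat) set \<Rightarrow> ('v, 'a::comm_ring_1) mpoly \<Rightarrow> bool" where
  "monomials_in M p \<longleftrightarrow> keys p \<subseteq> M"

lemma monomials_in_add: "monomials_in M p \<Longrightarrow> monomials_in M q \<Longrightarrow> monomials_in M (p + q)"
  using keys_add[of p q] unfolding monomials_in_def by blast

lemma monomials_in_sum: "(\<And>i. i \<in> I \<Longrightarrow> monomials_in M (f i)) \<Longrightarrow> monomials_in M (sum f I)"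
proof (induction I rule: infinite_finite_induct)
  case (insert i I) then show ?case by (simp add: monomials_in_add)
qed (simp_all add: monomials_in_def)

lemma Const_eq_0_iff: "Const c = 0 \<longleftrightarrow> c = 0"
  unfolding Const_def by (metis lookup_single_eq lookup_zero single_zero)

lemma monomials_in_mult:
  assumes "\<And>k l. k \<in> K \<Longrightarrow> l \<in> L \<Longrightarrow> k + l \<in> M" "monomials_in K p" "monomials_in L q"
  shows "monomials_in M (p * q)"
  using keys_mult[of p q] assms unfolding monomials_in_def by blast

lemma monomials_in_bihomogeneous:
  "bihomogeneous v a b p \<Longrightarrow> (\<And>k. lookup k v = a \<Longrightarrow> other_degree v k = b \<Longrightarrow> k \<in> M) \<Longrightarrow> monomials_in M p"
  unfolding monomials_in_def bihomogeneous_def by blast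

text \<open>If \<open>u s \<noteq> 0\<close> and all minors vanish, then \<open>v s\<close> and \<open>- u s\<close> are the coefficients of a linear
  relation between \<open>u\<close> and \<open>v\<close>.\<close>

lemma nonzero_minor:
  fixes u v :: "'b \<Rightarrow> 'k::field"
  assumes "\<And>a b. (\<And>t. t \<in> T \<Longrightarrow> a * u t + b * v t = 0) \<Longrightarrow> a = 0 \<and> b = 0"
  shows "\<exists>s\<in>T. \<exists>t\<in>T. u s * v t - u t * v s \<noteq> 0"
proof (rule ccontr)
  assume "\<not> ?thesis"
  then have m: "u s * v t = u t * v s" if "s \<in> T" "t \<in> T" for s t using that by auto
  have "\<exists>s\<in>T. u s \<noteq> 0" using assms[of 1 0] by auto
  then obtain s where s: "s \<in> T" "u s \<noteq> 0" by blast
  have "v s = 0 \<and> - u s = 0" using m[OF s(1)] by (intro assms) (auto simp: mult_ac)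
  then show False using s(2) by simp
qed

context cone_family begin

lemma y_nonzero: "y \<noteq> 0" by (rule Var_nonzero)

lemma h_bihom: "bihomogeneous n 0 (d - m) h"
  unfolding bihomogeneous_def
proof
  fix k assume k: "k \<in> keys h"
  then have "keys k \<subseteq> {1..n-2}" using hS by (auto simp: mpolyn_def mpolys_def dest!: in_keys_iff[THEN iffD1, of k h])
  then have "n \<notin> keys k" using n3 by auto
  then have "lookup k n = 0" "keys k - {n} = keys k" by (auto simp: in_keys_iff)
  then show "lookup k n = 0 \<and> other_degree n k = d - m"
    using h_hom k unfolding homogeneous_def other_degree_def by auto
qed

lemma ymh_bihom: "bihomogeneous n 0 d (y ^ m * h)"
  using bihomogeneous_mult[OF bihomogeneous_Var_power(2) h_bihom, of "n - 1" m] n3 md by simp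

lemma pd_g_ymh: "i \<noteq> n \<Longrightarrow> partial_deriv i g = - partial_deriv i (y ^ m * h)"
  unfolding g_def by (simp add: pd_diff pd_power pd_Var)

lemma pd_g_bihom: "i \<noteq> n \<Longrightarrow> bihomogeneous n 0 (d - 1) (partial_deriv i g)"
  unfolding pd_g_ymh by (intro bihomogeneous_uminus bihomogeneous_pd ymh_bihom)

text \<open>If \<open>\<theta>(g) = r g\<close>, then \<open>d z\<^bsup>d-1\<^esup> \<theta>(z) = r g - \<Sum>\<^bsub>i<n\<^esub> \<theta>(x\<^sub>i) \<partial>\<^sub>i g\<close>. Every term on the right lies in the
  ideal generated by \<open>z\<^sup>d\<close> and the monomials of degree \<open>d - 1\<close> in the other variables, and dividing by
  \<open>z\<^bsup>d-1\<^esup>\<close> lowers only the exponent of \<open>z\<close>.\<close>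

lemma log_derivation_z:
  assumes \<theta>: "\<theta> \<in> derivations n" and r: "r \<in> mpolyn n" "\<theta> g = r * g"
  shows "monomials_in {k. 1 \<le> lookup k n \<or> d - 1 \<le> other_degree n k} (\<theta> z)"
proof -
  let ?M = "{k. d \<le> lookup k n \<or> d - 1 \<le> other_degree n k}"
  have up: "monomials_in ?M (p * q)" if "monomials_in ?M q" for p q :: "(nat, 'k) mpoly"
    by (rule monomials_in_mult[of UNIV ?M]) (use that in \<open>auto simp: lookup_add other_degree_add monomials_in_def\<close>)
  have "{1..n} = insert n {1..n-1}" using n3 by auto
  then have "r * g = \<theta> z * partial_deriv n g + (\<Sum>i\<in>{1..n-1}. \<theta> (Var i) * partial_deriv i g)"
    using derivation_chain_rule[OF \<theta> gR] r(2) n3 by simp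
  then have "Const (of_nat d) * (z ^ (d - 1) * \<theta> z) = r * g - (\<Sum>i\<in>{1..n-1}. \<theta> (Var i) * partial_deriv i g)"
    by (simp add: pd_g(1) of_nat_mpoly mult_ac)
  then have "Const (inverse (of_nat d)) * (Const (of_nat d) * (z ^ (d - 1) * \<theta> z)) =
     Const (inverse (of_nat d)) * (r * g + (\<Sum>i\<in>{1..n-1}. - \<theta> (Var i) * partial_deriv i g))"
    by (simp add: sum_negf)
  then have eq: "z ^ (d - 1) * \<theta> z = Const (inverse (of_nat d)) * (r * g + (\<Sum>i\<in>{1..n-1}. - \<theta> (Var i) * partial_deriv i g))"
    using md by (simp only: Const_inverse of_nat_eq_0_iff)
  have "monomials_in ?M (z ^ d)" by (rule monomials_in_bihomogeneous[OF bihomogeneous_Var_power(1)]) auto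
  moreover have "monomials_in ?M (- (y ^ m * h))"
    by (rule monomials_in_bihomogeneous[OF bihomogeneous_uminus[OF ymh_bihom]]) auto
  ultimately have "monomials_in ?M g"
    unfolding g_def using monomials_in_add[of ?M "z ^ d" "- (y ^ m * h)"] by simp
  moreover have "monomials_in ?M (partial_deriv i g)" if "i \<in> {1..n-1}" for i
    using that n3 by (intro monomials_in_bihomogeneous[OF pd_g_bihom]) auto
  ultimately have M: "monomials_in ?M (z ^ (d - 1) * \<theta> z)"
    unfolding eq by (intro up monomials_in_add monomials_in_sum)
  show ?thesis unfolding monomials_in_def
  proof
    fix k assume "k \<in> keys (\<theta> z)"
    then have "single n (d - 1) + k \<in> keys (z ^ (d - 1) * \<theta> z)"
      by (simp add: in_keys_iff Var_power lookup_single_times)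
    then have "single n (d - 1) + k \<in> ?M" using M unfolding monomials_in_def by blast
    then show "k \<in> {k. 1 \<le> lookup k n \<or> d - 1 \<le> other_degree n k}"
      using md by (auto simp: lookup_add other_degree_add other_degree_single)
  qed
qed

text \<open>The relation between three Koszul derivations has coefficients without constant term, two of
  which are not divisible by \<open>z\<close>. In a free module this is incompatible with two of the derivations
  being part of a minimal system of generators at the origin.\<close>

lemma no_log_derivation_basis:
  assumes B: "B \<subseteq> carrier (log_derivations n g)" "spans_log_derivations n g B" "indep_derivations n B"
  shows False
proof -
  note s = is_subringD[OF is_subring_mpolyn]
  obtain i where i: "1 \<le> i" "i \<le> n - 2" and pdh: "partial_deriv i h \<noteq> 0" using exists_pd_h_nonzero by auto
  have ij: "i \<noteq> n - 1" "i \<noteq> n" "n - 1 \<noteq> n" "i \<in> {1..n}" "n - 1 \<in> {1..n}" "n \<in> {1..n}" using i n3 by auto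
  define a0 where "a0 = partial_deriv n g"
  define b1 where "b1 = partial_deriv (n - 1) g"
  define b2 where "b2 = partial_deriv i g"
  have ab: "a0 \<in> mpolyn n" "b1 \<in> mpolyn n" "b2 \<in> mpolyn n"
    unfolding a0_def b1_def b2_def by (intro pd_closed_mpolyn gR)+
  \<comment> \<open>The Koszul derivations \<open>g\<^sub>y \<partial>\<^sub>z - g\<^sub>z \<partial>\<^sub>y\<close>, \<open>g\<^sub>i \<partial>\<^sub>z - g\<^sub>z \<partial>\<^sub>i\<close> and \<open>g\<^sub>i \<partial>\<^sub>y - g\<^sub>y \<partial>\<^sub>i\<close>.\<close>
  define K1 where "K1 = (\<lambda>j. if j = n then b1 else if j = n - 1 then - a0 else 0)"
  define K2 where "K2 = (\<lambda>j. if j = n then b2 else if j = i then - a0 else 0)"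
  define K3 where "K3 = (\<lambda>j. if j = n - 1 then b2 else if j = i then - b1 else 0)"
  have two: "(\<Sum>j\<in>{1..n}. (if j = p then u else if j = q then v else 0) * partial_deriv j g) =
      u * partial_deriv p g + v * partial_deriv q g" if "p \<in> {1..n}" "q \<in> {1..n}" "p \<noteq> q" for p q u v
  proof -
    have "(\<Sum>j\<in>{1..n}. (if j = p then u else if j = q then v else 0) * partial_deriv j g) =
       (\<Sum>j\<in>{p, q}. (if j = p then u else if j = q then v else 0) * partial_deriv j g)"
      using that by (intro sum.mono_neutral_right) auto
    then show ?thesis using that by simp
  qed
  have Kg: "vfield n K1 g = 0" "vfield n K2 g = 0" "vfield n K3 g = 0"
    unfolding vfield_apply[OF gR] K1_def K2_def K3_def
    by (subst two; use ij in \<open>simp add: a0_def b1_def b2_def mult.commute\<close>)+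
  have Kd: "vfield n K1 \<in> derivations n" "vfield n K2 \<in> derivations n" "vfield n K3 \<in> derivations n"
    unfolding K1_def K2_def K3_def by (intro vfield_in_derivations; use ab in \<open>auto intro!: s\<close>)+
  have KD: "\<theta> \<in> carrier (log_derivations n g)" if "\<theta> \<in> derivations n" "\<theta> g = 0" for \<theta>
    using that s(2) by (auto simp: log_derivations_simps intro!: bexI[of _ 0])
  have span: "\<exists>T c. finite T \<and> T \<subseteq> B \<and> (\<forall>b\<in>T. c b \<in> mpolyn n) \<and>
     (\<forall>j\<in>{1..n}. \<theta> (Var j) = (\<Sum>b\<in>T. c b * b (Var j)))" if "\<theta> \<in> derivations n" "\<theta> g = 0" for \<theta>
    using B(2) KD[OF that] unfolding spans_log_derivations_def by blast
  obtain T1 c1 where T1: "finite T1" "T1 \<subseteq> B" "\<forall>b\<in>T1. c1 b \<in> mpolyn n"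
    "\<forall>j\<in>{1..n}. vfield n K1 (Var j) = (\<Sum>b\<in>T1. c1 b * b (Var j))" using span[OF Kd(1) Kg(1)] by auto
  obtain T2 c2 where T2: "finite T2" "T2 \<subseteq> B" "\<forall>b\<in>T2. c2 b \<in> mpolyn n"
    "\<forall>j\<in>{1..n}. vfield n K2 (Var j) = (\<Sum>b\<in>T2. c2 b * b (Var j))" using span[OF Kd(2) Kg(2)] by auto
  obtain T3 c3 where T3: "finite T3" "T3 \<subseteq> B" "\<forall>b\<in>T3. c3 b \<in> mpolyn n"
    "\<forall>j\<in>{1..n}. vfield n K3 (Var j) = (\<Sum>b\<in>T3. c3 b * b (Var j))" using span[OF Kd(3) Kg(3)] by auto
  define T where "T = T1 \<union> T2 \<union> T3"
  define k1 where "k1 = (\<lambda>b. if b \<in> T1 then c1 b else 0)"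
  define k2 where "k2 = (\<lambda>b. if b \<in> T2 then c2 b else 0)"
  define k3 where "k3 = (\<lambda>b. if b \<in> T3 then c3 b else 0)"
  have T: "finite T" "T \<subseteq> B" using T1 T2 T3 by (auto simp: T_def)
  have ext: "(\<Sum>b\<in>S. c b * w b) = (\<Sum>b\<in>T. (if b \<in> S then c b else 0) * w b)"
    if "S \<subseteq> T" for S and c w :: "((nat, 'k) mpoly \<Rightarrow> (nat, 'k) mpoly) \<Rightarrow> (nat, 'k) mpoly"
  proof -
    have "(\<Sum>b\<in>S. c b * w b) = (\<Sum>b\<in>S. (if b \<in> S then c b else 0) * w b)" by (intro sum.cong) auto
    also have "\<dots> = (\<Sum>b\<in>T. (if b \<in> S then c b else 0) * w b)"
      using that T(1) by (intro sum.mono_neutral_left) auto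
    finally show ?thesis .
  qed
  have k: "k1 b \<in> mpolyn n" "k2 b \<in> mpolyn n" "k3 b \<in> mpolyn n" if "b \<in> T" for b
    using T1 T2 T3 s(2) by (auto simp: k1_def k2_def k3_def)
  have K: "K1 j = (\<Sum>b\<in>T. k1 b * b (Var j))" "K2 j = (\<Sum>b\<in>T. k2 b * b (Var j))"
    "K3 j = (\<Sum>b\<in>T. k3 b * b (Var j))" if "j \<in> {1..n}" for j
  proof -
    have "T1 \<subseteq> T" "T2 \<subseteq> T" "T3 \<subseteq> T" by (auto simp: T_def)
    note e = ext[OF this(1)] ext[OF this(2)] ext[OF this(3)]
    show "K1 j = (\<Sum>b\<in>T. k1 b * b (Var j))"
      using T1(4)[rule_format, OF that] unfolding vfield_Var[OF that] e(1) k1_def .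
    show "K2 j = (\<Sum>b\<in>T. k2 b * b (Var j))"
      using T2(4)[rule_format, OF that] unfolding vfield_Var[OF that] e(2) k2_def .
    show "K3 j = (\<Sum>b\<in>T. k3 b * b (Var j))"
      using T3(4)[rule_format, OF that] unfolding vfield_Var[OF that] e(3) k3_def .
  qed
  have "\<forall>j\<in>{1..n}. (\<Sum>b\<in>T. (b2 * k1 b - b1 * k2 b + a0 * k3 b) * b (Var j)) = 0"
  proof
    fix j assume j: "j \<in> {1..n}"
    have "(\<Sum>b\<in>T. (b2 * k1 b - b1 * k2 b + a0 * k3 b) * b (Var j)) =
       b2 * (\<Sum>b\<in>T. k1 b * b (Var j)) - b1 * (\<Sum>b\<in>T. k2 b * b (Var j)) + a0 * (\<Sum>b\<in>T. k3 b * b (Var j))"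
      by (simp add: algebra_simps sum.distrib sum_subtractf sum_distrib_left)
    also have "\<dots> = b2 * K1 j - b1 * K2 j + a0 * K3 j" by (simp only: K[OF j])
    also have "\<dots> = 0" using ij by (auto simp: K1_def K2_def K3_def)
    finally show "(\<Sum>b\<in>T. (b2 * k1 b - b1 * k2 b + a0 * k3 b) * b (Var j)) = 0" .
  qed
  moreover have "\<forall>b\<in>T. b2 * k1 b - b1 * k2 b + a0 * k3 b \<in> mpolyn n" using k ab by (auto intro!: s)
  ultimately have rel: "b2 * k1 b - b1 * k2 b + a0 * k3 b = 0" if "b \<in> T" for b
    using B(3)[unfolded indep_derivations_def, rule_format, of T "\<lambda>b. b2 * k1 b - b1 * k2 b + a0 * k3 b"] T that by blast
  \<comment> \<open>If the constant terms of the coordinates were linearly dependent, the \<open>z\<close>-component of the same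
    combination of the first two derivations, a form of degree \<open>d - 1\<close> without \<open>z\<close>, would lie in the
    ideal generated by \<open>z\<close> and the monomials of degree \<open>d\<close>.\<close>
  let ?M = "{k. 1 \<le> lookup k n \<or> d - 1 \<le> other_degree n k}"
  let ?M' = "{k. 1 \<le> lookup k n \<or> d \<le> other_degree n k}"
  note ct = is_homD[OF is_hom_constant_term]
  have lin: "l1 = 0 \<and> l2 = 0"
    if l: "\<And>b. b \<in> T \<Longrightarrow> l1 * lookup (k1 b) 0 + l2 * lookup (k2 b) 0 = 0" for l1 l2 :: 'k
  proof -
    have "Const l1 * b1 + Const l2 * b2 = Const l1 * K1 n + Const l2 * K2 n"
      using ij by (simp add: K1_def K2_def)
    also have "\<dots> = (\<Sum>b\<in>T. (Const l1 * k1 b + Const l2 * k2 b) * b z)"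
      unfolding K[OF ij(6)] by (simp add: sum_distrib_left sum.distrib algebra_simps)
    finally have eq: "Const l1 * b1 + Const l2 * b2 = (\<Sum>b\<in>T. (Const l1 * k1 b + Const l2 * k2 b) * b z)" .
    have "monomials_in ?M' ((Const l1 * k1 b + Const l2 * k2 b) * b z)" if "b \<in> T" for b
    proof (rule monomials_in_mult[of "{k. k \<noteq> 0}" ?M])
      have "lookup (Const l1 * k1 b + Const l2 * k2 b) 0 = 0"
        using l[OF that] by (simp add: ct Const_def)
      then show "monomials_in {k. k \<noteq> 0} (Const l1 * k1 b + Const l2 * k2 b)"
        unfolding monomials_in_def by (auto simp: in_keys_iff)
      have "b \<in> carrier (log_derivations n g)" using that T B(1) by auto
      then show "monomials_in ?M (b z)" by (auto simp: log_derivations_simps simp del: One_nat_def intro: log_derivation_z)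
      fix k l :: "nat \<Rightarrow>\<^sub>0 nat" assume kl: "k \<in> {k. k \<noteq> 0}" "l \<in> ?M"
      then obtain v where v: "v \<in> keys k" by (auto simp: poly_mapping_eq_iff fun_eq_iff in_keys_iff)
      have "1 \<le> lookup k n \<or> 1 \<le> other_degree n k"
      proof (cases "v = n")
        case False
        have "lookup k v \<le> other_degree n k" unfolding other_degree_def
          using v False by (intro member_le_sum) auto
        then show ?thesis using v by (auto simp: in_keys_iff)
      qed (use v in \<open>auto simp: in_keys_iff\<close>)
      then show "k + l \<in> ?M'" using kl(2) md by (auto simp: lookup_add other_degree_add)
    qed
    then have 1: "monomials_in ?M' (Const l1 * b1 + Const l2 * b2)" unfolding eq by (rule monomials_in_sum)
    have "bihomogeneous n 0 (d - 1) (Const l1 * b1 + Const l2 * b2)"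
      using bihomogeneous_mult[OF bihomogeneous_Const pd_g_bihom[OF ij(3)], of l1]
        bihomogeneous_mult[OF bihomogeneous_Const pd_g_bihom[OF ij(2)], of l2]
      unfolding b1_def b2_def by (simp add: bihomogeneous_add)
    then have "keys (Const l1 * b1 + Const l2 * b2) = {}"
      using 1 md unfolding bihomogeneous_def monomials_in_def by fastforce
    then have 0: "Const l1 * b1 + Const l2 * b2 = 0"
      by (intro poly_mapping_eqI) (metis empty_iff in_keys_iff lookup_zero)
    have ym: "y ^ m = y * y ^ (m - 1)" using m1 by (cases m) auto
    have "y ^ (m - 1) * (Const l1 * (of_nat m * h) + Const l2 * (y * partial_deriv i h)) = - (Const l1 * b1 + Const l2 * b2)"
      unfolding b1_def b2_def pd_g(2) pd_g(3)[OF i(2)] ym by (simp add: algebra_simps)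
    then have 2: "Const l1 * (of_nat m * h) + Const l2 * (y * partial_deriv i h) = 0" using 0 y_nonzero by simp
    then have "coeff (univ_in (n - 1) (Const l1 * (of_nat m * h) + Const l2 * (y * partial_deriv i h))) 0 = 0"
      by (simp add: is_homD[OF is_hom_univ])
    then have "Const l1 * (of_nat m * h) = 0"
      by (simp add: is_homD[OF univ_coeff_0_hom] univ_z[unfolded One_nat_def] univ_Const)
    then have "l1 = 0" using h_nonzero m1 of_nat_mpoly_neq_0[of m, where ?'k = 'k] by (simp add: Const_mult_eq_0_iff Const_eq_0_iff)
    moreover have "l2 = 0" using 2 pdh y_nonzero unfolding \<open>l1 = 0\<close>
      by (simp add: is_homD[OF is_hom_Const] Const_mult_eq_0_iff Const_eq_0_iff)
    ultimately show ?thesis by simp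
  qed
  have "\<exists>s\<in>T. \<exists>t\<in>T. lookup (k1 s) 0 * lookup (k2 t) 0 - lookup (k1 t) 0 * lookup (k2 s) 0 \<noteq> 0"
    by (rule nonzero_minor) (rule lin)
  then obtain b b' where b: "b \<in> T" "b' \<in> T"
    and minor: "lookup (k1 b * k2 b' - k1 b' * k2 b) 0 \<noteq> 0" by (auto simp: ct)
  \<comment> \<open>\<open>\<partial>\<^sub>i g\<close> times the minor is a multiple of \<open>\<partial>g/\<partial>z = d z\<^bsup>d-1\<^esup>\<close>, but \<open>z\<close> does not divide \<open>\<partial>\<^sub>i g\<close>.\<close>
  define \<Delta> where "\<Delta> = k1 b * k2 b' - k1 b' * k2 b"
  have r: "b2 * k1 c = b1 * k2 c - a0 * k3 c" if "c \<in> T" for c using rel[OF that] by (simp add: algebra_simps)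
  have "b2 * \<Delta> = (b2 * k1 b) * k2 b' - (b2 * k1 b') * k2 b" by (simp add: \<Delta>_def algebra_simps)
  also have "\<dots> = a0 * (k3 b' * k2 b - k3 b * k2 b')" unfolding r[OF b(1)] r[OF b(2)] by (simp add: algebra_simps)
  finally have eq: "b2 * \<Delta> = a0 * (k3 b' * k2 b - k3 b * k2 b')" .
  have a00: "coeff (univ_in n a0) 0 = 0"
    unfolding a0_def pd_g(1) using md m1 by (simp add: is_homD[OF univ_coeff_0_hom] univ_z)
  have "b2 \<in> mpolyn (n - 1)"
    unfolding b2_def pd_g(3)[OF i(2)] by (intro s yR1 pd_closed_mpolyn hR1)
  then have "univ_in n b2 = [:b2:]" using n3 by (intro univ_in_free_mpolyn) auto
  moreover have "b2 \<noteq> 0" unfolding b2_def pd_g(3)[OF i(2)] using pdh y_nonzero by simp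
  moreover have "coeff (univ_in n (b2 * \<Delta>)) 0 = 0" unfolding eq is_homD(4)[OF univ_coeff_0_hom] a00 by simp
  ultimately have "coeff (univ_in n \<Delta>) 0 = 0" by (simp add: is_homD[OF univ_coeff_0_hom])
  moreover have "\<Delta> \<in> mpolyn n" unfolding \<Delta>_def by (intro s k b)
  ultimately obtain \<Delta>' where "\<Delta> = z * \<Delta>'"
    using Var_dvdI[of \<Delta> "{1..n}" n] ij(6) unfolding mpolyn_def by auto
  then have "lookup \<Delta> 0 = lookup z 0 * lookup \<Delta>' 0" by (simp only: ct)
  moreover have "lookup z 0 = 0" by (simp add: Var_def lookup_single when_def poly_mapping_eq_iff fun_eq_iff)
  ultimately show False using minor unfolding \<Delta>_def by simp
qed

lemma nonfree_g: "nonfree_divisor n g"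
  unfolding nonfree_divisor_def free_module_def module_basis_iff[OF gR]
  using squarefree_g no_log_derivation_basis by blast

end

section \<open>Adjoining a variable to a free module of vectors\<close>

lemma poly_eq_sum_upto:
  assumes "degree p \<le> J" shows "poly p x = (\<Sum>j\<le>J. coeff p j * (x :: 'a::comm_ring_1) ^ j)"
  unfolding poly_altdef using assms by (intro sum.mono_neutral_left) (auto simp: coeff_eq_0)

text \<open>The first \<open>N\<close> components of a logarithmic derivation of \<open>h \<in> K[x\<^sub>1, \<dots>, x\<^sub>N]\<close>, with coefficients in
  the larger ring \<open>K[x\<^sub>1, \<dots>, x\<^sub>k]\<close>. Spanning and independence pass from \<open>k = N\<close> to every \<open>k \<ge> N\<close>, because
  the condition on \<open>a\<close> holds separately for the coefficients of each power of a new variable.\<close>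

definition spans_vectors :: "nat \<Rightarrow> (nat, 'k::field) mpoly \<Rightarrow> 'b set \<Rightarrow> ('b \<Rightarrow> nat \<Rightarrow> (nat, 'k) mpoly) \<Rightarrow> nat \<Rightarrow> bool" where
  "spans_vectors N h B b k \<longleftrightarrow> (\<forall>a c. (\<forall>i\<in>{1..N}. a i \<in> mpolyn k) \<longrightarrow> c \<in> mpolyn k \<longrightarrow>
     (\<Sum>i\<in>{1..N}. a i * partial_deriv i h) = c * h \<longrightarrow>
     (\<exists>T \<gamma>. finite T \<and> T \<subseteq> B \<and> (\<forall>\<beta>\<in>T. \<gamma> \<beta> \<in> mpolyn k) \<and> (\<forall>i\<in>{1..N}. a i = (\<Sum>\<beta>\<in>T. \<gamma> \<beta> * b \<beta> i))))"

definition indep_vectors :: "nat \<Rightarrow> 'b set \<Rightarrow> ('b \<Rightarrow> nat \<Rightarrow> (nat, 'k::field) mpoly) \<Rightarrow> nat \<Rightarrow> bool" where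
  "indep_vectors N B b k \<longleftrightarrow> (\<forall>T \<gamma>. finite T \<longrightarrow> T \<subseteq> B \<longrightarrow> (\<forall>\<beta>\<in>T. \<gamma> \<beta> \<in> mpolyn k) \<longrightarrow>
     (\<forall>i\<in>{1..N}. (\<Sum>\<beta>\<in>T. \<gamma> \<beta> * b \<beta> i) = 0) \<longrightarrow> (\<forall>\<beta>\<in>T. \<gamma> \<beta> = 0))"

lemma indep_vectors_Suc:
  fixes b :: "'b \<Rightarrow> nat \<Rightarrow> (nat, 'k::field) mpoly"
  assumes ind: "indep_vectors N B b k" and "N \<le> k" and b: "\<And>\<beta> i. \<beta> \<in> B \<Longrightarrow> i \<in> {1..N} \<Longrightarrow> b \<beta> i \<in> mpolyn N"
  shows "indep_vectors N B b (Suc k)"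
  unfolding indep_vectors_def
proof (intro allI impI ballI)
  fix T \<gamma> \<beta>
  assume T: "finite T" "T \<subseteq> B" "\<forall>\<beta>\<in>T. \<gamma> \<beta> \<in> mpolyn (Suc k)" and z: "\<forall>i\<in>{1..N}. (\<Sum>\<beta>\<in>T. \<gamma> \<beta> * b \<beta> i) = 0"
    and \<beta>: "\<beta> \<in> T"
  have "coeff (univ_in (Suc k) (\<gamma> \<beta>)) j = 0" for j
  proof -
    let ?g = "\<lambda>\<beta>. coeff (univ_in (Suc k) (\<gamma> \<beta>)) j"
    have "(\<Sum>\<beta>\<in>T. ?g \<beta> * b \<beta> i) = 0" if i: "i \<in> {1..N}" for i
    proof -
      have "univ_in (Suc k) (\<gamma> \<beta> * b \<beta> i) = univ_in (Suc k) (\<gamma> \<beta>) * [:b \<beta> i:]" if "\<beta> \<in> T" for \<beta>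
        using univ_in_free_mpolyn[OF b[of \<beta> i], of "Suc k"] that T(2) i \<open>N \<le> k\<close>
        by (auto simp: is_homD[OF is_hom_univ])
      then have "coeff (univ_in (Suc k) (\<Sum>\<beta>\<in>T. \<gamma> \<beta> * b \<beta> i)) j = (\<Sum>\<beta>\<in>T. ?g \<beta> * b \<beta> i)"
        by (simp add: is_hom_sum[OF is_hom_univ] coeff_sum mult.commute)
      then show ?thesis using z i by (simp add: is_homD[OF is_hom_univ])
    qed
    moreover have "\<forall>\<beta>\<in>T. ?g \<beta> \<in> mpolyn k" using T(3) univ_coeff_closed[of _ "Suc k"] by auto
    ultimately show ?thesis using ind[unfolded indep_vectors_def, rule_format, of T ?g] T \<beta> by blast
  qed
  then have "univ_in (Suc k) (\<gamma> \<beta>) = 0" by (intro poly_eqI) simp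
  then show "\<gamma> \<beta> = 0" using poly_univ[of "Suc k" "\<gamma> \<beta>"] by simp
qed

lemma spans_vectors_Suc:
  fixes b :: "'b \<Rightarrow> nat \<Rightarrow> (nat, 'k::field) mpoly"
  assumes sp: "spans_vectors N h B b k" and "N \<le> k" and h: "h \<in> mpolyn N"
  shows "spans_vectors N h B b (Suc k)"
  unfolding spans_vectors_def
proof (intro allI impI)
  fix a c assume a: "\<forall>i\<in>{1..N}. a i \<in> mpolyn (Suc k)" and c: "c \<in> mpolyn (Suc k)"
    and eq: "(\<Sum>i\<in>{1..N}. a i * partial_deriv i h) = c * h"
  let ?x = "Var (Suc k) :: (nat, 'k) mpoly"
  have "\<exists>T \<gamma>. finite T \<and> T \<subseteq> B \<and> (\<forall>\<beta>\<in>T. \<gamma> \<beta> \<in> mpolyn k) \<and>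
     (\<forall>i\<in>{1..N}. coeff (univ_in (Suc k) (a i)) j = (\<Sum>\<beta>\<in>T. \<gamma> \<beta> * b \<beta> i))" for j
  proof (rule sp[unfolded spans_vectors_def, rule_format])
    show "coeff (univ_in (Suc k) (a i)) j \<in> mpolyn k" if "i \<in> {1..N}" for i
      using univ_coeff_closed[of "a i" "Suc k"] a that by simp
    show "coeff (univ_in (Suc k) c) j \<in> mpolyn k" using univ_coeff_closed[of c "Suc k"] c by simp
    have f: "univ_in (Suc k) p = [:p:]" if "p \<in> mpolyn N" for p :: "(nat, 'k) mpoly"
      using univ_in_free_mpolyn[OF that, of "Suc k"] \<open>N \<le> k\<close> by simp
    have "coeff (univ_in (Suc k) (\<Sum>i\<in>{1..N}. a i * partial_deriv i h)) j = coeff (univ_in (Suc k) (c * h)) j"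
      by (simp only: eq)
    then show "(\<Sum>i\<in>{1..N}. coeff (univ_in (Suc k) (a i)) j * partial_deriv i h) = coeff (univ_in (Suc k) c) j * h"
      by (simp add: is_hom_sum[OF is_hom_univ] is_homD[OF is_hom_univ] f[OF h] f[OF pd_closed_mpolyn[OF h]] coeff_sum mult.commute)
  qed
  then have "\<forall>j. \<exists>T \<gamma>. finite T \<and> T \<subseteq> B \<and> (\<forall>\<beta>\<in>T. \<gamma> \<beta> \<in> mpolyn k) \<and>
     (\<forall>i\<in>{1..N}. coeff (univ_in (Suc k) (a i)) j = (\<Sum>\<beta>\<in>T. \<gamma> \<beta> * b \<beta> i))" by (rule allI)
  from choice[OF this] obtain T where "\<forall>j. \<exists>\<gamma>. finite (T j) \<and> T j \<subseteq> B \<and> (\<forall>\<beta>\<in>T j. \<gamma> \<beta> \<in> mpolyn k) \<and>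
     (\<forall>i\<in>{1..N}. coeff (univ_in (Suc k) (a i)) j = (\<Sum>\<beta>\<in>T j. \<gamma> \<beta> * b \<beta> i))" by (rule exE)
  from choice[OF this] obtain \<gamma> where "\<forall>j. finite (T j) \<and> T j \<subseteq> B \<and> (\<forall>\<beta>\<in>T j. \<gamma> j \<beta> \<in> mpolyn k) \<and>
     (\<forall>i\<in>{1..N}. coeff (univ_in (Suc k) (a i)) j = (\<Sum>\<beta>\<in>T j. \<gamma> j \<beta> * b \<beta> i))" by (rule exE)
  then have T: "\<And>j. finite (T j)" "\<And>j. T j \<subseteq> B" "\<And>j \<beta>. \<beta> \<in> T j \<Longrightarrow> \<gamma> j \<beta> \<in> mpolyn k"
    "\<And>i j. i \<in> {1..N} \<Longrightarrow> coeff (univ_in (Suc k) (a i)) j = (\<Sum>\<beta>\<in>T j. \<gamma> j \<beta> * b \<beta> i)"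
    by blast+
  define J where "J = Max (insert 0 ((\<lambda>i. degree (univ_in (Suc k) (a i))) ` {1..N}))"
  define S where "S = (\<Union>j\<le>J. T j)"
  define \<delta> where "\<delta> = (\<lambda>\<beta>. \<Sum>j\<le>J. (if \<beta> \<in> T j then \<gamma> j \<beta> else 0) * ?x ^ j)"
  note s = is_subringD[OF is_subring_mpolyn]
  have up: "p \<in> mpolyn (Suc k)" if "p \<in> mpolyn k" for p :: "(nat, 'k) mpoly"
    using that mpolyn_mono[of k "Suc k"] by auto
  have "\<delta> \<beta> \<in> mpolyn (Suc k)" for \<beta>
    unfolding \<delta>_def by (intro is_subring_sum is_subring_mpolyn s) (auto intro: s up T Var_in_mpolyn)
  moreover have "a i = (\<Sum>\<beta>\<in>S. \<delta> \<beta> * b \<beta> i)" if i: "i \<in> {1..N}" for i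
  proof -
    have "degree (univ_in (Suc k) (a i)) \<le> J" unfolding J_def using i by (intro Max_ge) auto
    then have "a i = (\<Sum>j\<le>J. coeff (univ_in (Suc k) (a i)) j * ?x ^ j)"
      using poly_univ[of "Suc k" "a i"] poly_eq_sum_upto[of "univ_in (Suc k) (a i)" J ?x] by simp
    also have "\<dots> = (\<Sum>j\<le>J. (\<Sum>\<beta>\<in>S. (if \<beta> \<in> T j then \<gamma> j \<beta> else 0) * b \<beta> i) * ?x ^ j)"
    proof (intro sum.cong refl arg_cong2[where f = "(*)"])
      fix j assume "j \<in> {..J}"
      then have "T j \<subseteq> S" "finite S" using T(1) by (auto simp: S_def)
      then have "(\<Sum>\<beta>\<in>S. (if \<beta> \<in> T j then \<gamma> j \<beta> else 0) * b \<beta> i) = (\<Sum>\<beta>\<in>T j. (if \<beta> \<in> T j then \<gamma> j \<beta> else 0) * b \<beta> i)"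
        by (intro sum.mono_neutral_right) auto
      then show "coeff (univ_in (Suc k) (a i)) j = (\<Sum>\<beta>\<in>S. (if \<beta> \<in> T j then \<gamma> j \<beta> else 0) * b \<beta> i)"
        unfolding T(4)[OF i] by simp
    qed
    also have "\<dots> = (\<Sum>\<beta>\<in>S. \<delta> \<beta> * b \<beta> i)"
      unfolding \<delta>_def sum_distrib_right by (subst sum.swap) (simp add: mult_ac)
    finally show ?thesis .
  qed
  moreover have "finite S" "S \<subseteq> B" using T by (auto simp: S_def)
  ultimately show "\<exists>T \<gamma>. finite T \<and> T \<subseteq> B \<and> (\<forall>\<beta>\<in>T. \<gamma> \<beta> \<in> mpolyn (Suc k)) \<and> (\<forall>i\<in>{1..N}. a i = (\<Sum>\<beta>\<in>T. \<gamma> \<beta> * b \<beta> i))"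
    by (intro exI[of _ S] exI[of _ \<delta>]) auto
qed

lemma spans_vectors_mono:
  assumes "spans_vectors N h B b N" "h \<in> mpolyn N" "N \<le> k" shows "spans_vectors N h B b k"
  using assms(3) by (induction k rule: dec_induct) (auto intro: assms spans_vectors_Suc)

lemma indep_vectors_mono:
  assumes "indep_vectors N B b N" "\<And>\<beta> i. \<beta> \<in> B \<Longrightarrow> i \<in> {1..N} \<Longrightarrow> b \<beta> i \<in> mpolyn N" "N \<le> k"
  shows "indep_vectors N B b k"
  using assms(3) by (induction k rule: dec_induct) (auto intro: assms indep_vectors_Suc)

section \<open>The divisor \<open>g h\<close> is free\<close>

context cone_family begin

lemma sum_split_n: "(\<Sum>i\<in>{1..n}. F i) = (\<Sum>i\<in>{1..n-2}. F i) + F (n - 1) + F n" for F :: "nat \<Rightarrow> 'b::comm_monoid_add"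
proof -
  have "{1..n} = insert n (insert (n - 1) {1..n-2})" using n3 by auto
  moreover have "n \<notin> insert (n - 1) {1..n-2}" "n - 1 \<notin> {1..n-2}" using n3 by auto
  moreover have "sum F (insert a (insert b S)) = sum F S + F b + F a"
    if "finite S" "a \<notin> insert b S" "b \<notin> S" for a b S using that by (simp add: add_ac)
  ultimately show ?thesis using finite_atLeastAtMost by metis
qed

lemma derivation_h: "\<theta> \<in> derivations n \<Longrightarrow> \<theta> h = (\<Sum>i\<in>{1..n-2}. \<theta> (Var i) * partial_deriv i h)"
  using n3 by (simp only: derivation_chain_rule[OF _ hR] sum_split_n pd_h_zero) (simp add: pd_h_zero)

lemma derivation_g:
  assumes "\<theta> \<in> derivations n"
  shows "\<theta> g = of_nat d * z ^ (d - 1) * \<theta> z - of_nat m * y ^ (m - 1) * h * \<theta> y - y ^ m * \<theta> h"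
proof -
  have "(\<Sum>i\<in>{1..n-2}. \<theta> (Var i) * partial_deriv i g) = - (y ^ m * \<theta> h)"
    unfolding derivation_h[OF assms] sum_distrib_left sum_negf[symmetric] by (intro sum.cong) (auto simp: pd_g(3) mult_ac)
  then show ?thesis
    unfolding derivation_chain_rule[OF assms gR] sum_split_n pd_g(1,2) by (simp add: algebra_simps)
qed

lemma ghR: "g * h \<in> mpolyn n" by (intro is_subringD[OF is_subring_mpolyn] gR hR)

lemma derivation_gh: "\<theta> \<in> derivations n \<Longrightarrow> \<theta> (g * h) = \<theta> g * h + g * \<theta> h"
  using gR hR by (simp add: derivations_iff)

lemma zd: "z ^ d = z * z ^ (d - 1)" using md by (cases d) auto

lemma ym: "y ^ m = y * y ^ (m - 1)" using m1 by (cases m) auto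

lemma g_nonzero: "g \<noteq> 0"
  using univ_g_0 h_nonzero y_nonzero by (auto simp: is_homD[OF is_hom_univ])

text \<open>Modulo \<open>h\<close>, multiplication by \<open>g\<close> is multiplication by \<open>z\<^sup>d\<close>, and \<open>z\<close> does not divide \<open>h\<close>.\<close>

lemma h_dvd_if_dvd_g_mult:
  assumes "g * u = h * w" "u \<in> mpolyn n" "w \<in> mpolyn n"
  shows "\<exists>c\<in>mpolyn n. u = c * h"
proof -
  have "h * (w + y ^ m * u) = z ^ d * u" using assms(1) by (simp add: g_def algebra_simps)
  moreover have "w + y ^ m * u \<in> mpolyn n" by (intro is_subringD[OF is_subring_mpolyn] yR assms)
  ultimately show ?thesis
    using cancel_Var_power[of h "w + y ^ m * u" n d u n] n3 h_nonzero by (auto simp: univ_z mult.commute)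
qed

text \<open>From \<open>\<theta>(g h) \<in> \<langle>g h\<rangle>\<close> one gets \<open>h\<close> dividing \<open>g \<theta>(h)\<close>, so \<open>\<theta>(h) = c h\<close> and then \<open>\<theta>(g) = t g\<close>. The last
  equation equates a multiple of \<open>z\<^bsup>d-1\<^esup>\<close> with a multiple of \<open>y\<^bsup>m-1\<^esup> h\<close>, which \<open>z\<close> does not divide; the
  common cofactor is \<open>s\<close>.\<close>

lemma log_derivation_gh_components:
  assumes \<theta>: "\<theta> \<in> derivations n" and r: "r \<in> mpolyn n" "\<theta> (g * h) = r * (g * h)"
  shows "\<exists>c\<in>mpolyn n. \<exists>t\<in>mpolyn n. \<exists>s\<in>mpolyn n. \<theta> h = c * h \<and>
    of_nat m * \<theta> y = y * t + z ^ (d - 1) * s - y * c \<and> of_nat d * \<theta> z = z * t + y ^ (m - 1) * h * s"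
proof -
  note s = is_subringD[OF is_subring_mpolyn]
  have cl: "\<theta> p \<in> mpolyn n" if "p \<in> mpolyn n" for p using \<theta> that by (simp add: derivations_iff)
  have "g * \<theta> h = h * (r * g - \<theta> g)" using r(2) derivation_gh[OF \<theta>] by (simp add: algebra_simps)
  then obtain c where c: "c \<in> mpolyn n" "\<theta> h = c * h"
    using h_dvd_if_dvd_g_mult[of "\<theta> h" "r * g - \<theta> g"] cl[OF hR] cl[OF gR] r(1) gR by (auto intro: s)
  define t where "t = r - c"
  have t: "t \<in> mpolyn n" unfolding t_def by (intro s r c)
  have "\<theta> g * h = (t * g) * h" using r(2) derivation_gh[OF \<theta>] c(2) by (simp add: t_def algebra_simps)
  then have tg0: "\<theta> g = t * g" using h_nonzero by simp
  have tg: "of_nat d * z ^ (d - 1) * \<theta> z - of_nat m * y ^ (m - 1) * h * \<theta> y - y ^ m * (c * h) = t * (z ^ d - y ^ m * h)"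
    using derivation_g[OF \<theta>] unfolding tg0 c(2) unfolding g_def by (rule sym)
  define w where "w = of_nat m * \<theta> y + y * c - y * t"
  define v where "v = of_nat d * \<theta> z - z * t"
  have eq: "(y ^ (m - 1) * h) * w = z ^ (d - 1) * v"
    using tg unfolding zd ym w_def v_def by (simp add: algebra_simps)
  moreover have "w \<in> mpolyn n" unfolding w_def by (intro s cl yR c t)
  moreover have "coeff (univ_in n (y ^ (m - 1) * h)) 0 \<noteq> 0"
    using h_nonzero y_nonzero by (simp add: is_homD[OF univ_coeff_0_hom] univ_z[unfolded One_nat_def])
  ultimately obtain s where s': "s \<in> mpolyn n" "(y ^ (m - 1) * h) * s = v"
    using cancel_Var_power[of "y ^ (m - 1) * h" w n "d - 1" v n] n3 by auto
  have "(y ^ (m - 1) * h) * w = (y ^ (m - 1) * h) * (z ^ (d - 1) * s)"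
    unfolding eq s'(2)[symmetric] by (simp add: mult_ac)
  moreover have "y ^ (m - 1) * h \<noteq> 0" using h_nonzero y_nonzero by simp
  ultimately have "w = z ^ (d - 1) * s" using mult_left_cancel by blast
  then have "of_nat m * \<theta> y = y * t + z ^ (d - 1) * s - y * c" "of_nat d * \<theta> z = z * t + y ^ (m - 1) * h * s"
    using s'(2) unfolding w_def v_def by (auto simp: algebra_simps)
  then show ?thesis using c t s'(1) by blast
qed

text \<open>For each basis element \<open>\<delta>\<close> of the module for \<open>h\<close>, with \<open>\<delta>(h) = c h\<close>, the basis for \<open>g h\<close> contains
  \<open>\<delta> - (y c / m) \<partial>\<^sub>y\<close>, which kills \<open>g\<close>. It is completed by \<open>(y / m) \<partial>\<^sub>y + (z / d) \<partial>\<^sub>z\<close>, which fixes \<open>g\<close>, and by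
  \<open>(z\<^bsup>d-1\<^esup> / m) \<partial>\<^sub>y + (y\<^bsup>m-1\<^esup> h / d) \<partial>\<^sub>z\<close>, which kills \<open>g\<close>; both kill \<open>h\<close>. The coordinates of a logarithmic
  derivation with respect to the last two are the parameters \<open>t\<close> and \<open>s\<close> of
  \<open>log_derivation_gh_components\<close>.\<close>

lemma free_gh:
  assumes free: "free_divisor (n - 2) h"
  shows "free_divisor n (g * h)"
proof -
  note s = is_subringD[OF is_subring_mpolyn]
  obtain B where B: "B \<subseteq> carrier (log_derivations (n - 2) h)" "spans_log_derivations (n - 2) h B" "indep_derivations (n - 2) B"
    using free unfolding free_divisor_def free_module_def module_basis_iff[OF hS] by blast
  let ?v = "\<lambda>(b :: (nat, 'k) mpoly \<Rightarrow> (nat, 'k) mpoly) i. b (Var i)"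
  have Bd: "b \<in> derivations (n - 2)" if "b \<in> B" for b using B(1) that by (auto simp: log_derivations_simps)
  have Bv: "b (Var i) \<in> mpolyn (n - 2)" if "b \<in> B" "i \<in> {1..n-2}" for b i
    using derivation_Var_closed[OF Bd] that by auto
  have "\<exists>c. c \<in> mpolyn (n - 2) \<and> b h = c * h" if "b \<in> B" for b
    using B(1) that by (auto simp: log_derivations_simps)
  then obtain cof where cof: "\<And>b. b \<in> B \<Longrightarrow> cof b \<in> mpolyn (n - 2)" "\<And>b. b \<in> B \<Longrightarrow> b h = cof b * h" by metis
  have bh: "(\<Sum>i\<in>{1..n-2}. b (Var i) * partial_deriv i h) = cof b * h" if "b \<in> B" for b
    using cof(2)[OF that] derivation_chain_rule[OF Bd[OF that] hS] by simp
  have "spans_vectors (n - 2) h B ?v (n - 2)" unfolding spans_vectors_def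
  proof (intro allI impI)
    fix a c assume a: "\<forall>i\<in>{1..n-2}. a i \<in> mpolyn (n - 2)" and c: "c \<in> mpolyn (n - 2)"
      "(\<Sum>i\<in>{1..n-2}. a i * partial_deriv i h) = c * h"
    have "vfield (n - 2) a \<in> carrier (log_derivations (n - 2) h)"
      using a c by (auto simp: log_derivations_simps vfield_apply[OF hS] intro!: vfield_in_derivations)
    then obtain T \<gamma> where "finite T" "T \<subseteq> B" "\<forall>b\<in>T. \<gamma> b \<in> mpolyn (n - 2)"
      "\<forall>i\<in>{1..n-2}. vfield (n - 2) a (Var i) = (\<Sum>b\<in>T. \<gamma> b * b (Var i))"
      using B(2) unfolding spans_log_derivations_def by meson
    then show "\<exists>T \<gamma>. finite T \<and> T \<subseteq> B \<and> (\<forall>\<beta>\<in>T. \<gamma> \<beta> \<in> mpolyn (n - 2)) \<and> (\<forall>i\<in>{1..n-2}. a i = (\<Sum>\<beta>\<in>T. \<gamma> \<beta> * \<beta> (Var i)))"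
      by (intro exI[of _ T] exI[of _ \<gamma>]) (simp add: vfield_Var)
  qed
  then have span: "spans_vectors (n - 2) h B ?v n" by (rule spans_vectors_mono[OF _ hS]) simp
  have "indep_vectors (n - 2) B ?v (n - 2)"
    using B(3) unfolding indep_vectors_def indep_derivations_def .
  then have indep: "indep_vectors (n - 2) B ?v n" by (rule indep_vectors_mono[OF _ Bv]) auto
  have up: "p \<in> mpolyn n" if "p \<in> mpolyn (n - 2)" for p :: "(nat, 'k) mpoly"
    using that mpolyn_mono[of "n - 2" n] by auto
  define im where "im = (Const (inverse (of_nat m)) :: (nat, 'k) mpoly)"
  define id where "id = (Const (inverse (of_nat d)) :: (nat, 'k) mpoly)"
  have im: "im * (of_nat m * p) = p" and id: "id * (of_nat d * p) = p" for p :: "(nat, 'k) mpoly"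
    unfolding im_def id_def using m1 md by (simp_all only: of_nat_mpoly[of m] of_nat_mpoly[of d] Const_inverse of_nat_eq_0_iff)
  have im0: "im \<noteq> 0" "id \<noteq> 0" unfolding im_def id_def using m1 md by (auto simp: Const_eq_0_iff)
  have iR: "im \<in> mpolyn n" "id \<in> mpolyn n" unfolding im_def id_def by (intro Const_in_mpolyn)+
  define ext where "ext = (\<lambda>b. vfield n (\<lambda>i. if i \<le> n - 2 then b (Var i) else if i = n - 1 then - (im * (y * cof b)) else 0))"
  define tt where "tt = vfield n (\<lambda>i. if i = n - 1 then im * y else if i = n then id * z else 0)"
  define ss where "ss = vfield n (\<lambda>i. if i = n - 1 then im * z ^ (d - 1) else if i = n then id * (y ^ (m - 1) * h) else 0)"
  have n': "\<not> n \<le> n - 2" "\<not> n - 1 \<le> n - 2" "n \<noteq> n - 1" "n - 1 \<in> {1..n}" "n \<in> {1..n}" using n3 by auto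
  have low: "i \<noteq> n - 1" "i \<noteq> n" "i \<in> {1..n}" "i \<le> n - 2" if "i \<in> {1..n-2}" for i using that n3 by auto
  have ext_v: "i \<in> {1..n-2} \<Longrightarrow> ext b (Var i) = b (Var i)" "ext b y = - (im * (y * cof b))" "ext b z = 0" for i b
    unfolding ext_def using n' low[of i] by (auto simp: vfield_Var)
  have tt_v: "i \<in> {1..n-2} \<Longrightarrow> tt (Var i) = 0" "tt y = im * y" "tt z = id * z" for i
    unfolding tt_def using n' low[of i] by (auto simp: vfield_Var)
  have ss_v: "i \<in> {1..n-2} \<Longrightarrow> ss (Var i) = 0" "ss y = im * z ^ (d - 1)" "ss z = id * (y ^ (m - 1) * h)" for i
    unfolding ss_def using n' low[of i] by (auto simp: vfield_Var)
  have dext: "ext b \<in> derivations n" if "b \<in> B" for b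
    unfolding ext_def
  proof (rule vfield_in_derivations)
    fix i assume i: "i \<in> {1..n}"
    have "im * (y * cof b) \<in> mpolyn n" by (intro s iR yR up cof(1) that)
    moreover have "b (Var i) \<in> mpolyn n" if "i \<le> n - 2" using that i by (intro up Bv \<open>b \<in> B\<close>) auto
    ultimately show "(if i \<le> n - 2 then b (Var i) else if i = n - 1 then - (im * (y * cof b)) else 0) \<in> mpolyn n"
      by (auto intro: s(2,5))
  qed
  have cl: "im * y \<in> mpolyn n" "id * z \<in> mpolyn n" "im * z ^ (d - 1) \<in> mpolyn n" "id * (y ^ (m - 1) * h) \<in> mpolyn n"
    by (intro s iR yR zR hR)+
  have dtt: "tt \<in> derivations n"
    unfolding tt_def by (intro vfield_in_derivations) (simp add: cl[unfolded One_nat_def] s(2))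
  have dss: "ss \<in> derivations n"
    unfolding ss_def by (intro vfield_in_derivations) (simp add: cl[unfolded One_nat_def] s(2))
  have imh: "of_nat m * A * h * (im * C) = A * h * C" and idz: "of_nat d * A * (id * C) = A * C" for A C
    using im[of "A * h * C"] id[of "A * C"] by (simp_all only: mult_ac)
  have ext_h: "ext b h = cof b * h" if "b \<in> B" for b
    unfolding derivation_h[OF dext[OF that]] using bh[OF that] ext_v(1) by simp
  have ext_g: "ext b g = 0" if "b \<in> B" for b
    unfolding derivation_g[OF dext[OF that]] ext_v ext_h[OF that] ym mult_minus_right imh by (simp add: mult_ac)
  have tt_h: "tt h = 0" unfolding derivation_h[OF dtt] using tt_v(1) by simp
  have tt_g: "tt g = g"
  proof -
    have "tt g = z ^ (d - 1) * z - y ^ (m - 1) * h * y"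
      unfolding derivation_g[OF dtt] tt_v tt_h imh idz by simp
    also have "\<dots> = g" unfolding g_def zd ym by (simp add: mult_ac)
    finally show ?thesis .
  qed
  have ss_h: "ss h = 0" unfolding derivation_h[OF dss] using ss_v(1) by simp
  have ss_g: "ss g = 0"
    unfolding derivation_g[OF dss] ss_v ss_h imh idz by (simp add: mult_ac)
  let ?D = "carrier (log_derivations n (g * h))"
  define B' where "B' = ext ` B \<union> {tt, ss}"
  have memD: "\<theta> \<in> ?D" if "\<theta> \<in> derivations n" "\<theta> (g * h) = r * (g * h)" "r \<in> mpolyn n" for \<theta> r
    using that by (auto simp: log_derivations_simps)
  have "B' \<subseteq> ?D" unfolding B'_def
  proof (intro Un_least subsetI)
    fix \<theta> assume "\<theta> \<in> ext ` B"
    then obtain b where b: "b \<in> B" "\<theta> = ext b" by auto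
    then show "\<theta> \<in> ?D"
      using derivation_gh[OF dext[OF b(1)]] ext_h[OF b(1)] ext_g[OF b(1)] cof(1)[OF b(1)] dext[OF b(1)]
      by (intro memD[of _ "cof b"]) (auto simp: mult_ac intro: up)
  next
    fix \<theta> assume "\<theta> \<in> {tt, ss}"
    moreover have "tt \<in> ?D" using derivation_gh[OF dtt] tt_g tt_h dtt by (intro memD[of _ 1]) (auto intro: s)
    moreover have "ss \<in> ?D" using derivation_gh[OF dss] ss_g ss_h dss by (intro memD[of _ 0]) (auto intro: s)
    ultimately show "\<theta> \<in> ?D" by auto
  qed
  have yk0: "y ^ (m - 1) * h \<noteq> 0" using h_nonzero y_nonzero by simp
  have zz: "z \<noteq> 0" by (rule Var_nonzero)
  have inj: "inj_on ext B"
  proof (rule inj_onI)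
    fix b b' assume "b \<in> B" "b' \<in> B" "ext b = ext b'"
    then show "b = b'" using ext_v(1) by (intro derivation_eqI[OF Bd Bd]) (auto, metis)
  qed
  have tt_ss: "tt \<noteq> ss"
  proof
    assume "tt = ss"
    then have "im * y = im * z ^ (d - 1)" using tt_v(2) ss_v(2) by simp
    then have "y = z ^ (d - 1)" using im0 by simp
    then have "coeff (univ_in n y) 0 = coeff (univ_in n (z ^ (d - 1))) 0" by simp
    then show False using md m1 y_nonzero by (simp add: is_homD[OF univ_coeff_0_hom] univ_z[unfolded One_nat_def])
  qed
  have not_ext: "tt \<noteq> ext b" "ss \<noteq> ext b" for b
    using tt_v(3) ss_v(3) ext_v(3) im0 zz yk0 by auto
  \<comment> \<open>As \<open>ext\<close> is injective and misses \<open>tt \<noteq> ss\<close>, sums over finite subsets of \<open>B'\<close> can be reindexed over \<open>B\<close>.\<close>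
  have comb: "(\<Sum>\<beta>\<in>ext ` T \<union> U. c \<beta> * \<beta> p) = (\<Sum>b\<in>T. c (ext b) * ext b p) +
      (if tt \<in> U then c tt else 0) * tt p + (if ss \<in> U then c ss else 0) * ss p"
    if "finite T" "T \<subseteq> B" "U \<subseteq> {tt, ss}" for T U c p
  proof -
    have fin: "finite U" using that(3) finite_subset by blast
    have "ext ` T \<inter> U = {}" using that(3) not_ext by auto
    then have "(\<Sum>\<beta>\<in>ext ` T \<union> U. c \<beta> * \<beta> p) = (\<Sum>\<beta>\<in>ext ` T. c \<beta> * \<beta> p) + (\<Sum>\<beta>\<in>U. c \<beta> * \<beta> p)"
      using that(1) fin by (intro sum.union_disjoint) auto
    moreover have "(\<Sum>\<beta>\<in>ext ` T. c \<beta> * \<beta> p) = (\<Sum>b\<in>T. c (ext b) * ext b p)"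
      using inj_on_subset[OF inj that(2)] by (simp add: sum.reindex)
    moreover have "(\<Sum>\<beta>\<in>U. c \<beta> * \<beta> p) = (\<Sum>\<beta>\<in>{tt, ss}. (if \<beta> \<in> U then c \<beta> else 0) * \<beta> p)"
      using that(3) by (intro sum.mono_neutral_cong_left) auto
    ultimately show ?thesis using tt_ss by (simp add: add.assoc)
  qed
  have "spans_log_derivations n (g * h) B'" unfolding spans_log_derivations_def
  proof
    fix \<theta> assume "\<theta> \<in> ?D"
    then have \<theta>: "\<theta> \<in> derivations n" "\<exists>r\<in>mpolyn n. \<theta> (g * h) = r * (g * h)" by (auto simp: log_derivations_simps)
    then obtain c t u where c: "c \<in> mpolyn n" "\<theta> h = c * h" and tu: "t \<in> mpolyn n" "u \<in> mpolyn n"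
      and ty: "of_nat m * \<theta> y = y * t + z ^ (d - 1) * u - y * c" and tz: "of_nat d * \<theta> z = z * t + y ^ (m - 1) * h * u"
      using log_derivation_gh_components[OF \<theta>(1)] by blast
    have "\<forall>i\<in>{1..n-2}. \<theta> (Var i) \<in> mpolyn n" using low(3) derivation_Var_closed[OF \<theta>(1)] by blast
    moreover have "(\<Sum>i\<in>{1..n-2}. \<theta> (Var i) * partial_deriv i h) = c * h" using derivation_h[OF \<theta>(1)] c(2) by simp
    ultimately obtain T \<gamma> where T: "finite T" "T \<subseteq> B" "\<forall>b\<in>T. \<gamma> b \<in> mpolyn n"
      "\<forall>i\<in>{1..n-2}. \<theta> (Var i) = (\<Sum>b\<in>T. \<gamma> b * b (Var i))"
      using span[unfolded spans_vectors_def, rule_format, of "\<lambda>i. \<theta> (Var i)" c] c(1) by blast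
    have "c * h = (\<Sum>i\<in>{1..n-2}. (\<Sum>b\<in>T. \<gamma> b * b (Var i)) * partial_deriv i h)"
      using c(2) derivation_h[OF \<theta>(1)] T(4) by simp
    also have "\<dots> = (\<Sum>b\<in>T. \<gamma> b * (\<Sum>i\<in>{1..n-2}. b (Var i) * partial_deriv i h))"
      unfolding sum_distrib_right sum_distrib_left by (subst sum.swap) (simp add: mult.assoc)
    also have "\<dots> = (\<Sum>b\<in>T. \<gamma> b * cof b) * h"
      unfolding sum_distrib_right
    proof (intro sum.cong refl)
      fix b assume "b \<in> T"
      then have "b \<in> B" using T(2) by auto
      show "\<gamma> b * (\<Sum>i\<in>{1..n-2}. b (Var i) * partial_deriv i h) = \<gamma> b * cof b * h"
        unfolding bh[OF \<open>b \<in> B\<close>] by (rule mult.assoc[symmetric])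
    qed
    finally have cT: "c = (\<Sum>b\<in>T. \<gamma> b * cof b)" using h_nonzero by simp
    define \<gamma>' where "\<gamma>' = (\<lambda>\<beta>. if \<beta> = tt then t else if \<beta> = ss then u else \<gamma> (inv_into B ext \<beta>))"
    have g_ext: "\<gamma>' (ext b) = \<gamma> b" if "b \<in> T" for b
      using that T(2) inj not_ext[of b] by (auto simp: \<gamma>'_def inv_into_f_f)
    have comb': "(\<Sum>\<beta>\<in>ext ` T \<union> {tt, ss}. \<gamma>' \<beta> * \<beta> p) = (\<Sum>b\<in>T. \<gamma> b * ext b p) + t * tt p + u * ss p" for p
      using comb[OF T(1,2) subset_refl, of \<gamma>' p] g_ext tt_ss by (simp add: \<gamma>'_def)
    have "\<theta> (Var i) = (\<Sum>\<beta>\<in>ext ` T \<union> {tt, ss}. \<gamma>' \<beta> * \<beta> (Var i))" if i: "i \<in> {1..n}" for i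
    proof -
      have "i \<in> {1..n-2} \<or> i = n - 1 \<or> i = n" using i by auto
      then consider "i \<in> {1..n-2}" | "i = n - 1" | "i = n" by blast
      then show ?thesis
      proof cases
        case 1
        then show ?thesis unfolding comb' using T(4) by (simp only: ext_v tt_v ss_v mult_zero_right add_0_right)
      next
        case 2
        have "\<theta> y = im * (y * t + z ^ (d - 1) * u - y * c)" unfolding ty[symmetric] by (rule im[symmetric])
        also have "\<dots> = (\<Sum>b\<in>T. \<gamma> b * - (im * (y * cof b))) + t * (im * y) + u * (im * z ^ (d - 1))"
          unfolding cT by (simp add: sum_distrib_left sum_distrib_right sum_negf algebra_simps)
        finally show ?thesis unfolding comb' 2 ext_v tt_v ss_v .
      next
        case 3
        have "\<theta> z = id * (z * t + y ^ (m - 1) * h * u)" unfolding tz[symmetric] by (rule id[symmetric])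
        then show ?thesis unfolding comb' 3 ext_v tt_v ss_v by (simp add: algebra_simps)
      qed
    qed
    moreover have "\<forall>\<beta>\<in>ext ` T \<union> {tt, ss}. \<gamma>' \<beta> \<in> mpolyn n" using T(3) g_ext tu tt_ss by (auto simp: \<gamma>'_def)
    moreover have "finite (ext ` T \<union> {tt, ss})" "ext ` T \<union> {tt, ss} \<subseteq> B'" using T unfolding B'_def by auto
    ultimately show "\<exists>T c. finite T \<and> T \<subseteq> B' \<and> (\<forall>b\<in>T. c b \<in> mpolyn n) \<and> (\<forall>i\<in>{1..n}. \<theta> (Var i) = (\<Sum>b\<in>T. c b * b (Var i)))"
      by blast
  qed
  moreover have "indep_derivations n B'" unfolding indep_derivations_def
  proof (intro allI impI)
    fix T' c assume T': "finite T'" "T' \<subseteq> B'" "\<forall>b\<in>T'. c b \<in> mpolyn n" "\<forall>i\<in>{1..n}. (\<Sum>b\<in>T'. c b * b (Var i)) = 0"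
    define T where "T = {b \<in> B. ext b \<in> T'}"
    define U where "U = T' \<inter> {tt, ss}"
    have TU: "T' = ext ` T \<union> U" using T'(2) unfolding T_def U_def B'_def by auto
    have T: "finite T" "T \<subseteq> B"
      using T'(1) inj_on_subset[OF inj, of T] finite_imageD[of ext T] by (auto simp: T_def intro: finite_subset)
    have U: "U \<subseteq> {tt, ss}" by (simp add: U_def)
    define t where "t = (if tt \<in> U then c tt else 0)"
    define u where "u = (if ss \<in> U then c ss else 0)"
    have eq: "(\<Sum>b\<in>T. c (ext b) * ext b (Var i)) + t * tt (Var i) + u * ss (Var i) = 0" if "i \<in> {1..n}" for i
      using T'(4) that unfolding TU comb[OF T U] t_def u_def by blast
    have "\<forall>i\<in>{1..n-2}. (\<Sum>b\<in>T. c (ext b) * b (Var i)) = 0"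
    proof
      fix i assume i: "i \<in> {1..n-2}"
      show "(\<Sum>b\<in>T. c (ext b) * b (Var i)) = 0" using eq[OF low(3)[OF i]] by (simp only: ext_v(1)[OF i] tt_v(1)[OF i] ss_v(1)[OF i] mult_zero_right add_0_right)
    qed
    moreover have "\<forall>b\<in>T. c (ext b) \<in> mpolyn n" using T'(3) by (auto simp: T_def)
    ultimately have c0: "\<forall>b\<in>T. c (ext b) = 0"
      using indep[unfolded indep_vectors_def, rule_format, of T "\<lambda>b. c (ext b)"] T by blast
    have 1: "im * (t * y + u * z ^ (d - 1)) = 0" using eq[OF n'(4)] c0 unfolding tt_v ss_v by (simp add: algebra_simps)
    have 2: "id * (t * z + u * (y ^ (m - 1) * h)) = 0" using eq[OF n'(5)] c0 unfolding tt_v ss_v by (simp add: algebra_simps)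
    have 1: "t * y + u * z ^ (d - 1) = 0" and 2: "t * z + u * (y ^ (m - 1) * h) = 0" using 1 2 im0 by simp_all
    \<comment> \<open>The coefficient matrix of the two equations has determinant \<open>- g\<close>.\<close>
    have "u * g = z * (t * y + u * z ^ (d - 1)) - y * (t * z + u * (y ^ (m - 1) * h))"
      unfolding g_def zd ym by (simp add: algebra_simps)
    then have "u * g = 0" by (simp only: 1 2 mult_zero_right diff_zero)
    then have "u = 0" using g_nonzero by simp
    then have "t = 0" using 1 y_nonzero by simp
    show "\<forall>b\<in>T'. c b = 0"
    proof
      fix \<beta> assume "\<beta> \<in> T'"
      then have "\<beta> \<in> ext ` T \<or> \<beta> \<in> U" using TU by blast
      then show "c \<beta> = 0"
        using c0 \<open>t = 0\<close> \<open>u = 0\<close> U unfolding t_def u_def by (auto split: if_splits)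
    qed
  qed
  ultimately have "module_basis (mpoly_ring n) (log_derivations n (g * h)) B'"
    unfolding module_basis_iff[OF ghR] using \<open>B' \<subseteq> ?D\<close> by blast
  then show ?thesis
    unfolding free_divisor_def free_module_def using squarefree_gh module_log_derivations[OF ghR] by blast
qed

end

section \<open>Ideals of linear type and the kernel of the evaluation map\<close>

lemma rees_eval_eq_evalm: "rees_eval = evalm (\<lambda>c. [:c:]) (\<lambda>a. [:0, a:])"
  unfolding rees_eval_def evalm_def by (rule ext) simp

lemma is_hom_rees_eval: "is_hom rees_eval"
  unfolding rees_eval_eq_evalm by (rule is_hom_evalm[OF is_hom_const_poly])

lemma rees_eval_Var: "rees_eval (Var a) = [:0, a:]"
  unfolding rees_eval_eq_evalm by (rule evalm_Var[OF is_hom_const_poly])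

lemma rees_eval_Const: "rees_eval (Const c) = [:c:]"
  unfolding rees_eval_eq_evalm by (rule evalm_Const[OF is_hom_const_poly])

definition sym_ideal :: "'a::comm_ring_1 set \<Rightarrow> 'a set \<Rightarrow> ('a, 'a) mpoly set" where
  "sym_ideal A I = Idl\<^bsub>ring_on (mpolys A I)\<^esub> (sym_relations A I)"

context
  fixes A I :: "'a::comm_ring_1 set"
  assumes A: "is_subring A" and I: "ideal_in A I"
begin

lemma sym_relations_subset: "sym_relations A I \<subseteq> mpolys A I"
  unfolding sym_relations_def
  using ideal_inD[OF A I] is_subringD[OF is_subring_mpolys[OF A]]
  by (auto intro!: is_subringD[OF is_subring_mpolys[OF A]] Var_in_mpolys[OF A] Const_in_mpolys[OF A])

lemma ideal_in_sym_ideal: "ideal_in (mpolys A I) (sym_ideal A I)"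
  and sym_relations_in_sym_ideal: "sym_relations A I \<subseteq> sym_ideal A I"
  unfolding sym_ideal_def
  using genideal_ring_on(1,2)[OF is_subring_mpolys[OF A] sym_relations_subset] by auto

lemma sym_ideal_subset: "ideal_in (mpolys A I) J \<Longrightarrow> sym_relations A I \<subseteq> J \<Longrightarrow> sym_ideal A I \<subseteq> J"
  unfolding sym_ideal_def by (rule genideal_ring_on(3)[OF is_subring_mpolys[OF A] sym_relations_subset])

lemma rees_eval_sym_ideal: "p \<in> sym_ideal A I \<Longrightarrow> rees_eval p = 0"
proof -
  assume p: "p \<in> sym_ideal A I"
  note h = is_homD[OF is_hom_rees_eval]
  have "ideal_in (mpolys A I) {p \<in> mpolys A I. rees_eval p = 0}"
    unfolding ideal_in_def by (auto simp: h intro: is_subringD[OF is_subring_mpolys[OF A]])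
  moreover have "sym_relations A I \<subseteq> {p \<in> mpolys A I. rees_eval p = 0}"
    using sym_relations_subset by (auto simp: sym_relations_def h rees_eval_Var rees_eval_Const)
  ultimately show ?thesis using sym_ideal_subset p by blast
qed

text \<open>The evaluation is constant on cosets of the ideal of relations, so \<open>p\<close> with value \<open>0\<close> has the same
  image in the Rees algebra as \<open>0\<close>, and injectivity identifies the two cosets.\<close>

lemma linear_type_imp_kernel:
  assumes lt: "linear_type A I" and p: "p \<in> mpolys A I" "rees_eval p = 0"
  shows "p \<in> sym_ideal A I"
proof -
  let ?R = "ring_on (mpolys A I)" and ?K = "sym_ideal A I"
  note K = ideal_inD[OF is_subring_mpolys[OF A] ideal_in_sym_ideal]
  note h = is_homD[OF is_hom_rees_eval]
  have coset: "?K +>\<^bsub>?R\<^esub> q = {k + q | k. k \<in> ?K}" for q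
    by (auto simp: a_r_coset_def r_coset_def)
  have val: "sym_to_rees (?K +>\<^bsub>?R\<^esub> q) = rees_eval q" for q
  proof -
    have "rees_eval ` (?K +>\<^bsub>?R\<^esub> q) = {rees_eval q}"
      using K(2) by (force simp: coset h rees_eval_sym_ideal image_iff)
    then show ?thesis by (simp add: sym_to_rees_def)
  qed
  have mem: "?K +>\<^bsub>?R\<^esub> q \<in> carrier (sym_algebra A I)" if "q \<in> mpolys A I" for q
    using that unfolding sym_algebra_def sym_ideal_def[symmetric] FactRing_def A_RCOSETS_def RCOSETS_def a_r_coset_def
    by auto
  have "inj_on sym_to_rees (carrier (sym_algebra A I))"
    using lt unfolding linear_type_def ring_iso_def by (auto simp: bij_betw_def)
  moreover have "0 \<in> mpolys A I" by (rule is_subringD[OF is_subring_mpolys[OF A]])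
  ultimately have "?K +>\<^bsub>?R\<^esub> p = ?K +>\<^bsub>?R\<^esub> 0"
    using mem[OF p(1)] mem[of 0] val[of p] val[of 0] p(2) by (auto simp: inj_on_def h)
  moreover have "p \<in> ?K +>\<^bsub>?R\<^esub> p" using K(2) by (force simp: coset)
  ultimately have "p \<in> ?K +>\<^bsub>?R\<^esub> 0" by simp
  then show ?thesis by (simp add: coset)
qed

definition ideal_power :: "nat \<Rightarrow> 'a set" where
  "ideal_power k = I [^]\<^bsub>ideals_set (ring_on A)\<^esub> k"

lemma ideal_power_0: "ideal_power 0 = A"
  and ideal_power_Suc: "ideal_power (Suc k) = ideal_prod (ring_on A) (ideal_power k) I"
  by (simp_all add: ideal_power_def nat_pow_def ideals_set_def)

lemma ideal_in_ideal_power: "ideal_in A (ideal_power k)"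
proof -
  interpret cring "ring_on A" by (rule cring_ring_on[OF A])
  have "ideal (ideal_power k) (ring_on A)"
  proof (induction k)
    case 0 then show ?case using oneideal by (simp add: ideal_power_0)
  next
    case (Suc k) then show ?case
      using ideal_prod_is_ideal I ideal_ring_on_iff[OF A] by (simp add: ideal_power_Suc)
  qed
  then show ?thesis using ideal_ring_on_iff[OF A] by simp
qed

lemma ideal_power_mult: assumes "a \<in> ideal_power i" "b \<in> ideal_power j" shows "a * b \<in> ideal_power (i + j)"
proof -
  interpret cring "ring_on A" by (rule cring_ring_on[OF A])
  interpret M: Group.comm_monoid "ideals_set (ring_on A)" by (rule ideals_set_is_comm_monoid)
  have "I \<in> carrier (ideals_set (ring_on A))"
    using I ideal_ring_on_iff[OF A] by (simp add: ideals_set_def)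
  then have "ideal_prod (ring_on A) (ideal_power i) (ideal_power j) = ideal_power (i + j)"
    using M.nat_pow_mult[of I i j] by (simp add: ideal_power_def ideals_set_def)
  then show ?thesis using ideal_prod.prod[OF assms, of "ring_on A"] by simp
qed

definition rees_set :: "'a poly set" where "rees_set = {p. \<forall>i. coeff p i \<in> ideal_power i}"

lemma rees_algebra_eq: "rees_algebra A I = ring_on rees_set"
  by (simp add: rees_algebra_def rees_set_def ideal_power_def)

lemma is_subring_rees_set: "is_subring rees_set"
  unfolding is_subring_def
proof (intro conjI ballI)
  note P = ideal_inD[OF A ideal_in_ideal_power]
  show "1 \<in> rees_set"
    unfolding rees_set_def by (auto simp: ideal_power_0 P is_subringD[OF A])
  fix p q assume p: "p \<in> rees_set" and q: "q \<in> rees_set"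
  show "p + q \<in> rees_set" using p q by (auto simp: rees_set_def intro: P)
  have "coeff p i * coeff q (k - i) \<in> ideal_power k" if "i \<le> k" for i k
    using ideal_power_mult[of "coeff p i" i "coeff q (k - i)" "k - i"] that p q by (simp add: rees_set_def)
  then show "p * q \<in> rees_set"
    by (auto simp: rees_set_def coeff_mult intro!: ideal_in_sum[OF ideal_in_ideal_power])
next
  fix p assume "p \<in> rees_set"
  then show "- p \<in> rees_set" by (auto simp: rees_set_def intro: ideal_inD[OF A ideal_in_ideal_power])
qed

lemma rees_eval_image: "rees_eval ` mpolys A I = rees_set"
proof
  note P = ideal_inD[OF A ideal_in_ideal_power]
  note h = is_homD[OF is_hom_rees_eval]
  have "mpolys A I \<subseteq> {p. rees_eval p \<in> rees_set}"
  proof (rule mpolys_subset_closed[OF A])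
    show "Const a \<in> {p. rees_eval p \<in> rees_set}" if "a \<in> A" for a
      using that by (auto simp: rees_eval_Const rees_set_def coeff_pCons ideal_power_0 P split: nat.splits)
    show "Var a \<in> {p. rees_eval p \<in> rees_set}" if "a \<in> I" for a
    proof -
      have "1 * a \<in> ideal_power (Suc 0)"
        unfolding ideal_power_Suc ideal_power_0
        using ideal_prod.prod[OF is_subringD(1)[OF A] that, of "ring_on A"] by simp
      then show ?thesis by (auto simp: rees_eval_Var rees_set_def coeff_pCons P split: nat.splits)
    qed
  qed (auto simp: h is_subringD[OF is_subring_rees_set])
  then show "rees_eval ` mpolys A I \<subseteq> rees_set" by auto
  let ?im = "rees_eval ` mpolys A I"
  have im: "is_subring ?im" by (intro is_subring_image is_hom_rees_eval is_subring_mpolys A)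
  have var: "[:0, a:] \<in> ?im" if "a \<in> I" for a
    using rees_eval_Var[of a] Var_in_mpolys[OF A that] by (metis imageI)
  have mon: "monom a k \<in> ?im" if "a \<in> ideal_power k" for a k
    using that
  proof (induction k arbitrary: a)
    case 0
    then show ?case using rees_eval_Const[of a] Const_in_mpolys[OF A, of a I]
      by (metis ideal_power_0 imageI monom_0)
  next
    case (Suc k)
    have "a \<in> ideal_prod (ring_on A) (ideal_power k) I" using Suc.prems by (simp add: ideal_power_Suc)
    then show ?case
    proof (induction rule: ideal_prod.induct)
      case (prod i j)
      have "monom (i * j) (Suc k) = monom i k * [:0, j:]"
        by (simp add: monom_Suc smult_monom mult.commute)
      then show ?case using is_subringD(4)[OF im Suc.IH[OF prod(1)] var[OF prod(2)]] by simp
    next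
      case (sum a b)
      then show ?case using is_subringD(3)[OF im] by (simp add: add_monom[symmetric])
    qed
  qed
  show "rees_set \<subseteq> ?im"
  proof
    fix p assume "p \<in> rees_set"
    then have "(\<Sum>i\<le>degree p. monom (coeff p i) i) \<in> ?im"
      by (intro is_subring_sum[OF im] mon) (simp add: rees_set_def)
    then show "p \<in> ?im" by (simp add: poly_as_sum_of_monoms)
  qed
qed

text \<open>The evaluation maps onto the Rees algebra, so by the first isomorphism theorem only its kernel
  matters.\<close>

lemma kernel_imp_linear_type:
  assumes ker: "\<And>p. p \<in> mpolys A I \<Longrightarrow> rees_eval p = 0 \<Longrightarrow> p \<in> sym_ideal A I"
  shows "linear_type A I"
proof -
  let ?R = "ring_on (mpolys A I)" and ?S = "rees_algebra A I"
  interpret R: cring ?R by (rule cring_ring_on[OF is_subring_mpolys[OF A]])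
  interpret S: cring ?S unfolding rees_algebra_eq by (rule cring_ring_on[OF is_subring_rees_set])
  note h = is_homD[OF is_hom_rees_eval]
  interpret ring_hom_ring ?R ?S rees_eval
  proof (rule ring_hom_ringI2)
    show "rees_eval \<in> ring_hom ?R ?S"
      using rees_eval_image by (auto intro!: ring_hom_memI simp: rees_algebra_eq h)
  qed (rule R.ring_axioms S.ring_axioms)+
  have "a_kernel ?R ?S rees_eval = sym_ideal A I"
  proof
    show "a_kernel ?R ?S rees_eval \<subseteq> sym_ideal A I"
      using ker unfolding a_kernel_def' rees_algebra_eq ring_on_simps by blast
    show "sym_ideal A I \<subseteq> a_kernel ?R ?S rees_eval"
      using rees_eval_sym_ideal ideal_inD(1)[OF is_subring_mpolys[OF A] ideal_in_sym_ideal]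
      unfolding a_kernel_def' rees_algebra_eq ring_on_simps by blast
  qed
  moreover have "rees_eval ` carrier ?R = carrier ?S" using rees_eval_image by (simp add: rees_algebra_eq)
  ultimately have "(\<lambda>X. the_elem (rees_eval ` X)) \<in> ring_iso (?R Quot (sym_ideal A I)) ?S"
    using FactRing_iso_set by simp
  moreover have "(sym_to_rees :: ('a, 'a) mpoly set \<Rightarrow> 'a poly) = (\<lambda>X. the_elem (rees_eval ` X))" by (rule HOL.ext) (simp add: sym_to_rees_def)
  ultimately show ?thesis unfolding linear_type_def sym_algebra_def sym_ideal_def by simp
qed

end

section \<open>The kernel of an evaluation map in four variables\<close>

definition ideal2 :: "'a::comm_ring_1 set \<Rightarrow> 'a \<Rightarrow> 'a \<Rightarrow> 'a set" where
  "ideal2 C a b = {u * a + v * b | u v. u \<in> C \<and> v \<in> C}"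

lemma ideal2I: "u \<in> C \<Longrightarrow> v \<in> C \<Longrightarrow> u * a + v * b \<in> ideal2 C a b"
  by (auto simp: ideal2_def)

lemma coeff_0_X_mult:
  fixes p :: "'a::comm_ring_1 poly"
  shows "coeff ([:0, 1:] * p) 0 = 0" "coeff ([:0, 1:] * p) (Suc k) = coeff p k"
  by simp_all

lemma coeff_0_imp_X_mult:
  assumes "p \<in> polys B" "coeff p 0 = 0" shows "\<exists>p'\<in>polys B. p = [:0, 1:] * p'"
proof -
  obtain a q where "p = pCons a q" by (cases p)
  then show ?thesis using assms by (auto simp: pCons_in_polys_iff intro!: bexI[of _ q])
qed

lemma monic_division:
  fixes r :: "'c::idom"
  assumes B: "is_subring B" and r: "r \<in> B" and d: "1 \<le> d" and a: "a \<in> polys B"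
  shows "\<exists>w\<in>polys B. \<exists>s\<in>polys B. a = (monom 1 d - [:r:]) * w + s \<and> (\<forall>k\<ge>d. coeff s k = 0)"
  using a
proof (induction a rule: pCons_induct)
  case 0
  then show ?case using is_subringD(2)[OF is_subring_polys[OF B]] by (intro bexI[of _ 0]) auto
next
  case (pCons c a)
  note P = is_subringD[OF is_subring_polys[OF B]]
  have c: "c \<in> B" "a \<in> polys B" using pCons.prems by (auto simp: pCons_in_polys_iff)
  then obtain w s where w: "w \<in> polys B" "s \<in> polys B" "a = (monom 1 d - [:r:]) * w + s" "\<forall>k\<ge>d. coeff s k = 0"
    using pCons.IH by blast
  let ?q = "monom 1 d - [:r:]"
  define e where "e = coeff (pCons c s) d"
  have pc: "pCons c s \<in> polys B" using c w by (simp add: pCons_in_polys_iff)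
  then have eB: "e \<in> B" unfolding e_def by (rule coeff_polys)
  have q: "?q \<in> polys B"
    using is_subringD(7)[OF is_subring_polys[OF B] X_in_polys[OF B], of d] const_in_polys[OF B r]
    by (intro P) (simp_all add: monom_altdef)
  have "pCons c a = ?q * ([:0, 1:] * w + [:e:]) + (pCons c s - ?q * [:e:])"
    unfolding w(3) by (simp add: algebra_simps)
  moreover have "[:0, 1:] * w + [:e:] \<in> polys B" by (intro P X_in_polys B w const_in_polys eB)
  moreover have "pCons c s - ?q * [:e:] \<in> polys B" by (intro P pc q const_in_polys B eB)
  moreover have "coeff (pCons c s - ?q * [:e:]) k = 0" if "d \<le> k" for k
  proof (cases "k = d")
    case True
    then show ?thesis using d by (simp add: e_def coeff_pCons split: nat.splits)
  next
    case False
    then show ?thesis using that w(4) by (simp add: coeff_pCons split: nat.splits)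
  qed
  ultimately show ?case by blast
qed

text \<open>Division by the monic polynomial \<open>q = X\<^sup>d - r\<close> does not leave the subring, and remainders are unique.
  Hence \<open>q\<close> divides \<open>a\<close> whenever it divides \<open>c a\<close> for a nonzero constant \<open>c\<close>: the remainder of \<open>c a\<close> is
  \<open>c\<close> times that of \<open>a\<close>.\<close>

lemma monic_cancel_constant:
  fixes r c :: "'c::idom"
  assumes B: "is_subring B" and r: "r \<in> B" and d: "1 \<le> d" and a: "a \<in> polys B"
    and c: "c \<noteq> 0" and eq: "(monom 1 d - [:r:]) * w = [:c:] * a"
  shows "\<exists>w'\<in>polys B. a = (monom 1 d - [:r:]) * w'"
proof -
  let ?q = "monom 1 d - [:r:]"
  obtain w' s where w': "w' \<in> polys B" "a = ?q * w' + s" "\<forall>k\<ge>d. coeff s k = 0"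
    using monic_division[OF B r d a] by blast
  have qd: "degree ?q = d" "?q \<noteq> 0"
  proof -
    have 1: "degree (monom (1::'c) d) = d" by (simp add: degree_monom_eq)
    have "degree (- [:r:]) < degree (monom (1::'c) d)" using 1 d by simp
    then have "degree (monom 1 d + - [:r:]) = d" using degree_add_eq_left 1 by metis
    then show "degree ?q = d" by (simp only: diff_conv_add_uminus)
    then show "?q \<noteq> 0" using d by auto
  qed
  have eq': "?q * (w - [:c:] * w') = [:c:] * s" using eq unfolding w'(2) by (simp add: algebra_simps)
  have "w - [:c:] * w' = 0"
  proof (rule ccontr)
    assume ne: "w - [:c:] * w' \<noteq> 0"
    then have "degree (?q * (w - [:c:] * w')) = d + degree (w - [:c:] * w')"
      using qd(1) degree_mult_eq[OF qd(2) ne] by simp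
    moreover have "?q * (w - [:c:] * w') \<noteq> 0" by (rule no_zero_divisors[OF qd(2) ne])
    ultimately have "coeff ([:c:] * s) (d + degree (w - [:c:] * w')) \<noteq> 0"
      unfolding eq'[symmetric] by (metis leading_coeff_neq_0)
    then show False using w'(3) by simp
  qed
  then have "[:c:] * s = 0" using eq' by simp
  then have "s = 0" using c by simp
  then show ?thesis using w' by auto
qed

text \<open>Consider \<open>X F = a E + b S\<close>, where \<open>E = \<beta> + X v\<close> and \<open>S = X\<^bsup>d-1\<^esup> u + \<gamma>\<close>. At \<open>X = 0\<close> it is a relation between \<open>\<beta>\<close>
  and \<open>\<gamma>\<close>, and a multiple of the trivial one if \<open>\<gamma>\<close> is a nonzerodivisor modulo \<open>\<beta>\<close>. Subtracting the same multiple
  of the trivial relation between \<open>E\<close> and \<open>S\<close> makes \<open>a\<close> and \<open>b\<close> divisible by \<open>X\<close>.\<close>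

lemma X_nonzerodivisor_mod_ideal2:
  fixes \<beta> \<gamma> u v :: "'c::idom"
  assumes B: "is_subring B" and mem: "\<beta> \<in> B" "\<gamma> \<in> B" "u \<in> B" "v \<in> B" and "\<beta> \<noteq> 0" and d: "2 \<le> d"
    and reg: "\<And>b w. b \<in> B \<Longrightarrow> w \<in> B \<Longrightarrow> \<gamma> * b = \<beta> * w \<Longrightarrow> \<exists>w'\<in>B. b = \<beta> * w'"
    and F: "[:0, 1:] * F \<in> ideal2 (polys B) ([:\<beta>:] + [:0, 1:] * [:v:]) ([:0, 1:] ^ (d - 1) * [:u:] + [:\<gamma>:])"
  shows "F \<in> ideal2 (polys B) ([:\<beta>:] + [:0, 1:] * [:v:]) ([:0, 1:] ^ (d - 1) * [:u:] + [:\<gamma>:])"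
proof -
  let ?X = "[:0, 1:] :: 'c poly"
  let ?E = "[:\<beta>:] + ?X * [:v:]" and ?S = "?X ^ (d - 1) * [:u:] + [:\<gamma>:]"
  note P = is_subringD[OF is_subring_polys[OF B]]
  obtain a b where ab: "a \<in> polys B" "b \<in> polys B" "?X * F = a * ?E + b * ?S"
    using F unfolding ideal2_def by auto
  have E0: "coeff ?E 0 = \<beta>" by simp
  have S0: "coeff ?S 0 = \<gamma>" using d by (cases "d - 1") auto
  have E0': "coeff (p * ?E) 0 = coeff p 0 * \<beta>" and S0': "coeff (p * ?S) 0 = coeff p 0 * \<gamma>" for p
    unfolding coeff_mult_0 E0 S0 by (rule refl)+
  have "coeff (a * ?E + b * ?S) 0 = 0" unfolding ab(3)[symmetric] by simp
  then have 0: "coeff a 0 * \<beta> + coeff b 0 * \<gamma> = 0" unfolding coeff_add[of "a * ?E"] E0' S0' .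
  then have "\<gamma> * coeff b 0 = \<beta> * (- coeff a 0)" by (simp add: algebra_simps eq_neg_iff_add_eq_0)
  then obtain w where w: "w \<in> B" "coeff b 0 = \<beta> * w"
    using reg[of "coeff b 0" "- coeff a 0"] ab by (auto simp: polys_def intro: is_subringD[OF B])
  have "\<beta> * (coeff a 0 + \<gamma> * w) = 0" using 0 unfolding w(2) by (simp add: algebra_simps)
  then have a0: "coeff a 0 + \<gamma> * w = 0" using \<open>\<beta> \<noteq> 0\<close> by simp
  have Ep: "?E \<in> polys B" by (intro P const_in_polys B mem X_in_polys)
  have Sp: "?S \<in> polys B" by (intro P const_in_polys B mem X_in_polys)
  have "coeff (a + [:w:] * ?S) 0 = 0" unfolding coeff_add[of a] S0' using a0 by (simp add: mult.commute)
  moreover have "a + [:w:] * ?S \<in> polys B" by (intro P ab const_in_polys B w Sp)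
  ultimately obtain a1 where a1: "a1 \<in> polys B" "a + [:w:] * ?S = ?X * a1" using coeff_0_imp_X_mult by blast
  have "coeff (b - [:w:] * ?E) 0 = 0" unfolding coeff_diff[of b] E0' using w(2) by (simp add: mult.commute)
  moreover have "b - [:w:] * ?E \<in> polys B" by (intro P ab const_in_polys B w Ep)
  ultimately obtain b1 where b1: "b1 \<in> polys B" "b - [:w:] * ?E = ?X * b1" using coeff_0_imp_X_mult by blast
  have "?X * F = (a + [:w:] * ?S) * ?E + (b - [:w:] * ?E) * ?S" unfolding ab(3) by (simp only: algebra_simps)
  also have "\<dots> = ?X * (a1 * ?E + b1 * ?S)" unfolding a1(2) b1(2) by (simp only: algebra_simps)
  finally have "F = a1 * ?E + b1 * ?S" by (simp only: mult_cancel_left) simp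
  then show ?thesis using a1 b1 ideal2I by metis
qed

text \<open>The element \<open>y\<^sup>k \<eta> V\<close> is a nonzerodivisor modulo \<open>y U - H\<close> over a subring \<open>A\<close> of a domain: \<open>y\<close> because
  \<open>H \<noteq> 0\<close> is what remains at \<open>y = 0\<close>, and \<open>c = \<eta> V\<close> because \<open>y U\<close> has coefficient \<open>1\<close>. The variable \<open>y\<close> is the
  outermost one, followed by \<open>U\<close> and \<open>V\<close>.\<close>

lemma yU_minus_H_regular:
  fixes A :: "'b::idom set" and \<eta> H :: 'b
  defines "D \<equiv> polys (polys A)"
  defines "\<beta> \<equiv> [:- [:[:H:]:], [:0, 1:]:] :: 'b poly poly poly"
  defines "c \<equiv> [:[:0, \<eta>:]:] :: 'b poly poly"
  assumes A: "is_subring A" and mem: "\<eta> \<in> A" "H \<in> A" and nz: "\<eta> \<noteq> 0" "H \<noteq> 0"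
    and b: "b \<in> polys D" and w: "w \<in> polys D" and eq: "([:0, 1:] ^ k * [:c:]) * b = \<beta> * w"
  shows "\<exists>w'\<in>polys D. b = \<beta> * w'"
proof -
  have D: "is_subring D" unfolding D_def by (intro is_subring_polys A)
  have HD: "[:[:H:]:] \<in> D" unfolding D_def by (intro const_in_polys is_subring_polys A mem)
  have H0: "[:[:H:]:] \<noteq> 0" using nz by simp
  have c0: "c \<noteq> 0" using nz by (simp add: c_def)
  have \<beta>0: "\<beta> \<noteq> 0" by (simp add: \<beta>_def)
  have "\<exists>w1\<in>polys D. w = [:0, 1:] ^ k * w1 \<and> [:c:] * b = \<beta> * w1"
    using eq w
  proof (induction k arbitrary: w)
    case 0 then show ?case by auto
  next
    case (Suc k)
    have "coeff (\<beta> * w) 0 = 0" unfolding Suc.prems(1)[symmetric] power_Suc mult.assoc by (rule coeff_0_X_mult)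
    then have "coeff w 0 = 0" using H0 by (simp add: coeff_mult_0 \<beta>_def)
    then obtain w2 where w2: "w2 \<in> polys D" "w = [:0, 1:] * w2" using coeff_0_imp_X_mult[OF Suc.prems(2)] by blast
    have "[:0, 1:] * (([:0, 1:] ^ k * [:c:]) * b) = [:0, 1:] * (\<beta> * w2)"
      using Suc.prems(1) unfolding w2(2) by (simp only: power_Suc mult_ac)
    then have "([:0, 1:] ^ k * [:c:]) * b = \<beta> * w2" by (simp only: mult_cancel_left) simp
    then obtain w1 where "w1 \<in> polys D" "w2 = [:0, 1:] ^ k * w1" "[:c:] * b = \<beta> * w1" using Suc.IH w2(1) by blast
    then show ?case unfolding w2(2) by (intro bexI[of _ w1]) (simp_all only: power_Suc mult.assoc)
  qed
  then obtain w1 where w1: "w1 \<in> polys D" "[:c:] * b = \<beta> * w1" by blast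
  \<comment> \<open>Comparing coefficients of powers of \<open>y\<close> from the top downwards, \<open>c\<close> divides every coefficient of the cofactor.\<close>
  have rec: "c * coeff b (Suc j) = [:0, 1:] * coeff w1 j - [:[:H:]:] * coeff w1 (Suc j)" for j
  proof -
    have "coeff ([:c:] * b) (Suc j) = coeff (\<beta> * w1) (Suc j)" by (simp only: w1(2))
    moreover have "Polynomial.smult [:- H:] p = - Polynomial.smult [:H:] p" for p
    proof -
      have "[:- H:] = - [:H:]" by simp
      then show ?thesis by (simp only: smult_minus_left)
    qed
    ultimately show ?thesis by (simp add: \<beta>_def)
  qed
  have "\<exists>e\<in>D. coeff w1 j = c * e" for j
  proof (induction "degree w1 + 1 - j" arbitrary: j)
    case 0
    then have "coeff w1 j = 0" by (intro coeff_eq_0) auto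
    then show ?case using is_subringD(2)[OF D] by (intro bexI[of _ 0]) auto
  next
    case (Suc i)
    have "i = degree w1 + 1 - Suc j" using Suc.hyps(2) by simp
    then obtain e where e: "e \<in> D" "coeff w1 (Suc j) = c * e" using Suc.hyps(1) by blast
    define f where "f = coeff b (Suc j) + [:[:H:]:] * e"
    have f: "f \<in> D" unfolding f_def using b by (intro is_subringD[OF D] HD e) (simp add: polys_def)
    have eq: "[:0, 1:] * coeff w1 j = c * f" using rec[of j] unfolding f_def e(2) by (simp add: algebra_simps)
    have "coeff (c * f) 0 = 0" unfolding eq[symmetric] by simp
    then have "coeff f 0 = 0" using nz by (simp add: c_def)
    then obtain f' where f': "f' \<in> D" "f = [:0, 1:] * f'" using coeff_0_imp_X_mult[of f "polys A"] f unfolding D_def by blast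
    have "[:0, 1:] * coeff w1 j = [:0, 1:] * (c * f')" using eq unfolding f'(2) by (simp only: mult.left_commute)
    then have "coeff w1 j = c * f'" by (simp only: mult_cancel_left) simp
    then show ?case using f'(1) by blast
  qed
  then obtain E where E: "\<And>j. E j \<in> D" "\<And>j. coeff w1 j = c * E j" by metis
  define w' where "w' = (\<Sum>j\<le>degree w1. monom (E j) j)"
  have cw: "coeff w' j = (if j \<le> degree w1 then E j else 0)" for j
    unfolding w'_def by (simp add: coeff_sum)
  have w'D: "w' \<in> polys D" using E(1) is_subringD(2)[OF D] by (auto simp: polys_def cw)
  have "[:c:] * w' = w1"
  proof (rule poly_eqI)
    fix j show "coeff ([:c:] * w') j = coeff w1 j"
      using E(2)[of j] by (auto simp: cw coeff_eq_0)
  qed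
  then have "[:c:] * b = [:c:] * (\<beta> * w')" using w1(2) by (simp only: mult.left_commute)
  then have "b = \<beta> * w'" using c0 by (simp only: mult_cancel_left) simp
  then show ?thesis using w'D by blast
qed

lemma polys2_subset_closed:
  assumes A: "is_subring A" and c: "\<And>a. a \<in> A \<Longrightarrow> [:[:a:]:] \<in> X" and v: "[:[:0, 1:]:] \<in> X" "[:0, 1:] \<in> X"
    and add: "\<And>p q. p \<in> X \<Longrightarrow> q \<in> X \<Longrightarrow> p + q \<in> X" and mult: "\<And>p q. p \<in> X \<Longrightarrow> q \<in> X \<Longrightarrow> p * q \<in> X"
  shows "polys (polys A) \<subseteq> X"
proof (rule polys_subset_closed[OF is_subring_polys[OF A] _ v(2) add mult])
  have "polys A \<subseteq> {b. [:b:] \<in> X}"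
  proof (rule polys_subset_closed[OF A])
    fix p q assume "p \<in> {b. [:b:] \<in> X}" "q \<in> {b. [:b:] \<in> X}"
    then show "p + q \<in> {b. [:b:] \<in> X}" "p * q \<in> {b. [:b:] \<in> X}"
      using add[of "[:p:]" "[:q:]"] mult[of "[:p:]" "[:q:]"] by (simp_all add: mult.commute)
  qed (use c v in auto)
  then show "a \<in> polys A \<Longrightarrow> [:a:] \<in> X" for a by auto
qed auto

lemma polys3_subset_closed:
  assumes A: "is_subring A" and c: "\<And>a. a \<in> A \<Longrightarrow> [:[:[:a:]:]:] \<in> X"
    and v: "[:[:[:0, 1:]:]:] \<in> X" "[:[:0, 1:]:] \<in> X" "[:0, 1:] \<in> X"
    and add: "\<And>p q. p \<in> X \<Longrightarrow> q \<in> X \<Longrightarrow> p + q \<in> X" and mult: "\<And>p q. p \<in> X \<Longrightarrow> q \<in> X \<Longrightarrow> p * q \<in> X"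
  shows "polys (polys (polys A)) \<subseteq> X"
proof (rule polys2_subset_closed[OF is_subring_polys[OF A] _ v(2,3) add mult])
  have "polys A \<subseteq> {b. [:[:b:]:] \<in> X}"
  proof (rule polys_subset_closed[OF A])
    fix p q assume "p \<in> {b. [:[:b:]:] \<in> X}" "q \<in> {b. [:[:b:]:] \<in> X}"
    then show "p + q \<in> {b. [:[:b:]:] \<in> X}" "p * q \<in> {b. [:[:b:]:] \<in> X}"
      using add[of "[:[:p:]:]" "[:[:q:]:]"] mult[of "[:[:p:]:]" "[:[:q:]:]"] by (simp_all add: mult.commute)
  qed (use c v in auto)
  then show "a \<in> polys A \<Longrightarrow> [:[:a:]:] \<in> X" for a by auto
qed auto

lemma polys4_subset_closed:
  assumes A: "is_subring A" and c: "\<And>a. a \<in> A \<Longrightarrow> [:[:[:[:a:]:]:]:] \<in> X"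
    and v: "[:[:[:[:0, 1:]:]:]:] \<in> X" "[:[:[:0, 1:]:]:] \<in> X" "[:[:0, 1:]:] \<in> X" "[:0, 1:] \<in> X"
    and add: "\<And>p q. p \<in> X \<Longrightarrow> q \<in> X \<Longrightarrow> p + q \<in> X" and mult: "\<And>p q. p \<in> X \<Longrightarrow> q \<in> X \<Longrightarrow> p * q \<in> X"
  shows "polys (polys (polys (polys A))) \<subseteq> X"
proof (rule polys2_subset_closed[OF is_subring_polys[OF is_subring_polys[OF A]] _ v(3,4) add mult])
  have "polys (polys A) \<subseteq> {b. [:[:b:]:] \<in> X}"
  proof (rule polys2_subset_closed[OF A])
    fix p q assume "p \<in> {b. [:[:b:]:] \<in> X}" "q \<in> {b. [:[:b:]:] \<in> X}"
    then show "p + q \<in> {b. [:[:b:]:] \<in> X}" "p * q \<in> {b. [:[:b:]:] \<in> X}"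
      using add[of "[:[:p:]:]" "[:[:q:]:]"] mult[of "[:[:p:]:]" "[:[:q:]:]"] by (simp_all add: mult.commute)
  qed (use c v in auto)
  then show "a \<in> polys (polys A) \<Longrightarrow> [:[:a:]:] \<in> X" for a by auto
qed auto

text \<open>The polynomials that agree modulo \<open>l\<close>, up to a power of \<open>q\<close>, with an element of a subring \<open>S\<close> form a
  subring. If they include a variable missing from \<open>S\<close>, that variable can thus be eliminated from
  every polynomial.\<close>

lemma clear_denominators_closed:
  fixes q l :: "'a::comm_ring_1"
  assumes C: "is_subring C" and S: "is_subring S" and "S \<subseteq> C" "q \<in> S" "l \<in> C"
  defines "X \<equiv> {F \<in> C. \<exists>N. \<exists>G\<in>S. \<exists>w\<in>C. q ^ N * F = G + l * w}"
  shows "S \<subseteq> X" "\<And>F F'. F \<in> X \<Longrightarrow> F' \<in> X \<Longrightarrow> F + F' \<in> X" "\<And>F F'. F \<in> X \<Longrightarrow> F' \<in> X \<Longrightarrow> F * F' \<in> X"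
proof -
  show "S \<subseteq> X"
  proof
    fix F assume "F \<in> S"
    then have "q ^ 0 * F = F + l * 0" "F \<in> C" using assms by auto
    then show "F \<in> X" unfolding X_def using \<open>F \<in> S\<close> is_subringD(2)[OF C] by blast
  qed
  fix F F' assume "F \<in> X" "F' \<in> X"
  then obtain N G w N' G' w' where F: "F \<in> C" "G \<in> S" "w \<in> C" "q ^ N * F = G + l * w"
    and F': "F' \<in> C" "G' \<in> S" "w' \<in> C" "q ^ N' * F' = G' + l * w'" unfolding X_def by blast
  have inC: "q \<in> C" "G \<in> C" "G' \<in> C" using F F' assms by auto
  have "q ^ (N + N') * (F + F') = q ^ N' * (q ^ N * F) + q ^ N * (q ^ N' * F')" by (simp add: power_add algebra_simps)
  also have "\<dots> = (q ^ N' * G + q ^ N * G') + l * (q ^ N' * w + q ^ N * w')" unfolding F(4) F'(4) by (simp add: algebra_simps)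
  finally have 1: "q ^ (N + N') * (F + F') = (q ^ N' * G + q ^ N * G') + l * (q ^ N' * w + q ^ N * w')" .
  moreover have "q ^ N' * G + q ^ N * G' \<in> S" by (intro is_subringD[OF S] assms F F')
  moreover have "q ^ N' * w + q ^ N * w' \<in> C" "F + F' \<in> C" by (intro is_subringD[OF C] inC F F')+
  ultimately show "F + F' \<in> X" unfolding X_def by blast
  have "q ^ (N + N') * (F * F') = (q ^ N * F) * (q ^ N' * F')" by (simp add: power_add algebra_simps)
  also have "\<dots> = G * G' + l * (G * w' + w * G' + l * w * w')" unfolding F(4) F'(4) by (simp add: algebra_simps)
  finally have 1: "q ^ (N + N') * (F * F') = G * G' + l * (G * w' + w * G' + l * w * w')" .
  moreover have "G * G' \<in> S" by (intro is_subringD[OF S] F F')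
  moreover have "G * w' + w * G' + l * w * w' \<in> C" "F * F' \<in> C" by (intro is_subringD[OF C] inC F F' assms)+
  ultimately show "F * F' \<in> X" unfolding X_def by blast
qed

text \<open>Let \<open>q = z\<^sup>d - y\<^sup>m \<eta>\<close>. From \<open>z V = H - y U + E\<close> every \<open>F\<close> becomes free of \<open>V\<close> modulo \<open>E\<close>, up to a power of \<open>z\<close>.
  Then \<open>l = z S - y\<^bsup>m-1\<^esup> \<eta> E = q U + y\<^bsup>m-1\<^esup> \<eta> H\<close> removes \<open>U\<close>, up to a power of \<open>q\<close>; what remains is a polynomial
  in \<open>y\<close> and \<open>z\<close> in the kernel of \<open>\<Psi>\<close>, which vanishes by assumption. The power of \<open>q\<close> is cancelled
  modulo \<open>l\<close>, because \<open>l\<close> is congruent to \<open>y\<^bsup>m-1\<^esup> \<eta> H\<close> modulo \<open>q\<close> and that is a nonzero constant with respect to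
  the monic polynomial \<open>q\<close> in \<open>z\<close>. The power of \<open>z\<close> is cancelled by \<open>X_nonzerodivisor_mod_ideal2\<close>.\<close>

lemma kernel_in_four_variables:
  fixes d m :: nat and A :: "'b::idom set" and \<eta> H :: 'b and \<Psi> :: "'b poly poly poly poly \<Rightarrow> 'r::comm_ring_1"
  defines "\<iota> \<equiv> \<lambda>a :: 'b. [:[:[:[:a:]:]:]:]"
    and "z \<equiv> [:0, 1:] :: 'b poly poly poly poly" and "y \<equiv> [:[:0, 1:]:] :: 'b poly poly poly poly"
    and "U \<equiv> [:[:[:0, 1:]:]:] :: 'b poly poly poly poly" and "V \<equiv> [:[:[:[:0, 1:]:]:]:] :: 'b poly poly poly poly"
    and "C \<equiv> polys (polys (polys (polys A)))"
  defines "E \<equiv> y * U + z * V - \<iota> H" and "S \<equiv> z ^ (d - 1) * U + y ^ (m - 1) * \<iota> \<eta> * V"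
  assumes A: "is_subring A" and mem: "\<eta> \<in> A" "H \<in> A" and nz: "\<eta> \<noteq> 0" "H \<noteq> 0" and d: "2 \<le> d" and m: "1 \<le> m"
    and \<Psi>: "is_hom \<Psi>" "\<Psi> E = 0" "\<Psi> S = 0"
    and inj: "\<And>G. G \<in> polys (polys ((\<lambda>a. [:[:a:]:]) ` A)) \<Longrightarrow> \<Psi> G = 0 \<Longrightarrow> G = 0"
    and F: "F \<in> C" "\<Psi> F = 0"
  shows "F \<in> ideal2 C E S"
proof -
  note \<Psi>h = is_homD[OF \<Psi>(1)]
  have subs: "is_subring (polys A)" "is_subring (polys (polys A))" "is_subring (polys (polys (polys A)))" "is_subring C"
    unfolding C_def by (intro is_subring_polys A)+
  note Ch = is_subringD[OF subs(4)]
  have hom1: "is_hom (\<lambda>a :: 'b. [:a:])" and hom2: "is_hom (\<lambda>a :: 'b. [:[:a:]:])"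
    using is_hom_const_poly is_hom_comp[OF is_hom_const_poly is_hom_const_poly] by auto
  define A1 where "A1 = (\<lambda>a. [:a:]) ` A"
  define A2 where "A2 = (\<lambda>a. [:[:a:]:]) ` A"
  have A1: "is_subring A1" and A2: "is_subring A2"
    unfolding A1_def A2_def by (rule is_subring_image[OF hom1 A], rule is_subring_image[OF hom2 A])
  define S1 where "S1 = polys (polys (polys A1))"
  define S2 where "S2 = polys (polys A2)"
  have subs1: "is_subring (polys A1)" "is_subring (polys (polys A1))" "is_subring S1"
    unfolding S1_def by (intro is_subring_polys A1)+
  have subs2: "is_subring (polys A2)" "is_subring S2"
    unfolding S2_def by (intro is_subring_polys A2)+
  have S1C: "S1 \<subseteq> C"
    unfolding S1_def C_def A1_def by (intro polys_mono) (auto intro: const_in_polys A)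
  have "A2 \<subseteq> polys A1" unfolding A1_def A2_def by (auto intro: const_in_polys A1[unfolded A1_def])
  then have S2S1: "S2 \<subseteq> S1" unfolding S1_def S2_def by (intro polys_mono)
  have inS2: "\<iota> a \<in> S2" if "a \<in> A" for a
    unfolding \<iota>_def S2_def using that by (intro const_in_polys subs2 A2) (simp add: A2_def)
  have zy: "z \<in> S2" "y \<in> S2" unfolding z_def y_def S2_def by (intro const_in_polys X_in_polys subs2 A2)+
  have US1: "U \<in> S1" unfolding U_def S1_def by (intro const_in_polys X_in_polys subs1 A1)
  have VC: "V \<in> C" unfolding V_def C_def by (intro const_in_polys X_in_polys subs A)
  have inC: "\<iota> a \<in> C" if "a \<in> A" for a using inS2[OF that] S2S1 S1C by auto
  have memC: "z \<in> C" "y \<in> C" "U \<in> C" using zy US1 S2S1 S1C by auto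
  have EC: "E \<in> C" and SC: "S \<in> C" unfolding E_def S_def by (intro Ch memC VC inC mem)+
  define q where "q = z ^ d - y ^ m * \<iota> \<eta>"
  define c where "c = y ^ (m - 1) * (\<iota> \<eta> * \<iota> H)"
  define l where "l = q * U + c"
  have zd: "z ^ d = z * z ^ (d - 1)" and ym: "y ^ m = y * y ^ (m - 1)" using d m by (cases d, simp_all, cases m, simp_all)
  have l_eq: "l = z * S - y ^ (m - 1) * \<iota> \<eta> * E"
    unfolding l_def q_def c_def S_def E_def zd ym by (simp add: algebra_simps)
  have qS2: "q \<in> S2" unfolding q_def by (intro is_subringD[OF subs2(2)] zy inS2 mem)
  have cS2: "c \<in> S2" unfolding c_def by (intro is_subringD[OF subs2(2)] zy inS2 mem)
  have lC: "l \<in> C" unfolding l_eq by (intro Ch memC EC SC inC mem)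
  \<comment> \<open>After multiplication by a power of \<open>z\<close>, the variable \<open>V\<close> is eliminated by means of \<open>E\<close>.\<close>
  note X1 = clear_denominators_closed[OF subs(4) subs1(3) S1C _ EC, of z]
  have "C \<subseteq> {F \<in> C. \<exists>N. \<exists>G\<in>S1. \<exists>w\<in>C. z ^ N * F = G + E * w}" (is "_ \<subseteq> ?X1")
    unfolding C_def
  proof (rule polys4_subset_closed[OF A]; fold C_def)
    have zS1: "z \<in> S1" using zy S2S1 by auto
    note X1 = X1[OF zS1]
    show "[:[:[:[:a:]:]:]:] \<in> ?X1" if "a \<in> A" for a
      using inS2[OF that] S2S1 X1(1) unfolding \<iota>_def by blast
    show "[:[:[:0, 1:]:]:] \<in> ?X1" using US1 X1(1) unfolding U_def by blast
    show "[:[:0, 1:]:] \<in> ?X1" using zy(2) S2S1 X1(1) unfolding y_def by blast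
    show "[:0, 1:] \<in> ?X1" using zS1 X1(1) unfolding z_def by blast
    have "z ^ 1 * V = (\<iota> H - y * U) + E * 1" unfolding E_def by (simp add: algebra_simps)
    moreover have "\<iota> H - y * U \<in> S1" using inS2[OF mem(2)] zy US1 S2S1 by (intro is_subringD[OF subs1(3)]) auto
    ultimately have "V \<in> ?X1" using VC Ch(1) by blast
    then show "[:[:[:[:0, 1:]:]:]:] \<in> ?X1" unfolding V_def .
    show "\<And>p q. p \<in> ?X1 \<Longrightarrow> q \<in> ?X1 \<Longrightarrow> p + q \<in> ?X1" by (rule X1(2))
    show "\<And>p q. p \<in> ?X1 \<Longrightarrow> q \<in> ?X1 \<Longrightarrow> p * q \<in> ?X1" by (rule X1(3))
  qed
  then obtain N G w where G: "G \<in> S1" "w \<in> C" "z ^ N * F = G + E * w" using F(1) by blast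
  \<comment> \<open>The variable \<open>U\<close> is eliminated by means of \<open>l\<close>, after multiplication by a power of \<open>q\<close>.\<close>
  have S2C: "S2 \<subseteq> C" using S2S1 S1C by auto
  note X2 = clear_denominators_closed[OF subs(4) subs2(2) S2C qS2 lC]
  have "S1 \<subseteq> {F \<in> C. \<exists>N. \<exists>G\<in>S2. \<exists>w\<in>C. q ^ N * F = G + l * w}" (is "_ \<subseteq> ?X2")
    unfolding S1_def
  proof (rule polys3_subset_closed[OF A1])
    show "[:[:[:a:]:]:] \<in> ?X2" if "a \<in> A1" for a
      using that inS2 X2(1) unfolding A1_def \<iota>_def by blast
    show "[:[:0, 1:]:] \<in> ?X2" using zy(2) X2(1) unfolding y_def by blast
    show "[:0, 1:] \<in> ?X2" using zy(1) X2(1) unfolding z_def by blast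
    have "q ^ 1 * U = - c + l * 1" unfolding l_def by simp
    moreover have "- c \<in> S2" by (intro is_subringD[OF subs2(2)] cS2)
    ultimately have "U \<in> ?X2" using memC(3) Ch(1) by blast
    then show "[:[:[:0, 1:]:]:] \<in> ?X2" unfolding U_def .
    show "\<And>p q. p \<in> ?X2 \<Longrightarrow> q \<in> ?X2 \<Longrightarrow> p + q \<in> ?X2" by (rule X2(2))
    show "\<And>p q. p \<in> ?X2 \<Longrightarrow> q \<in> ?X2 \<Longrightarrow> p * q \<in> ?X2" by (rule X2(3))
  qed
  then obtain J a w1 where a: "a \<in> S2" "w1 \<in> C" "q ^ J * G = a + l * w1" using G(1) by blast
  have "\<Psi> G = \<Psi> (z ^ N * F) - \<Psi> (E * w)" unfolding G(3) \<Psi>h by simp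
  then have \<Psi>G: "\<Psi> G = 0" by (simp add: \<Psi>h F(2) \<Psi>(2))
  have \<Psi>l: "\<Psi> l = 0" unfolding l_eq by (simp add: \<Psi>h \<Psi>)
  have "\<Psi> a = \<Psi> (q ^ J * G) - \<Psi> (l * w1)" unfolding a(3) \<Psi>h by simp
  then have "\<Psi> a = 0" by (simp add: \<Psi>h \<Psi>G \<Psi>l)
  then have "a = 0" using inj a(1) unfolding S2_def A2_def by blast
  then have qJ: "q ^ J * G = l * w1" using a(3) by simp
  \<comment> \<open>From here on \<open>C\<close> is \<open>B[z]\<close>, where \<open>B\<close> is the polynomial ring in the variables other than \<open>z\<close>.\<close>
  define y3 where "y3 = ([:0, 1:] :: 'b poly poly poly)"
  define \<eta>3 where "\<eta>3 = [:[:[:\<eta>:]:]:]"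
  define H3 where "H3 = [:[:[:H:]:]:]"
  define B where "B = polys (polys (polys A))"
  have B: "is_subring B" unfolding B_def by (rule subs(3))
  have CB: "C = polys B" unfolding C_def B_def ..
  have B3: "y3 \<in> B" "\<eta>3 \<in> B" "H3 \<in> B"
    unfolding y3_def \<eta>3_def H3_def B_def by (intro const_in_polys X_in_polys subs A mem)+
  note k = is_homD[OF is_hom_const_poly, symmetric]
  have yc: "y = [:y3:]" "\<iota> \<eta> = [:\<eta>3:]" "\<iota> H = [:H3:]" by (simp_all add: y_def y3_def \<eta>3_def H3_def \<iota>_def)
  have qm: "q = monom 1 d - [:y3 ^ m * \<eta>3:]"
    unfolding q_def yc monom_altdef z_def by (simp only: k(7) k(4) smult_1_left)
  have cm: "c = [:y3 ^ (m - 1) * (\<eta>3 * H3):]"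
    unfolding c_def yc by (simp only: k(7) k(4))
  have c3: "y3 ^ (m - 1) * (\<eta>3 * H3) \<noteq> 0" using nz by (simp add: y3_def \<eta>3_def H3_def)
  have qne: "q \<noteq> 0"
  proof
    assume "q = 0"
    then have "coeff (monom 1 d - [:y3 ^ m * \<eta>3:]) d = 0" unfolding qm by simp
    then show False using d by (simp add: coeff_pCons split: nat.splits)
  qed
  have "\<exists>w'\<in>C. G = l * w'" using qJ a(2)
  proof (induction J arbitrary: w1)
    case 0 then show ?case by auto
  next
    case (Suc J)
    have "q * (q ^ J * G - U * w1) = c * w1" using Suc.prems(1) unfolding l_def by (simp add: algebra_simps)
    then obtain w' where w': "w' \<in> C" "w1 = q * w'"
      using monic_cancel_constant[OF B _ _ _ c3, of "y3 ^ m * \<eta>3" d w1] Suc.prems(2) d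
        is_subringD(4)[OF B is_subringD(7)[OF B B3(1)] B3(2)]
      unfolding CB qm cm by auto
    have "q * (q ^ J * G) = q * (l * w')" using Suc.prems(1) unfolding w'(2) by (simp add: mult_ac)
    then have "q ^ J * G = l * w'" using qne by simp
    then show ?case using Suc.IH w'(1) by blast
  qed
  then obtain w' where w': "w' \<in> C" "G = l * w'" by blast
  have "z ^ N * F = (w - y ^ (m - 1) * \<iota> \<eta> * w') * E + (z * w') * S"
    unfolding G(3) w'(2) l_eq by (simp add: algebra_simps)
  moreover have "w - y ^ (m - 1) * \<iota> \<eta> * w' \<in> C" "z * w' \<in> C" by (intro Ch G w' memC inC mem)+
  ultimately have zN: "z ^ N * F \<in> ideal2 C E S" using ideal2I by metis
  define U3 where "U3 = ([:[:0, 1:]:] :: 'b poly poly poly)"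
  define V3 where "V3 = ([:[:[:0, 1:]:]:] :: 'b poly poly poly)"
  define \<beta> where "\<beta> = y3 * U3 - H3"
  define \<gamma> where "\<gamma> = y3 ^ (m - 1) * (\<eta>3 * V3)"
  have UV: "U = [:U3:]" "V = [:V3:]" by (simp_all add: U_def V_def U3_def V3_def)
  have UV3: "U3 \<in> B" "V3 \<in> B" unfolding U3_def V3_def B_def by (intro const_in_polys X_in_polys subs A)+
  have "\<beta> \<in> B" "\<gamma> \<in> B" unfolding \<beta>_def \<gamma>_def by (intro is_subringD[OF B] B3 UV3)+
  have E_eq: "E = [:\<beta>:] + [:0, 1:] * [:V3:]"
    unfolding E_def yc UV z_def \<beta>_def k(4) k(6) by (simp add: algebra_simps)
  have S_eq: "S = [:0, 1:] ^ (d - 1) * [:U3:] + [:\<gamma>:]"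
    unfolding S_def yc UV z_def \<gamma>_def by (simp only: k(7) k(4) mult.assoc)
  have \<beta>_eq: "\<beta> = [:- [:[:H:]:], [:0, 1:]:]" by (simp add: \<beta>_def y3_def U3_def H3_def)
  have \<gamma>_eq: "\<gamma> = [:0, 1:] ^ (m - 1) * [:[:[:0, \<eta>:]:]:]" by (simp add: \<gamma>_def y3_def \<eta>3_def V3_def)
  have \<beta>0: "\<beta> \<noteq> 0" by (simp add: \<beta>_eq)
  have reg: "\<exists>w'\<in>B. b = \<beta> * w'" if "b \<in> B" "w \<in> B" "\<gamma> * b = \<beta> * w" for b w
    using yU_minus_H_regular[OF A mem nz] that unfolding B_def \<beta>_eq \<gamma>_eq by blast
  have step: "F \<in> ideal2 C E S" if "z * F \<in> ideal2 C E S" for F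
    using that unfolding CB E_eq S_eq z_def
    by (rule X_nonzerodivisor_mod_ideal2[OF B \<open>\<beta> \<in> B\<close> \<open>\<gamma> \<in> B\<close> UV3 \<beta>0 d reg, rotated -1])
  show ?thesis using zN
  proof (induction N)
    case (Suc N) then show ?case using step[of "z ^ N * F"] by (simp add: mult.assoc)
  qed simp
qed

section \<open>Transport along coefficient homomorphisms\<close>

lemma evalp_commute:
  assumes "is_hom \<rho>" "is_hom \<phi>" "is_hom \<gamma>" "is_hom \<psi>" "\<And>c. \<rho> (\<phi> c) = \<psi> (\<gamma> c)"
  shows "\<rho> (evalp \<phi> x p) = evalp \<psi> (\<rho> x) (map_poly \<gamma> p)"
proof (induction p rule: pCons_induct)
  case 0 then show ?case by (simp add: evalp_0 is_homD[OF assms(1)])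
next
  case (pCons a p)
  have "map_poly \<gamma> (pCons a p) = pCons (\<gamma> a) (map_poly \<gamma> p)"
    by (rule map_poly_pCons) (rule is_homD(2)[OF assms(3)])
  then show ?case using pCons.IH
    by (simp add: evalp_pCons[OF assms(2)] evalp_pCons[OF assms(4)] is_homD[OF assms(1)] assms(5))
qed

lemma map_poly_image_polys:
  assumes \<gamma>: "is_hom \<gamma>" and B: "is_subring B" shows "map_poly \<gamma> ` polys B = polys (\<gamma> ` B)"
proof
  show "map_poly \<gamma> ` polys B \<subseteq> polys (\<gamma> ` B)"
    by (auto simp: polys_def coeff_map_poly is_homD(2)[OF \<gamma>])
  show "polys (\<gamma> ` B) \<subseteq> map_poly \<gamma> ` polys B"
  proof
    fix p assume "p \<in> polys (\<gamma> ` B)"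
    then show "p \<in> map_poly \<gamma> ` polys B"
    proof (induction p rule: pCons_induct)
      case 0
      have "map_poly \<gamma> 0 = 0" by simp
      then show ?case using is_subringD(2)[OF is_subring_polys[OF B]] by (metis imageI)
    next
      case (pCons a p)
      then obtain b p' where "b \<in> B" "a = \<gamma> b" "p' \<in> polys B" "p = map_poly \<gamma> p'"
        by (auto simp: pCons_in_polys_iff)
      then have "pCons a p = map_poly \<gamma> (pCons b p')" "pCons b p' \<in> polys B"
        by (simp_all add: map_poly_pCons[where f = \<gamma>, OF is_homD(2)[OF \<gamma>]] pCons_in_polys_iff)
      then show ?case by (metis imageI)
    qed
  qed
qed

lemma map_poly_kernel:
  assumes "is_hom \<gamma>" shows "{p \<in> polys B. map_poly \<gamma> p = 0} \<subseteq> polys {b \<in> B. \<gamma> b = 0}"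
proof
  fix p assume p: "p \<in> {p \<in> polys B. map_poly \<gamma> p = 0}"
  have "\<gamma> (coeff p i) = 0" for i
    using p coeff_map_poly[of \<gamma> p i] is_homD(2)[OF assms] by simp
  then show "p \<in> polys {b \<in> B. \<gamma> b = 0}" using p by (simp add: polys_def)
qed

lemma evalp_in_ideal:
  assumes Q: "is_subring Q" and J: "ideal_in Q J" and "is_hom \<phi>" "x \<in> Q" "\<And>c. c \<in> B \<Longrightarrow> \<phi> c \<in> J" "p \<in> polys B"
  shows "evalp \<phi> x p \<in> J"
  using assms(6)
proof (induction p rule: pCons_induct)
  case 0 then show ?case by (simp add: evalp_0 ideal_inD(2)[OF Q J])
next
  case (pCons a p)
  then show ?case
    unfolding evalp_pCons[OF assms(3)] using assms(4,5) by (intro ideal_inD(3,4)[OF Q J]) (auto simp: pCons_in_polys_iff)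
qed

lemma ideal_in_whole: "is_subring Q \<Longrightarrow> ideal_in Q Q"
  by (auto simp: ideal_in_def is_subringD)

text \<open>Multiplication by the constant polynomial \<open>[:x:]\<close> acts on coefficients, so evaluation at it can be
  computed coefficient by coefficient.\<close>

lemma coeff_evalp_const:
  assumes "is_hom \<phi>"
  shows "coeff (evalp \<phi> [:x:] p) k = poly (map_poly (\<lambda>c. coeff (\<phi> c) k) p) x"
proof (induction p rule: pCons_induct)
  case 0 then show ?case by (simp add: evalp_0)
next
  case (pCons a p)
  have "map_poly (\<lambda>c. coeff (\<phi> c) k) (pCons a p) = pCons (coeff (\<phi> a) k) (map_poly (\<lambda>c. coeff (\<phi> c) k) p)"
    by (rule map_poly_pCons) (simp add: is_homD(2)[OF assms])
  then show ?case using pCons.IH by (simp add: evalp_pCons[OF assms])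
qed

lemma coeff_evalp_linear: "coeff (evalp (\<lambda>c. [:c:]) [:0, q:] p) k = q ^ k * coeff p k"
proof (induction p arbitrary: k rule: pCons_induct)
  case 0 then show ?case by (simp add: evalp_0)
next
  case (pCons a p)
  show ?case
    using pCons.IH[of "k - 1"] by (cases k) (simp_all add: evalp_pCons[OF is_hom_const_poly] mult.assoc)
qed

lemma gradient_ideal_minimal:
  assumes F: "F \<in> mpolyn n" and "ideal_in (mpolyn n) I" "\<And>i. i \<in> {1..n} \<Longrightarrow> partial_deriv i F \<in> I"
  shows "gradient_ideal n F \<subseteq> I"
  unfolding gradient_ideal_def mpoly_ring_eq
  by (rule genideal_ring_on(3)[OF is_subring_mpolyn]) (use assms pd_closed_mpolyn in auto)

lemma sym_ideal_linear:
  assumes A: "is_subring A" and I: "ideal_in A I" and m: "r \<in> A" "s \<in> A" "a \<in> I" "b \<in> I"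
  shows "Const r * Var a + Const s * Var b - Var (r * a + s * b) \<in> sym_ideal A I"
proof -
  let ?K = "sym_ideal A I"
  note K = ideal_inD[OF is_subring_mpolys[OF A] ideal_in_sym_ideal[OF A I]]
  note rel = subsetD[OF sym_relations_in_sym_ideal[OF A I]]
  have ra: "Var (r * a) - Const r * Var a \<in> ?K" and sb: "Var (s * b) - Const s * Var b \<in> ?K"
    using m by (auto intro!: rel simp: sym_relations_def)
  have mm: "r * a \<in> I" "s * b \<in> I" using m by (auto intro: ideal_inD[OF A I])
  then have "Var (r * a + s * b) - Var (r * a) - Var (s * b) \<in> sym_relations A I"
    unfolding sym_relations_def by blast
  then have ab: "Var (r * a + s * b) - Var (r * a) - Var (s * b) \<in> ?K" by (rule rel)
  have "- (Var (r * a + s * b) - Var (r * a) - Var (s * b)) - (Var (r * a) - Const r * Var a) - (Var (s * b) - Const s * Var b) \<in> ?K"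
    by (intro K ra sb ab)
  then show ?thesis by (simp add: algebra_simps)
qed

lemma sym_ideal_Var_0:
  assumes A: "is_subring A" and I: "ideal_in A I" shows "Var 0 \<in> sym_ideal A I"
proof -
  have "Const 0 * Var 0 + Const 0 * Var 0 - Var (0 * 0 + 0 * 0) \<in> sym_ideal A I"
    using is_subringD(2)[OF A] ideal_inD(2)[OF A I] by (intro sym_ideal_linear[OF A I])
  then have "- Var 0 \<in> sym_ideal A I" by (simp add: is_homD[OF is_hom_Const])
  then show ?thesis using ideal_inD(6)[OF is_subring_mpolys[OF A] ideal_in_sym_ideal[OF A I]] by fastforce
qed

section \<open>The gradient ideal of \<open>g h\<close> is of linear type\<close>

context cone_family begin

text \<open>The factor \<open>2\<close> arises from \<open>\<partial>\<^sub>i (g h) = g \<partial>\<^sub>i h + h \<partial>\<^sub>i g = (z\<^sup>d - 2 y\<^sup>m h) \<partial>\<^sub>i h\<close>. Up to nonzero constants, \<open>u0\<close> and \<open>v0\<close>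
  are the derivatives of \<open>g h\<close> along \<open>y\<close> and \<open>z\<close>.\<close>

abbreviation (input) "\<eta> \<equiv> of_nat 2 * h"
definition q where "q = z ^ d - y ^ m * \<eta>"
definition u0 where "u0 = - (y ^ (m - 1) * \<eta> * h)"
definition v0 where "v0 = z ^ (d - 1) * h"
abbreviation "S \<equiv> mpolyn (n - 2) :: (nat, 'k) mpoly set"
abbreviation "R \<equiv> mpolyn n :: (nat, 'k) mpoly set"
abbreviation "Jh \<equiv> gradient_ideal (n - 2) h"
abbreviation "Jf \<equiv> gradient_ideal n (g * h)"

lemmas idealJh = ideal_in_gradient[OF hS] and idealJf = ideal_in_gradient[OF ghR]
lemmas Rs = is_subringD[OF is_subring_mpolyn]
lemmas Jf = ideal_inD[OF is_subring_mpolyn idealJf]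

lemma S_subset_R: "S \<subseteq> R" by (rule mpolyn_mono) simp

lemma pd_gh: "partial_deriv n (g * h) = of_nat d * v0"
  "partial_deriv (n - 1) (g * h) = - (of_nat m * y ^ (m - 1) * h * h)"
  "i \<le> n - 2 \<Longrightarrow> partial_deriv i (g * h) = q * partial_deriv i h"
proof -
  have lt: "n - 2 < n - 1" "n - 2 < n" using n3 by auto
  show "partial_deriv n (g * h) = of_nat d * v0"
    unfolding pd_mult pd_g(1) pd_h_zero[OF lt(2)] v0_def by (simp add: mult_ac)
  show "partial_deriv (n - 1) (g * h) = - (of_nat m * y ^ (m - 1) * h * h)"
    unfolding pd_mult pd_g(2) pd_h_zero[OF lt(1)] by simp
  show "partial_deriv i (g * h) = q * partial_deriv i h" if "i \<le> n - 2"
    unfolding pd_mult pd_g(3)[OF that] unfolding q_def g_def by (simp add: algebra_simps)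
qed

lemma q_nonzero: "q \<noteq> 0"
proof -
  have "coeff (univ_in n q) 0 = - (y ^ m * \<eta>)"
    unfolding q_def is_homD(3-8)[OF univ_coeff_0_hom] univ_z using md by (simp add: power_0_left)
  moreover have "y ^ m * \<eta> \<noteq> 0" using y_nonzero h_nonzero by simp
  ultimately show ?thesis by (auto simp: is_homD[OF is_hom_univ])
qed

lemma q_mult_Jh: "a \<in> Jh \<Longrightarrow> q * a \<in> Jf"
proof -
  assume "a \<in> Jh"
  then obtain r where r: "\<And>i. r i \<in> S" "a = (\<Sum>i\<in>{1..n-2}. r i * partial_deriv i h)"
    unfolding gradient_ideal_iff[OF hS] by blast
  have "q * a = (\<Sum>i\<in>{1..n-2}. r i * partial_deriv i (g * h))"
    unfolding r(2) sum_distrib_left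
  proof (intro sum.cong refl)
    fix i assume "i \<in> {1..n-2}"
    then have "i \<le> n - 2" by simp
    show "q * (r i * partial_deriv i h) = r i * partial_deriv i (g * h)"
      unfolding pd_gh(3)[OF \<open>i \<le> n - 2\<close>] by (rule mult.left_commute)
  qed
  also have "\<dots> \<in> Jf"
    using r(1) S_subset_R by (intro ideal_in_sum[OF idealJf] Jf(4) pd_in_gradient_ideal[OF ghR]) auto
  finally show ?thesis .
qed

lemma v0_in_Jf: "v0 \<in> Jf"
proof -
  have "Const (inverse (of_nat d)) * (Const (of_nat d) * v0) \<in> Jf"
    unfolding of_nat_mpoly[of d, symmetric] pd_gh(1)[symmetric]
    using n3 by (intro Jf(4) pd_in_gradient_ideal[OF ghR] Const_in_mpolyn) auto
  then show ?thesis using md by (simp only: Const_inverse of_nat_eq_0_iff)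
qed

lemma u0_eq: "u0 = Const (2 * inverse (of_nat m)) * partial_deriv (n - 1) (g * h)"
proof -
  have "Const (2 * inverse (of_nat m)) * partial_deriv (n - 1) (g * h) =
     - (of_nat 2 * (Const (inverse (of_nat m)) * (Const (of_nat m) * (y ^ (m - 1) * h * h))))"
    unfolding pd_gh(2) of_nat_mpoly[of 2] of_nat_mpoly[of m] is_homD(4)[OF is_hom_Const] by (simp add: mult_ac)
  also have "Const (inverse (of_nat m)) * (Const (of_nat m) * (y ^ (m - 1) * h * h)) = y ^ (m - 1) * h * h"
    using m1 by (intro Const_inverse) simp
  also have "- (of_nat 2 * (y ^ (m - 1) * h * h)) = u0" unfolding u0_def by (simp add: mult_ac)
  finally show ?thesis ..
qed

lemma pd_y_gh: "partial_deriv (n - 1) (g * h) = Const (of_nat m * inverse 2) * u0"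
proof -
  have "Const (of_nat m * inverse 2) * u0 = Const ((of_nat m * inverse 2) * (2 * inverse (of_nat m))) * partial_deriv (n - 1) (g * h)"
    unfolding u0_eq is_homD(4)[OF is_hom_Const] by (simp only: mult.assoc)
  also have "(of_nat m * inverse 2) * (2 * inverse (of_nat m)) = (1 :: 'k)" using m1 by simp
  finally show ?thesis by (simp add: is_homD[OF is_hom_Const])
qed

lemma u0_in_Jf: "u0 \<in> Jf"
  unfolding u0_eq using n3 by (intro Jf(4) pd_in_gradient_ideal[OF ghR] Const_in_mpolyn) auto

lemma u0_v0_relations: "y * u0 + z * v0 = q * h" "z ^ (d - 1) * u0 + (y ^ (m - 1) * \<eta>) * v0 = 0"
  unfolding u0_def v0_def q_def zd ym by (simp_all add: algebra_simps)

lemma h_in_Jh: "h \<in> Jh"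
proof -
  have "Const (of_nat (d - m)) * h \<in> Jh"
    unfolding of_nat_mpoly[symmetric] euler_h[symmetric]
    by (intro ideal_in_sum[OF idealJh] ideal_inD(4)[OF is_subring_mpolyn idealJh] pd_in_gradient_ideal[OF hS] Var_in_mpolyn) auto
  then have "Const (inverse (of_nat (d - m))) * (Const (of_nat (d - m)) * h) \<in> Jh"
    by (rule ideal_inD(4)[OF is_subring_mpolyn idealJh Const_in_mpolyn])
  then show ?thesis using md by (simp only: Const_inverse of_nat_eq_0_iff)
qed

text \<open>The inclusion \<open>q J\<^sub>h \<subseteq> J\<^sub>f\<close> induces \<open>T\<^sub>a \<mapsto> T\<^bsub>qa\<^esub>\<close> on symmetric algebras. Adjoining four variables \<open>V, U, y, z\<close>, from the
  innermost to the outermost, gives \<open>\<Phi>\<close>, of which \<open>\<Psi>\<close> is the shadow on Rees algebras; \<open>\<Gamma>\<close> relates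
  their sources, and \<open>rees_eval \<circ> \<Phi> = \<Psi> \<circ> \<Gamma>\<close>.\<close>

definition rescale :: "((nat, 'k) mpoly, (nat, 'k) mpoly) mpoly \<Rightarrow> ((nat, 'k) mpoly, (nat, 'k) mpoly) mpoly" where
  "rescale = evalm Const (\<lambda>a. Var (q * a))"

definition \<Phi> where
  "\<Phi> = evalp (evalp (evalp (evalp rescale (Var v0)) (Var u0)) (Const y)) (Const z)"

definition \<pi> :: "(nat, 'k) mpoly poly \<Rightarrow> (nat, 'k) mpoly poly" where "\<pi> = evalp (\<lambda>c. [:c:]) [:0, q:]"

definition \<Psi> where
  "\<Psi> = evalp (evalp (evalp (evalp \<pi> [:0, v0:]) [:0, u0:]) [:y:]) [:z:]"

definition \<Gamma> where
  "\<Gamma> = map_poly (map_poly (map_poly (map_poly (rees_eval :: ((nat, 'k) mpoly, (nat, 'k) mpoly) mpoly \<Rightarrow> _))))"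

lemma homs: "is_hom rescale" "is_hom \<Phi>" "is_hom \<pi>" "is_hom \<Psi>" "is_hom \<Gamma>"
  unfolding rescale_def \<Phi>_def \<pi>_def \<Psi>_def \<Gamma>_def
  by (intro is_hom_evalp is_hom_evalm is_hom_Const is_hom_const_poly is_hom_map_poly is_hom_rees_eval)+

lemma rees_eval_rescale: "rees_eval (rescale p) = \<pi> (rees_eval p)"
proof (rule hom_eq_on_mpolys[of UNIV "\<lambda>p. rees_eval (rescale p)" "\<lambda>p. \<pi> (rees_eval p)" UNIV])
  show "is_hom (\<lambda>p. rees_eval (rescale p))" "is_hom (\<lambda>p. \<pi> (rees_eval p))"
    by (rule is_hom_comp[OF is_hom_rees_eval homs(1)], rule is_hom_comp[OF homs(3) is_hom_rees_eval])
  show "rees_eval (rescale (Const a)) = \<pi> (rees_eval (Const a))" for a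
    by (simp add: rescale_def evalm_Const[OF is_hom_Const] rees_eval_Const \<pi>_def evalp_pCons[OF is_hom_const_poly] evalp_0)
  show "rees_eval (rescale (Var a)) = \<pi> (rees_eval (Var a))" for a
    by (simp add: rescale_def evalm_Var[OF is_hom_Const] rees_eval_Var \<pi>_def evalp_pCons[OF is_hom_const_poly] evalp_0 mult.commute)
qed auto

lemma rees_eval_\<Phi>: "rees_eval (\<Phi> s) = \<Psi> (\<Gamma> s)"
proof -
  note ih = is_hom_evalp homs(1,3) is_hom_map_poly is_hom_rees_eval
  have 1: "rees_eval (evalp rescale (Var v0) p) = evalp \<pi> [:0, v0:] (map_poly rees_eval p)" for p
    using evalp_commute[OF is_hom_rees_eval homs(1) is_hom_rees_eval homs(3) rees_eval_rescale, of "Var v0"]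
    by (simp add: rees_eval_Var)
  have 2: "rees_eval (evalp (evalp rescale (Var v0)) (Var u0) p) =
     evalp (evalp \<pi> [:0, v0:]) [:0, u0:] (map_poly (map_poly rees_eval) p)" for p
    using evalp_commute[where \<rho> = rees_eval and \<phi> = "evalp rescale (Var v0)" and \<psi> = "evalp \<pi> [:0, v0:]"
        and \<gamma> = "map_poly rees_eval", OF _ _ _ _ 1, of "Var u0" p]
    by (simp add: ih rees_eval_Var)
  have 3: "rees_eval (evalp (evalp (evalp rescale (Var v0)) (Var u0)) (Const y) p) =
     evalp (evalp (evalp \<pi> [:0, v0:]) [:0, u0:]) [:y:] (map_poly (map_poly (map_poly rees_eval)) p)" for p
    using evalp_commute[where \<rho> = rees_eval and \<phi> = "evalp (evalp rescale (Var v0)) (Var u0)"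
        and \<psi> = "evalp (evalp \<pi> [:0, v0:]) [:0, u0:]" and \<gamma> = "map_poly (map_poly rees_eval)", OF _ _ _ _ 2, of "Const y" p]
    by (simp add: ih rees_eval_Const)
  show ?thesis unfolding \<Phi>_def \<Psi>_def \<Gamma>_def
    using evalp_commute[where \<rho> = rees_eval and \<phi> = "evalp (evalp (evalp rescale (Var v0)) (Var u0)) (Const y)"
        and \<psi> = "evalp (evalp (evalp \<pi> [:0, v0:]) [:0, u0:]) [:y:]" and \<gamma> = "map_poly (map_poly (map_poly rees_eval))", OF _ _ _ _ 3, of "Const z" s]
    by (simp add: ih rees_eval_Const)
qed

text \<open>On polynomials in \<open>y\<close> and \<open>z\<close> alone, \<open>\<Psi>\<close> substitutes \<open>q t\<close> for \<open>t\<close>, which multiplies the coefficient of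
  \<open>t\<^sup>k\<close> by \<open>q\<^sup>k \<noteq> 0\<close>, and the variables \<open>y\<close> and \<open>z\<close>, which are algebraically independent over \<open>S\<close>.\<close>

lemma \<Psi>_injective:
  assumes A: "A \<subseteq> polys S" and G: "G \<in> polys (polys ((\<lambda>a. [:[:a:]:]) ` A))" and 0: "\<Psi> G = 0"
  shows "G = 0"
proof -
  define f2 where "f2 = evalp (evalp \<pi> [:0, v0:]) [:0, u0:]"
  define f3 where "f3 = evalp f2 [:y:]"
  have f2: "is_hom f2" and f3: "is_hom f3" unfolding f3_def f2_def by (intro is_hom_evalp homs)+
  have f2c: "f2 [:[:a:]:] = \<pi> a" for a
    unfolding f2_def by (simp add: evalp_pCons evalp_0 is_hom_evalp homs)
  \<comment> \<open>\<open>Q k\<close> collects the coefficients of \<open>t\<^sup>k\<close> as a polynomial in \<open>y\<close>, and \<open>P k\<close> as one in \<open>z\<close>.\<close>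
  define Q where "Q = (\<lambda>k. map_poly (\<lambda>c :: (nat, 'k) mpoly poly poly poly. coeff (coeff (coeff c 0) 0) k))"
  define P where "P = (\<lambda>k. map_poly (\<lambda>c. poly (Q k c) y))"
  have Qc: "coeff (Q k g) i = coeff (coeff (coeff (coeff g i) 0) 0) k" for k g i
    unfolding Q_def by (simp add: coeff_map_poly)
  have QS: "Q k g \<in> polys S" if "g \<in> polys ((\<lambda>a. [:[:a:]:]) ` A)" for g k
  proof -
    have "coeff (coeff (coeff (coeff g i) 0) 0) k \<in> S" for i
    proof -
      have "coeff g i \<in> (\<lambda>a. [:[:a:]:]) ` A" using that by (simp add: polys_def)
      then show ?thesis using A by (auto simp: polys_def)
    qed
    then show ?thesis by (simp add: polys_def Qc)
  qed
  have f3k: "coeff (f3 g) k = q ^ k * poly (Q k g) y" if g: "g \<in> polys ((\<lambda>a. [:[:a:]:]) ` A)" for g k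
  proof -
    have "map_poly (\<lambda>c. coeff (f2 c) k) g = Polynomial.smult (q ^ k) (Q k g)"
    proof (rule poly_eqI)
      fix i
      have "coeff g i \<in> (\<lambda>a. [:[:a:]:]) ` A" using g by (simp add: polys_def)
      then obtain a where a: "coeff g i = [:[:a:]:]" by auto
      have "coeff (map_poly (\<lambda>c. coeff (f2 c) k) g) i = coeff (f2 (coeff g i)) k"
        by (rule coeff_map_poly) (simp add: is_homD(2)[OF f2])
      also have "\<dots> = q ^ k * coeff a k" unfolding a f2c \<pi>_def by (rule coeff_evalp_linear)
      finally show "coeff (map_poly (\<lambda>c. coeff (f2 c) k) g) i = coeff (Polynomial.smult (q ^ k) (Q k g)) i"
        by (simp add: Qc a)
    qed
    then show ?thesis unfolding f3_def coeff_evalp_const[OF f2] by simp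
  qed
  have Pc: "coeff (P k G) j = poly (Q k (coeff G j)) y" for k j
    unfolding P_def by (rule coeff_map_poly) (simp add: Q_def)
  have Gj: "coeff G j \<in> polys ((\<lambda>a. [:[:a:]:]) ` A)" for j using G by (rule coeff_polys)
  have PG: "P k G = 0" for k
  proof -
    have "map_poly (\<lambda>c. coeff (f3 c) k) G = Polynomial.smult (q ^ k) (P k G)"
    proof (rule poly_eqI)
      fix j
      have "coeff (map_poly (\<lambda>c. coeff (f3 c) k) G) j = coeff (f3 (coeff G j)) k"
        by (rule coeff_map_poly) (simp add: is_homD(2)[OF f3])
      then show "coeff (map_poly (\<lambda>c. coeff (f3 c) k) G) j = coeff (Polynomial.smult (q ^ k) (P k G)) j"
        by (simp add: f3k[OF Gj] Pc)
    qed
    then have "coeff (\<Psi> G) k = q ^ k * poly (P k G) z"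
      unfolding \<Psi>_def f2_def[symmetric] f3_def[symmetric] coeff_evalp_const[OF f3] by simp
    then have "poly (P k G) z = 0" using 0 q_nonzero by simp
    moreover have "P k G \<in> polys (mpolys UNIV {1..n-1})"
    proof -
      have "poly (Q k (coeff G j)) y \<in> mpolys UNIV {1..n-1}" for j
      proof (rule poly_in_mpolys)
        have "S \<subseteq> mpolys UNIV {1..n-1}" unfolding mpolyn_def by (rule mpolys_mono) auto
        then show "Q k (coeff G j) \<in> polys (mpolys UNIV {1..n-1})" using QS[OF Gj] polys_mono by blast
        show "n - 1 \<in> {1..n-1}" using n3 by auto
      qed
      then show ?thesis by (simp add: polys_def Pc)
    qed
    moreover have "n \<notin> {1..n-1}" using n3 by auto
    ultimately show ?thesis using univ_poly[of "P k G" "{1..n-1}" n] by (simp add: is_homD[OF is_hom_univ])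
  qed
  have QG: "Q k (coeff G j) = 0" for k j
  proof -
    have "poly (Q k (coeff G j)) y = 0" using PG[of k] Pc[of k j] by simp
    moreover have "n - 1 \<notin> {1..n-2}" using n3 by auto
    ultimately show ?thesis
      using univ_poly[of "Q k (coeff G j)" "{1..n-2}" "n - 1"] QS[OF Gj, unfolded mpolyn_def] by (simp add: is_homD[OF is_hom_univ])
  qed
  have Gji: "coeff (coeff G j) i = 0" for j i
  proof -
    have "coeff (coeff G j) i \<in> (\<lambda>a. [:[:a:]:]) ` A" using Gj by (rule coeff_polys)
    then obtain a where a: "coeff (coeff G j) i = [:[:a:]:]" by auto
    have "a = 0"
    proof (rule poly_eqI)
      fix k show "coeff a k = coeff 0 k" using Qc[of k "coeff G j" i] by (simp add: QG a)
    qed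
    then show ?thesis by (simp add: a)
  qed
  have "coeff G j = 0" for j by (rule poly_eqI) (simp add: Gji)
  then show "G = 0" by (intro poly_eqI) simp
qed


abbreviation "Ph \<equiv> mpolys S Jh"
abbreviation "Pf \<equiv> mpolys R Jf"
abbreviation "Kh \<equiv> sym_ideal S Jh"
abbreviation "Kf \<equiv> sym_ideal R Jf"
abbreviation "Cs \<equiv> polys (polys (polys (polys Ph)))"

lemmas Ph_subring = is_subring_mpolys[OF is_subring_mpolyn]
lemmas Kf_ideal = ideal_in_sym_ideal[OF is_subring_mpolyn idealJf]
lemmas Kf = ideal_inD[OF Ph_subring Kf_ideal]
lemmas Pf = is_subringD[OF Ph_subring[of n Jf]]

lemma \<Phi>_generators:
  "\<Phi> [:[:[:[:p:]:]:]:] = rescale p" "\<Phi> [:[:[:[:0, 1:]:]:]:] = Var v0" "\<Phi> [:[:[:0, 1:]:]:] = Var u0"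
  "\<Phi> [:[:0, 1:]:] = Const y" "\<Phi> [:0, 1:] = Const z"
  unfolding \<Phi>_def
  by (simp_all add: evalp_pCons evalp_0 is_hom_evalp homs is_homD[OF homs(1)] is_homD[OF is_hom_evalp[OF homs(1)]]
      is_homD[OF is_hom_evalp[OF is_hom_evalp[OF homs(1)]]] is_homD[OF is_hom_evalp[OF is_hom_evalp[OF is_hom_evalp[OF homs(1)]]]])

lemma \<Psi>_generators:
  "\<Psi> [:[:[:[:p:]:]:]:] = \<pi> p" "\<Psi> [:[:[:[:0, 1:]:]:]:] = [:0, v0:]" "\<Psi> [:[:[:0, 1:]:]:] = [:0, u0:]"
  "\<Psi> [:[:0, 1:]:] = [:y:]" "\<Psi> [:0, 1:] = [:z:]"
  unfolding \<Psi>_def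
  by (simp_all add: evalp_pCons evalp_0 is_hom_evalp homs is_homD[OF homs(3)] is_homD[OF is_hom_evalp[OF homs(3)]]
      is_homD[OF is_hom_evalp[OF is_hom_evalp[OF homs(3)]]] is_homD[OF is_hom_evalp[OF is_hom_evalp[OF is_hom_evalp[OF homs(3)]]]])

lemma rees_eval_0_1: "rees_eval 0 = 0" "rees_eval 1 = 1"
  by (simp_all add: is_homD[OF is_hom_rees_eval])

lemma \<Gamma>_generators:
  "\<Gamma> [:[:[:[:p:]:]:]:] = [:[:[:[:rees_eval p:]:]:]:]" "\<Gamma> [:[:[:[:0, 1:]:]:]:] = [:[:[:[:0, 1:]:]:]:]"
  "\<Gamma> [:[:[:0, 1:]:]:] = [:[:[:0, 1:]:]:]" "\<Gamma> [:[:0, 1:]:] = [:[:0, 1:]:]" "\<Gamma> [:0, 1:] = [:0, 1:]"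
  unfolding \<Gamma>_def by (simp_all add: map_poly_pCons rees_eval_0_1)

lemma rescale_generators: "rescale (Const c) = Const c" "rescale (Var a) = Var (q * a)"
  unfolding rescale_def by (simp_all add: evalm_Const evalm_Var is_hom_Const)

lemma rescale_closed: "p \<in> Ph \<Longrightarrow> rescale p \<in> Pf"
proof -
  have "Ph \<subseteq> {p. rescale p \<in> Pf}"
    using S_subset_R q_mult_Jh
    by (intro mpolys_subset_closed is_subring_mpolyn)
      (auto simp: rescale_generators is_homD[OF homs(1)] intro!: Pf Const_in_mpolys[OF is_subring_mpolyn] Var_in_mpolys[OF is_subring_mpolyn])
  then show "p \<in> Ph \<Longrightarrow> rescale p \<in> Pf" by auto
qed

lemma rescale_sym_ideal: "p \<in> Kh \<Longrightarrow> rescale p \<in> Kf"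
proof -
  note rel = subsetD[OF sym_relations_in_sym_ideal[OF is_subring_mpolyn idealJf]]
  note r = is_homD[OF homs(1)]
  have "ideal_in Ph {p \<in> Ph. rescale p \<in> Kf}"
    unfolding ideal_in_def using rescale_closed
    by (auto simp: r intro: is_subringD[OF Ph_subring] Kf)
  moreover have "sym_relations S Jh \<subseteq> {p \<in> Ph. rescale p \<in> Kf}"
  proof
    fix p assume p: "p \<in> sym_relations S Jh"
    have "rescale p \<in> sym_relations R Jf"
    proof -
      consider a b where "a \<in> Jh" "b \<in> Jh" "p = Var (a + b) - Var a - Var b"
        | s a where "s \<in> S" "a \<in> Jh" "p = Var (s * a) - Const s * Var a"
        using p unfolding sym_relations_def by blast
      then show ?thesis
      proof cases
        case 1
        have "rescale p = Var (q * a + q * b) - Var (q * a) - Var (q * b)"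
          unfolding 1(3) r rescale_generators distrib_left by (rule refl)
        then show ?thesis using q_mult_Jh[OF 1(1)] q_mult_Jh[OF 1(2)] unfolding sym_relations_def by blast
      next
        case 2
        have "rescale p = Var (s * (q * a)) - Const s * Var (q * a)"
          unfolding 2(3) r rescale_generators mult.left_commute[of q s a] by (rule refl)
        then show ?thesis using q_mult_Jh[OF 2(2)] 2(1) S_subset_R unfolding sym_relations_def by blast
      qed
    qed
    then show "p \<in> {p \<in> Ph. rescale p \<in> Kf}"
      using rel p sym_relations_subset[OF is_subring_mpolyn idealJh] by blast
  qed
  ultimately show "p \<in> Kh \<Longrightarrow> rescale p \<in> Kf"
    using sym_ideal_subset[OF is_subring_mpolyn idealJh] by blast
qed

lemma \<Phi>_maps:
  assumes J: "ideal_in Pf J" and "\<And>c. c \<in> B \<Longrightarrow> rescale c \<in> J" "s \<in> polys (polys (polys (polys B)))"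
  shows "\<Phi> s \<in> J"
proof -
  have v: "Var v0 \<in> Pf" "Var u0 \<in> Pf" "Const y \<in> Pf" "Const z \<in> Pf"
    using v0_in_Jf u0_in_Jf yR zR by (auto intro!: Var_in_mpolys Const_in_mpolys is_subring_mpolyn)
  show ?thesis unfolding \<Phi>_def using assms(3)
    by (intro evalp_in_ideal[OF Ph_subring J, rotated 3] v is_hom_evalp homs; (assumption | intro evalp_in_ideal[OF Ph_subring J, rotated 3] v is_hom_evalp homs assms(2))?)
qed

lemma \<Phi>_closed: "s \<in> Cs \<Longrightarrow> \<Phi> s \<in> Pf"
  by (rule \<Phi>_maps[OF ideal_in_whole[OF Ph_subring]]) (rule rescale_closed)

lemma Cs_subring: "is_subring Cs"
  by (intro is_subring_polys Ph_subring)

lemma Cs_generators: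
  "p \<in> Ph \<Longrightarrow> [:[:[:[:p:]:]:]:] \<in> Cs" "[:[:[:[:0, 1:]:]:]:] \<in> Cs" "[:[:[:0, 1:]:]:] \<in> Cs" "[:[:0, 1:]:] \<in> Cs" "[:0, 1:] \<in> Cs"
  by (intro const_in_polys X_in_polys is_subring_polys Ph_subring; assumption)+

text \<open>The elements \<open>a\<close> of \<open>J\<^sub>f\<close> for which \<open>T\<^sub>a\<close> is hit form an ideal, by the linear relations. So it suffices to
  hit the partial derivatives of \<open>g h\<close>.\<close>

lemma \<Phi>_surjective_mod_relations: "p \<in> Pf \<Longrightarrow> \<exists>s\<in>Cs. p - \<Phi> s \<in> Kf"
proof -
  note Cs = is_subringD[OF Cs_subring]
  note \<Phi>h = is_homD[OF homs(2)]
  define X where "X = {p \<in> Pf. \<exists>s\<in>Cs. p - \<Phi> s \<in> Kf}"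
  have XI: "p \<in> X" if "s \<in> Cs" "p = \<Phi> s" for p s
  proof -
    have "p - \<Phi> s \<in> Kf" using that Kf(2) by simp
    then show ?thesis unfolding X_def using that \<Phi>_closed by blast
  qed
  have add: "p + p' \<in> X" and mult: "p * p' \<in> X" if pp: "p \<in> X" "p' \<in> X" for p p'
  proof -
    obtain s s' where s: "p \<in> Pf" "s \<in> Cs" "p - \<Phi> s \<in> Kf" "p' \<in> Pf" "s' \<in> Cs" "p' - \<Phi> s' \<in> Kf"
      using pp unfolding X_def by blast
    have "(p - \<Phi> s) + (p' - \<Phi> s') \<in> Kf" by (intro Kf s)
    then have "p + p' - \<Phi> (s + s') \<in> Kf" by (simp add: \<Phi>h algebra_simps)
    then show "p + p' \<in> X" unfolding X_def using Cs(3)[OF s(2,5)] Pf(3)[OF s(1,4)] by blast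
    have "(p - \<Phi> s) * p' + \<Phi> s * (p' - \<Phi> s') \<in> Kf" by (intro Kf s \<Phi>_closed)
    then have "p * p' - \<Phi> (s * s') \<in> Kf" by (simp add: \<Phi>h algebra_simps)
    then show "p * p' \<in> X" unfolding X_def using Cs(4)[OF s(2,5)] Pf(4)[OF s(1,4)] by blast
  qed
  have ConstX: "Const r \<in> X" if "r \<in> R" for r
  proof -
    have "mpolys UNIV {1..n} \<subseteq> {r. Const r \<in> X}"
    proof (rule mpolys_subset_closed)
      have inPh: "Const r \<in> Ph" if "r \<in> S" for r using that by (intro Const_in_mpolys is_subring_mpolyn)
      show "Const c \<in> {r. Const r \<in> X}" for c
        using XI[OF Cs_generators(1)[OF inPh[OF Const_in_mpolyn[of c]]]] by (simp add: \<Phi>_generators rescale_generators)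
      show "Var i \<in> {r. Const r \<in> X}" if i: "i \<in> {1..n}" for i
      proof -
        consider "i \<in> {1..n-2}" | "i = n - 1" | "i = n" using i by fastforce
        then show ?thesis
        proof cases
          case 1
          then have "Const (Var i) \<in> Ph" by (intro inPh Var_in_mpolyn) auto
          from XI[OF Cs_generators(1)[OF this]] show ?thesis by (simp add: \<Phi>_generators rescale_generators)
        next
          case 2
          from XI[OF Cs_generators(4)] show ?thesis unfolding 2 by (simp only: \<Phi>_generators mem_Collect_eq)
        next
          case 3
          from XI[OF Cs_generators(5)] show ?thesis unfolding 3 by (simp only: \<Phi>_generators mem_Collect_eq)
        qed
      qed
    qed (auto simp: is_homD[OF is_hom_Const] intro: add mult)
    then show ?thesis using that unfolding mpolyn_def by blast
  qed
  define M where "M = {a \<in> Jf. Var a \<in> X}"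
  have mod: "p \<in> X" if p': "p' \<in> X" and pp': "p - p' \<in> Kf" for p p'
  proof -
    obtain s where s: "p' \<in> Pf" "s \<in> Cs" "p' - \<Phi> s \<in> Kf" using p' unfolding X_def by blast
    have "(p - p') + (p' - \<Phi> s) \<in> Kf" by (intro Kf pp' s)
    moreover have "(p - p') + p' \<in> Pf" using subsetD[OF Kf(1) pp'] s(1) by (rule Pf(3))
    ultimately have "p - \<Phi> s \<in> Kf" "p \<in> Pf" by simp_all
    then show ?thesis unfolding X_def using s(2) by blast
  qed
  have comb: "r * a + s * b \<in> M" if "r \<in> R" "s \<in> R" "a \<in> M" "b \<in> M" for r s a b
  proof -
    have ab: "a \<in> Jf" "b \<in> Jf" "Var a \<in> X" "Var b \<in> X" using that by (auto simp: M_def)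
    have "- (Const r * Var a + Const s * Var b - Var (r * a + s * b)) \<in> Kf"
      by (intro Kf sym_ideal_linear is_subring_mpolyn idealJf that ab)
    then have "Var (r * a + s * b) \<in> X"
      using mod[of "Const r * Var a + Const s * Var b"] ab ConstX that by (simp add: add mult)
    moreover have "r * a + s * b \<in> Jf" by (intro Jf that ab)
    ultimately show ?thesis by (simp add: M_def)
  qed
  have 0: "0 \<in> M"
  proof -
    have "0 \<in> X" using XI[OF Cs(2)] by (simp add: \<Phi>h)
    then have "Var 0 \<in> X" using mod[of 0 "Var 0"] sym_ideal_Var_0[OF is_subring_mpolyn idealJf] by simp
    then show ?thesis using Jf(2) by (simp add: M_def)
  qed
  have "ideal_in R M" unfolding ideal_in_def
  proof (intro conjI ballI)
    show "M \<subseteq> R" using Jf(1) by (auto simp: M_def)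
    show "a + b \<in> M" if "a \<in> M" "b \<in> M" for a b using comb[OF Rs(1) Rs(1) that] by simp
    show "r * a \<in> M" if "r \<in> R" "a \<in> M" for r a using comb[OF that(1) Rs(2) that(2) 0] by simp
  qed (rule 0)
  moreover have "partial_deriv i (g * h) \<in> M" if i: "i \<in> {1..n}" for i
  proof -
    consider "i \<in> {1..n-2}" | "i = n - 1" | "i = n" using i by fastforce
    then show ?thesis
    proof cases
      case 1
      then have "Var (partial_deriv i h) \<in> Ph" by (intro Var_in_mpolys is_subring_mpolyn pd_in_gradient_ideal hS)
      from XI[OF Cs_generators(1)[OF this]] have "Var (q * partial_deriv i h) \<in> X" by (simp add: \<Phi>_generators rescale_generators)
      then show ?thesis using pd_in_gradient_ideal[OF ghR i] pd_gh(3)[of i] 1 by (simp add: M_def)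
    next
      case 2
      have "u0 \<in> M" using XI[OF Cs_generators(3)] u0_in_Jf by (simp add: \<Phi>_generators M_def)
      then show ?thesis unfolding 2 pd_y_gh using comb[OF Const_in_mpolyn Rs(2) _ 0, of u0 "of_nat m * inverse 2"] by simp
    next
      case 3
      have "v0 \<in> M" using XI[OF Cs_generators(2)] v0_in_Jf by (simp add: \<Phi>_generators M_def)
      then show ?thesis unfolding 3 pd_gh(1) using comb[OF Rs(8) Rs(2) _ 0, of v0 d] by simp
    qed
  qed
  ultimately have "Jf \<subseteq> M" by (rule gradient_ideal_minimal[OF ghR])
  then have "Pf \<subseteq> X"
    using ConstX add mult by (intro mpolys_subset_closed is_subring_mpolyn) (auto simp: M_def)
  then show "p \<in> Pf \<Longrightarrow> \<exists>s\<in>Cs. p - \<Phi> s \<in> Kf" unfolding X_def by blast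
qed

lemma \<Gamma>_image: "\<Gamma> ` Cs = polys (polys (polys (polys (rees_eval ` Ph))))"
proof -
  note sh = is_hom_map_poly is_hom_rees_eval is_subring_polys Ph_subring
  show ?thesis unfolding \<Gamma>_def
    by (simp add: map_poly_image_polys sh)
qed

text \<open>That \<open>J\<^sub>h\<close> is of linear type describes the kernel of \<open>rees_eval\<close>; the kernel of \<open>\<Gamma>\<close> follows
  coefficientwise.\<close>

lemma \<Gamma>_kernel:
  assumes "linear_type S Jh" "s \<in> Cs" "\<Gamma> s = 0"
  shows "s \<in> polys (polys (polys (polys Kh)))"
proof -
  have 0: "{p \<in> Ph. rees_eval p = 0} \<subseteq> Kh"
    using linear_type_imp_kernel[OF is_subring_mpolyn idealJh assms(1)] by blast
  have 1: "{p \<in> polys Ph. map_poly rees_eval p = 0} \<subseteq> polys Kh"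
    by (rule order_trans[OF map_poly_kernel[OF is_hom_rees_eval] polys_mono[OF 0]])
  have 2: "{p \<in> polys (polys Ph). map_poly (map_poly rees_eval) p = 0} \<subseteq> polys (polys Kh)"
    by (rule order_trans[OF map_poly_kernel polys_mono[OF 1]]) (intro is_hom_map_poly is_hom_rees_eval)
  have 3: "{p \<in> polys (polys (polys Ph)). map_poly (map_poly (map_poly rees_eval)) p = 0} \<subseteq> polys (polys (polys Kh))"
    by (rule order_trans[OF map_poly_kernel polys_mono[OF 2]]) (intro is_hom_map_poly is_hom_rees_eval)
  have 4: "{p \<in> Cs. map_poly (map_poly (map_poly (map_poly rees_eval))) p = 0} \<subseteq> polys (polys (polys (polys Kh)))"
    by (rule order_trans[OF map_poly_kernel polys_mono[OF 3]]) (intro is_hom_map_poly is_hom_rees_eval)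
  show ?thesis using 4 assms(2,3) unfolding \<Gamma>_def by blast
qed

text \<open>If \<open>p = \<Phi>(s)\<close> modulo relations evaluates to \<open>0\<close>, then \<open>\<Gamma>(s)\<close> is in the kernel of \<open>\<Psi>\<close>, so
  \<open>s = a E' + b S' + s'\<close> with \<open>\<Gamma>(s') = 0\<close>. Each of the three terms is mapped by \<open>\<Phi>\<close> to relations: \<open>E'\<close> and \<open>S'\<close>
  because of the linear relations between \<open>u0\<close>, \<open>v0\<close> and \<open>q h\<close>, and \<open>s'\<close> because its coefficients are
  relations for \<open>J\<^sub>h\<close>.\<close>

lemma linear_type_gh:
  assumes lt: "linear_type S Jh" shows "linear_type R Jf"
proof (rule kernel_imp_linear_type[OF is_subring_mpolyn idealJf])
  fix p assume p: "p \<in> Pf" "rees_eval p = 0"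
  note Cs = is_subringD[OF Cs_subring]
  note \<Phi>h = is_homD[OF homs(2)] and \<Psi>h = is_homD[OF homs(4)] and \<Gamma>h = is_homD[OF homs(5)]
  obtain s where s: "s \<in> Cs" "p - \<Phi> s \<in> Kf" using \<Phi>_surjective_mod_relations[OF p(1)] by blast
  have "rees_eval (\<Phi> s) = rees_eval p - rees_eval (p - \<Phi> s)" by (simp add: is_homD[OF is_hom_rees_eval])
  then have "rees_eval (\<Phi> s) = 0" using p(2) rees_eval_sym_ideal[OF is_subring_mpolyn idealJf s(2)] by simp
  then have \<Psi>0: "\<Psi> (\<Gamma> s) = 0" by (simp add: rees_eval_\<Phi>)
  define A where "A = rees_eval ` Ph"
  define E' where "E' = ([:[:0, 1:]:] * [:[:[:0, 1:]:]:] + [:0, 1:] * [:[:[:[:0, 1:]:]:]:] - [:[:[:[:Var h:]:]:]:] ::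
     ((nat, 'k) mpoly, (nat, 'k) mpoly) mpoly poly poly poly poly)"
  define S' where "S' = ([:0, 1:] ^ (d - 1) * [:[:[:0, 1:]:]:] + [:[:0, 1:]:] ^ (m - 1) * [:[:[:[:Const \<eta>:]:]:]:] * [:[:[:[:0, 1:]:]:]:] ::
     ((nat, 'k) mpoly, (nat, 'k) mpoly) mpoly poly poly poly poly)"
  have hP: "Var h \<in> Ph" using h_in_Jh by (rule Var_in_mpolys[OF is_subring_mpolyn])
  have \<eta>P: "Const \<eta> \<in> Ph" by (intro Const_in_mpolys is_subring_mpolyn is_subringD[OF is_subring_mpolyn] hS)
  have ES: "E' \<in> Cs" "S' \<in> Cs" unfolding E'_def S'_def by (intro Cs Cs_generators hP \<eta>P)+
  have A: "is_subring A" unfolding A_def by (rule is_subring_image[OF is_hom_rees_eval Ph_subring])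
  have "A \<subseteq> polys S"
  proof -
    have "Ph \<subseteq> {p. rees_eval p \<in> polys S}"
      using ideal_inD(1)[OF is_subring_mpolyn idealJh] is_subringD(2)[OF is_subring_mpolyn[of "n - 2"]]
      by (intro mpolys_subset_closed is_subring_mpolyn)
        (auto simp: rees_eval_Const rees_eval_Var pCons_in_polys_iff is_homD[OF is_hom_rees_eval] polys_def[of S, THEN eqset_imp_iff, of 0]
          intro: is_subringD[OF is_subring_polys[OF is_subring_mpolyn]])
    then show ?thesis unfolding A_def by blast
  qed
  have GE: "\<Gamma> E' = [:[:0, 1:]:] * [:[:[:0, 1:]:]:] + [:0, 1:] * [:[:[:[:0, 1:]:]:]:] - [:[:[:[:[:0, h:]:]:]:]:]"
    unfolding E'_def \<Gamma>h \<Gamma>_generators rees_eval_Var by (rule refl)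
  have GS: "\<Gamma> S' = [:0, 1:] ^ (d - 1) * [:[:[:0, 1:]:]:] + [:[:0, 1:]:] ^ (m - 1) * [:[:[:[:[:\<eta>:]:]:]:]:] * [:[:[:[:0, 1:]:]:]:]"
    unfolding S'_def \<Gamma>h \<Gamma>_generators rees_eval_Const by (rule refl)
  have \<pi>v: "\<pi> [:0, a:] = [:0, q * a:]" "\<pi> [:a:] = [:a:]" for a
    by (simp_all add: \<pi>_def evalp_pCons[OF is_hom_const_poly] evalp_0 mult.commute)
  have "\<Psi> (\<Gamma> E') = [:0, y * u0 + z * v0 - q * h:]"
    unfolding GE \<Psi>h \<Psi>_generators \<pi>v by simp
  then have \<Psi>E: "\<Psi> (\<Gamma> E') = 0" unfolding u0_v0_relations by simp
  have "\<Psi> (\<Gamma> S') = [:0, z ^ (d - 1) * u0 + (y ^ (m - 1) * \<eta>) * v0:]"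
    unfolding GS \<Psi>h \<Psi>_generators \<pi>v by (simp add: is_homD(7)[OF is_hom_const_poly, symmetric])
  then have \<Psi>S: "\<Psi> (\<Gamma> S') = 0" unfolding u0_v0_relations by simp
  have "\<Gamma> s \<in> ideal2 (polys (polys (polys (polys A)))) (\<Gamma> E') (\<Gamma> S')"
    unfolding GE GS
  proof (rule kernel_in_four_variables[OF A])
    show "[:\<eta>:] \<in> A" "[:0, h:] \<in> A"
      using \<eta>P hP rees_eval_Const[of \<eta>] rees_eval_Var[of h] unfolding A_def by (metis imageI)+
    show "[:\<eta>:] \<noteq> 0" "[:0, h:] \<noteq> 0" using h_nonzero by simp_all
    show "2 \<le> d" "1 \<le> m" using md m1 by auto
    show "is_hom \<Psi>" by (rule homs)
    show "\<Gamma> s \<in> polys (polys (polys (polys A)))" using s(1) \<Gamma>_image unfolding A_def by blast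
  qed (use \<Psi>0 \<Psi>E \<Psi>S \<Psi>_injective[OF \<open>A \<subseteq> polys S\<close>] in \<open>auto simp only: GE GS\<close>)
  then obtain a b where ab: "a \<in> Cs" "b \<in> Cs" "\<Gamma> s = \<Gamma> a * \<Gamma> E' + \<Gamma> b * \<Gamma> S'"
    unfolding A_def \<Gamma>_image[symmetric] ideal2_def by auto
  define s' where "s' = s - (a * E' + b * S')"
  have s'C: "s' \<in> Cs" unfolding s'_def by (intro Cs s ab ES)
  have s'0: "\<Gamma> s' = 0" unfolding s'_def by (simp add: \<Gamma>h ab(3))
  have s'K: "\<Phi> s' \<in> Kf" by (rule \<Phi>_maps[OF Kf_ideal rescale_sym_ideal \<Gamma>_kernel[OF lt s'C s'0]])
  have \<Phi>E: "\<Phi> E' \<in> Kf"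
  proof -
    have "\<Phi> E' = Const y * Var u0 + Const z * Var v0 - Var (y * u0 + z * v0)"
      unfolding E'_def \<Phi>h \<Phi>_generators rescale_generators u0_v0_relations by (rule refl)
    then show ?thesis using sym_ideal_linear[OF is_subring_mpolyn idealJf yR zR u0_in_Jf v0_in_Jf] by simp
  qed
  have \<Phi>S: "\<Phi> S' \<in> Kf"
  proof -
    have "\<Phi> S' = Const (z ^ (d - 1)) * Var u0 + Const (y ^ (m - 1) * \<eta>) * Var v0"
      unfolding S'_def \<Phi>h \<Phi>_generators rescale_generators by (simp only: is_homD(4,7)[OF is_hom_Const])
    moreover have "Const (z ^ (d - 1)) * Var u0 + Const (y ^ (m - 1) * \<eta>) * Var v0 - Var 0 \<in> Kf"
    proof -
      have "z ^ (d - 1) \<in> R" "y ^ (m - 1) * \<eta> \<in> R" by (intro Rs zR yR hR)+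
      from sym_ideal_linear[OF is_subring_mpolyn idealJf this u0_in_Jf v0_in_Jf]
      show ?thesis unfolding u0_v0_relations .
    qed
    ultimately show ?thesis
      using Kf(3)[OF _ sym_ideal_Var_0[OF is_subring_mpolyn idealJf]] by fastforce
  qed
  have "\<Phi> s = \<Phi> s' + (\<Phi> a * \<Phi> E' + \<Phi> b * \<Phi> S')" unfolding s'_def by (simp add: \<Phi>h)
  also have "\<dots> \<in> Kf" by (intro Kf(3,4) s'K \<Phi>E \<Phi>S \<Phi>_closed ab)
  finally have "(p - \<Phi> s) + \<Phi> s \<in> Kf" by (intro Kf(3) s(2))
  then show "p \<in> sym_ideal R Jf" by simp
qed

end

theorem theorem2p12:
  fixes n d m :: nat
    and g h f :: "(nat, 'k::{alg_closed_field, field_char_0}) mpoly"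
  assumes "n \<ge> 3" and "d > m" and "m \<ge> 1" and "d - m \<ge> 2"
    and "h \<in> carrier (mpoly_ring (n - 2))"
    and "squarefree_in (mpoly_ring (n - 2)) h"
    and "homogeneous (d - m) h"
    and g: "g = Var n ^ d - Var (n - 1) ^ m * h"
    and f: "f = g * h"
  shows "nonfree_divisor n g \<and>
    (free_divisor (n - 2) h \<longrightarrow>
       free_divisor n f \<and>
       (linear_type (carrier (mpoly_ring (n - 2))) (gradient_ideal (n - 2) h) \<longrightarrow>
        linear_type (carrier (mpoly_ring n)) (gradient_ideal n f)))"
proof -
  interpret cone_family n d m h
    by unfold_locales (use assms in \<open>simp_all add: carrier_mpoly_ring\<close>)
  have "g = local.g" unfolding g g_def ..
  then show ?thesis
    unfolding f carrier_mpoly_ring using nonfree_g free_gh linear_type_gh by blast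
qed

end
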